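(* Let $M$ be a $C^{2,1}$ manifold endowed with a $C^{1,1}$ Lorentzian metric $g$ and corresponding locally Lipschitz Levi-Civita connection. Let $p\in M$. Then there is a local base $\{C_i\}$ for the topology at $p$ such that for every $i$, $C_i$ is strictly convex normal, globally hyperbolic, $\bar C_{i+1}\subset C_i$, and $C_{i+1}$ is causally convex in $C_i$ (and hence in $C_1$).
   Context: $C^{k,1}$ means $C^{k,1}_{loc}$. $M$ is an $n$-dimensional paracompact connected $C^{2,1}$ manifold, with $g$ of signature $(-,+,\dots,+)$ and time oriented by a global continuous timelike vector field. A non-vanishing vector $v$ is causal if $g(v,v)\le0$ and timelike if $g(v,v)<0$. Geodesics are the non-stationary solutions of $\ddot x^\mu=-\Gamma^\mu_{\alpha\beta}(x)\dot x^\alpha\dot x^\beta$, with $\Gamma$ the Christoffel symbols; $\gamma_v$ is the unique solution with initial velocity $v$, $\Omega_q\subset T_qM$ is the set of $v\in T_qM$ for which $\gamma_v$ is defined at least on $[0,1]$, and $\exp_qv:=\gamma_v(1)$. An open set $C\subset M$ is convex normal if for each $q\in C$ there is an open star-shaped ($v\in N_q$, $s\in[0,1]$ imply $sv\in N_q$) set $N_q\subset\Omega_q$ such that $\exp_q\colon N_q\to C$ is a homeomorphism, locally Lipschitz with locally Lipschitz inverse; it is strictly convex normal if moreover any two points of $\bar C$ are connected by a unique geodesic contained in $C$ but for the endpoints. For $S\subset M$, $J^+_S\subset S\times S$ is the set of pairs $(x,y)$ such that either there is a future directed $C^1$ causal curve from $x$ to $y$ contained in $S$, or $x=y\in S$;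 $J^+_S(x)=\{y:(x,y)\in J^+_S\}$ and $J^-_S(y)=\{x:(x,y)\in J^+_S\}$. A subset $A\subset B$ is causally convex in $B\subset M$ if every $C^1$ causal curve contained in $B$ and joining two points of $A$ is necessarily contained in $A$. An open subset $B$ is strongly causal if every point of $B$ admits arbitrarily small open neighborhoods which are causally convex in $B$. An open subset $S$ is causally simple if it is strongly causal and $J^+_S$ is closed in $S\times S$. A causally simple subset $S$ is globally hyperbolic if for every $x,y\in S$, $J^+_S(x)\cap J^-_S(y)$ is compact. *)

theory Defs
  imports "HOL-Analysis.Analysis"
begin

section \<open>Regularity classes on open subsets of Euclidean space\<close>

definition loc_lipschitz_on :: "'a::metric_space set \<Rightarrow> ('a \<Rightarrow> 'b::metric_space) \<Rightarrow> bool" where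
  "loc_lipschitz_on S f \<longleftrightarrow> (\<forall>x\<in>S. \<exists>r>0. \<exists>L. L-lipschitz_on (cball x r \<inter> S) f)"

text \<open>The class \<open>C\<^sup>k\<^sup>,\<^sup>1\<close> (always understood locally) on an open set. The derivative of order
  \<open>k\<close> is expressed through iterated directional derivatives.\<close>

primrec Ck1_on :: "nat \<Rightarrow> 'a::euclidean_space set \<Rightarrow> ('a \<Rightarrow> 'b::real_normed_vector) \<Rightarrow> bool" where
  "Ck1_on 0 S f \<longleftrightarrow> loc_lipschitz_on S f"
| "Ck1_on (Suc k) S f \<longleftrightarrow>
     (\<forall>x\<in>S. f differentiable (at x)) \<and>
     (\<forall>v. Ck1_on k S (\<lambda>x. frechet_derivative f (at x) v))"


section \<open>Manifolds of class \<open>C\<^sup>2\<^sup>,\<^sup>1\<close>\<close>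

text \<open>The manifold is a Hausdorff topological type \<open>'a\<close>; its dimension is \<open>CARD('n)\<close>. A chart is a
  pair of a domain and a map, whose values outside the domain are irrelevant. An atlas need not be
  maximal.\<close>

type_synonym ('a, 'n) chart = "'a set \<times> ('a \<Rightarrow> real^'n)"

definition chart_inv :: "('a, 'n) chart \<Rightarrow> real^'n \<Rightarrow> 'a" where
  "chart_inv c = inv_into (fst c) (snd c)"

definition C21_atlas :: "('a::topological_space, 'n::finite) chart set \<Rightarrow> bool" where
  "C21_atlas A \<longleftrightarrow>
     (\<Union>c\<in>A. fst c) = UNIV \<and>
     (\<forall>c\<in>A. open (fst c) \<and> open (snd c ` fst c) \<and>
        homeomorphism (fst c) (snd c ` fst c) (snd c) (chart_inv c)) \<and>
     (\<forall>c\<in>A. \<forall>c'\<in>A. Ck1_on 2 (snd c ` (fst c \<inter> fst c')) (snd c' \<circ> chart_inv c))"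

definition paracompact :: "'a::topological_space itself \<Rightarrow> bool" where
  "paracompact _ \<longleftrightarrow>
     (\<forall>\<U>::'a set set. (\<forall>U\<in>\<U>. open U) \<and> \<Union>\<U> = UNIV \<longrightarrow>
        (\<exists>\<V>. (\<forall>V\<in>\<V>. open V) \<and> \<Union>\<V> = UNIV \<and> (\<forall>V\<in>\<V>. \<exists>U\<in>\<U>. V \<subseteq> U) \<and>
             locally_finite_in euclidean \<V>))"

definition C21_manifold :: "('a::t2_space, 'n::finite) chart set \<Rightarrow> bool" where
  "C21_manifold A \<longleftrightarrow> C21_atlas A \<and> connected (UNIV :: 'a set) \<and> paracompact TYPE('a)"


section \<open>Tangent vectors\<close>

text \<open>A tangent vector at \<open>q\<close> is the family of its component vectors in all charts around \<open>q\<close>, any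
  two of which are related by the derivative of the transition map (and it is zero at all other
  indices). The vector space operations are pointwise, and the tangent space carries the
  subspace topology of the product topology: evaluation at a chart around \<open>q\<close> is a linear
  homeomorphism onto \<open>real^'n\<close>, with inverse \<open>tvec A c q\<close>.\<close>

type_synonym ('a, 'n) tvector = "('a, 'n) chart \<Rightarrow> real^'n"

definition change_of_chart ::
  "('a, 'n::finite) chart \<Rightarrow> ('a, 'n) chart \<Rightarrow> 'a \<Rightarrow> real^'n \<Rightarrow> real^'n" where
  "change_of_chart c c' q = frechet_derivative (snd c' \<circ> chart_inv c) (at (snd c q))"

definition tangent_space :: "('a, 'n::finite) chart set \<Rightarrow> 'a \<Rightarrow> ('a, 'n) tvector set" where
  "tangent_space A q =
     {v. (\<forall>c. \<not> (c \<in> A \<and> q \<in> fst c) \<longrightarrow> v c = 0) \<and>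
         (\<forall>c\<in>A. \<forall>c'\<in>A. q \<in> fst c \<and> q \<in> fst c' \<longrightarrow> v c' = change_of_chart c c' q (v c))}"

definition tvec :: "('a, 'n::finite) chart set \<Rightarrow> ('a, 'n) chart \<Rightarrow> 'a \<Rightarrow> real^'n \<Rightarrow> ('a, 'n) tvector"
  where
  "tvec A c q u = (\<lambda>c'. if c' \<in> A \<and> q \<in> fst c' then change_of_chart c c' q u else 0)"

text \<open>Velocities are taken relative to the parameter interval \<open>I\<close>, hence are one-sided at its
  endpoints.\<close>

definition velocity ::
  "('a, 'n::finite) chart set \<Rightarrow> real set \<Rightarrow> (real \<Rightarrow> 'a) \<Rightarrow> real \<Rightarrow> ('a, 'n) tvector" where
  "velocity A I \<gamma> t =
     (\<lambda>c. if c \<in> A \<and> \<gamma> t \<in> fst c then vector_derivative (snd c \<circ> \<gamma>) (at t within I) else 0)"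

definition C1_curve_on ::
  "('a::topological_space, 'n::finite) chart set \<Rightarrow> real set \<Rightarrow> (real \<Rightarrow> 'a) \<Rightarrow> bool" where
  "C1_curve_on A I \<gamma> \<longleftrightarrow>
     continuous_on I \<gamma> \<and>
     (\<forall>c\<in>A. (\<forall>t \<in> {t\<in>I. \<gamma> t \<in> fst c}. (snd c \<circ> \<gamma>) differentiable (at t within I)) \<and>
            continuous_on {t\<in>I. \<gamma> t \<in> fst c} (\<lambda>t. velocity A I \<gamma> t c))"


section \<open>Lorentzian metrics and time orientation\<close>

type_synonym ('a, 'n) metric = "'a \<Rightarrow> ('a, 'n) tvector \<Rightarrow> ('a, 'n) tvector \<Rightarrow> real"

text \<open>The components \<open>g\<^sub>i\<^sub>j\<close> in the chart \<open>c\<close>, at the coordinate point \<open>x\<close>.\<close>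

definition metric_comp ::
  "('a, 'n::finite) chart set \<Rightarrow> ('a, 'n) metric \<Rightarrow> ('a, 'n) chart \<Rightarrow> real^'n \<Rightarrow> real^'n^'n" where
  "metric_comp A g c x =
     (\<chi> i j. g (chart_inv c x) (tvec A c (chart_inv c x) (axis i 1)) (tvec A c (chart_inv c x) (axis j 1)))"

text \<open>Bilinearity on the tangent space is expressed by means of the linear isomorphisms
  \<open>tvec A c q\<close>; the signature by the existence of an orthonormal frame with exactly one timelike
  member (an orthonormal family of \<open>CARD('n)\<close> vectors is a basis).\<close>

definition C11_lorentzian_metric ::
  "('a::topological_space, 'n::finite) chart set \<Rightarrow> ('a, 'n) metric \<Rightarrow> bool" where
  "C11_lorentzian_metric A g \<longleftrightarrow>
     (\<forall>q. \<forall>c\<in>A. q \<in> fst c \<longrightarrow> bilinear (\<lambda>u w. g q (tvec A c q u) (tvec A c q w))) \<and>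
     (\<forall>q. \<forall>v\<in>tangent_space A q. \<forall>w\<in>tangent_space A q. g q v w = g q w v) \<and>
     (\<forall>q. \<exists>e :: 'n \<Rightarrow> ('a, 'n) tvector. \<exists>k.
        (\<forall>i. e i \<in> tangent_space A q) \<and>
        (\<forall>i j. g q (e i) (e j) = (if i = j then (if i = k then -1 else 1) else 0))) \<and>
     (\<forall>c\<in>A. \<forall>i j. Ck1_on 1 (snd c ` fst c) (\<lambda>x. metric_comp A g c x $ i $ j))"

definition causal_vector :: "('a, 'n) metric \<Rightarrow> 'a \<Rightarrow> ('a, 'n::finite) tvector \<Rightarrow> bool" where
  "causal_vector g q v \<longleftrightarrow> v \<noteq> (\<lambda>_. 0) \<and> g q v v \<le> 0"

definition timelike_vector :: "('a, 'n) metric \<Rightarrow> 'a \<Rightarrow> ('a, 'n::finite) tvector \<Rightarrow> bool" where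
  "timelike_vector g q v \<longleftrightarrow> v \<noteq> (\<lambda>_. 0) \<and> g q v v < 0"

definition time_orientation ::
  "('a::topological_space, 'n::finite) chart set \<Rightarrow> ('a, 'n) metric \<Rightarrow> ('a \<Rightarrow> ('a, 'n) tvector) \<Rightarrow> bool"
  where
  "time_orientation A g T \<longleftrightarrow>
     (\<forall>q. T q \<in> tangent_space A q \<and> timelike_vector g q (T q)) \<and>
     (\<forall>c\<in>A. continuous_on (fst c) (\<lambda>q. T q c))"


section \<open>Geodesics and the exponential map\<close>

definition partial_deriv :: "'n \<Rightarrow> (real^'n \<Rightarrow> real) \<Rightarrow> real^'n \<Rightarrow> real" where
  "partial_deriv i f x = frechet_derivative f (at x) (axis i 1)"

text \<open>\<open>christoffel A g c x k i j\<close> is \<open>\<Gamma>\<^sup>k\<^sub>i\<^sub>j\<close> in the chart \<open>c\<close>, at the coordinate point \<open>x\<close>.\<close>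

definition christoffel ::
  "('a, 'n::finite) chart set \<Rightarrow> ('a, 'n) metric \<Rightarrow> ('a, 'n) chart \<Rightarrow> real^'n \<Rightarrow> 'n \<Rightarrow> 'n \<Rightarrow> 'n \<Rightarrow> real"
  where
  "christoffel A g c x k i j =
     (let G = metric_comp A g c in
      1/2 * (\<Sum>l\<in>UNIV. matrix_inv (G x) $ k $ l *
        (partial_deriv i (\<lambda>y. G y $ j $ l) x + partial_deriv j (\<lambda>y. G y $ i $ l) x
          - partial_deriv l (\<lambda>y. G y $ i $ j) x)))"

text \<open>Solutions of the geodesic equation on the interval \<open>I\<close>, stationary ones included.\<close>

definition geodesic_solution ::
  "('a::topological_space, 'n::finite) chart set \<Rightarrow> ('a, 'n) metric \<Rightarrow> real set \<Rightarrow> (real \<Rightarrow> 'a) \<Rightarrow> bool"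
  where
  "geodesic_solution A g I \<gamma> \<longleftrightarrow>
     continuous_on I \<gamma> \<and>
     (\<forall>c\<in>A. \<forall>t\<in>I. \<gamma> t \<in> fst c \<longrightarrow>
        (snd c \<circ> \<gamma>) differentiable (at t within I) \<and>
        ((\<lambda>s. velocity A I \<gamma> s c) has_vector_derivative
           (\<chi> k. - (\<Sum>i\<in>UNIV. \<Sum>j\<in>UNIV. christoffel A g c (snd c (\<gamma> t)) k i j *
                      velocity A I \<gamma> t c $ i * velocity A I \<gamma> t c $ j)))
          (at t within I))"

definition geodesic ::
  "('a::topological_space, 'n::finite) chart set \<Rightarrow> ('a, 'n) metric \<Rightarrow> real set \<Rightarrow> (real \<Rightarrow> 'a) \<Rightarrow> bool"
  where
  "geodesic A g I \<gamma> \<longleftrightarrow> geodesic_solution A g I \<gamma> \<and> \<not> \<gamma> constant_on I"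

definition solution_with_velocity ::
  "('a::topological_space, 'n::finite) chart set \<Rightarrow> ('a, 'n) metric \<Rightarrow> 'a \<Rightarrow> ('a, 'n) tvector \<Rightarrow>
     (real \<Rightarrow> 'a) \<Rightarrow> bool" where
  "solution_with_velocity A g q v \<gamma> \<longleftrightarrow>
     geodesic_solution A g {0..1} \<gamma> \<and> \<gamma> 0 = q \<and> velocity A {0..1} \<gamma> 0 = v"

definition exp_domain ::
  "('a::topological_space, 'n::finite) chart set \<Rightarrow> ('a, 'n) metric \<Rightarrow> 'a \<Rightarrow> ('a, 'n) tvector set" where
  "exp_domain A g q = {v \<in> tangent_space A q. \<exists>\<gamma>. solution_with_velocity A g q v \<gamma>}"

definition geod_exp ::
  "('a::topological_space, 'n::finite) chart set \<Rightarrow> ('a, 'n) metric \<Rightarrow> 'a \<Rightarrow> ('a, 'n) tvector \<Rightarrow> 'a" where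
  "geod_exp A g q v = (THE y. \<exists>\<gamma>. solution_with_velocity A g q v \<gamma> \<and> \<gamma> 1 = y)"


section \<open>Convex normal sets\<close>

text \<open>Local Lipschitz continuity of maps between a tangent space and the manifold means local
  Lipschitz continuity of all coordinate expressions.\<close>

definition loc_lipschitz_from_tangent ::
  "('a::topological_space, 'n::finite) chart set \<Rightarrow> 'a \<Rightarrow> ('a, 'n) tvector set \<Rightarrow>
     (('a, 'n) tvector \<Rightarrow> 'a) \<Rightarrow> bool" where
  "loc_lipschitz_from_tangent A q N f \<longleftrightarrow>
     (\<forall>c\<in>A. \<forall>c'\<in>A. q \<in> fst c \<longrightarrow>
        loc_lipschitz_on {u. tvec A c q u \<in> N \<and> f (tvec A c q u) \<in> fst c'}
          (\<lambda>u. snd c' (f (tvec A c q u))))"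

definition loc_lipschitz_to_tangent ::
  "('a::topological_space, 'n::finite) chart set \<Rightarrow> 'a \<Rightarrow> 'a set \<Rightarrow> ('a \<Rightarrow> ('a, 'n) tvector) \<Rightarrow> bool"
  where
  "loc_lipschitz_to_tangent A q C h \<longleftrightarrow>
     (\<forall>c\<in>A. \<forall>c'\<in>A. q \<in> fst c \<longrightarrow>
        loc_lipschitz_on (snd c' ` (C \<inter> fst c')) (\<lambda>x. h (chart_inv c' x) c))"

definition convex_normal ::
  "('a::topological_space, 'n::finite) chart set \<Rightarrow> ('a, 'n) metric \<Rightarrow> 'a set \<Rightarrow> bool" where
  "convex_normal A g C \<longleftrightarrow>
     open C \<and>
     (\<forall>q\<in>C. \<exists>N. openin (top_of_set (tangent_space A q)) N \<and>
        (\<forall>v\<in>N. \<forall>s\<in>{0..1}. (\<lambda>c. s *\<^sub>R v c) \<in> N) \<and>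
        N \<subseteq> exp_domain A g q \<and>
        (\<exists>h. homeomorphism N C (geod_exp A g q) h \<and>
             loc_lipschitz_from_tangent A q N (geod_exp A g q) \<and>
             loc_lipschitz_to_tangent A q C h))"

text \<open>Geodesics are affinely parametrized, so a geodesic segment joining \<open>x\<close> to \<open>y\<close> has exactly
  one affine parametrization on the unit interval; uniqueness refers to the values there. The two
  endpoints are distinct.\<close>

definition inner_geodesic ::
  "('a::topological_space, 'n::finite) chart set \<Rightarrow> ('a, 'n) metric \<Rightarrow> 'a set \<Rightarrow> 'a \<Rightarrow> 'a \<Rightarrow>
     (real \<Rightarrow> 'a) \<Rightarrow> bool" where
  "inner_geodesic A g C x y \<gamma> \<longleftrightarrow>
     geodesic A g {0..1} \<gamma> \<and> \<gamma> 0 = x \<and> \<gamma> 1 = y \<and> \<gamma> ` {0<..<1} \<subseteq> C"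

definition strictly_convex_normal ::
  "('a::topological_space, 'n::finite) chart set \<Rightarrow> ('a, 'n) metric \<Rightarrow> 'a set \<Rightarrow> bool" where
  "strictly_convex_normal A g C \<longleftrightarrow>
     convex_normal A g C \<and>
     (\<forall>x\<in>closure C. \<forall>y\<in>closure C. x \<noteq> y \<longrightarrow>
        (\<exists>\<gamma>. inner_geodesic A g C x y \<gamma> \<and>
             (\<forall>\<gamma>'. inner_geodesic A g C x y \<gamma>' \<longrightarrow> (\<forall>t\<in>{0..1}. \<gamma>' t = \<gamma> t))))"


section \<open>Causality\<close>

definition causal_curve ::
  "('a::topological_space, 'n::finite) chart set \<Rightarrow> ('a, 'n) metric \<Rightarrow> real \<Rightarrow> real \<Rightarrow> (real \<Rightarrow> 'a) \<Rightarrow> bool"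
  where
  "causal_curve A g a b \<gamma> \<longleftrightarrow>
     a < b \<and> C1_curve_on A {a..b} \<gamma> \<and>
     (\<forall>t\<in>{a..b}. causal_vector g (\<gamma> t) (velocity A {a..b} \<gamma> t))"

text \<open>The field \<open>T\<close> is future directed, hence, with signature \<open>(-,+,\<dots>,+)\<close>, a causal vector is future
  directed iff its product with \<open>T\<close> is negative.\<close>

definition future_causal_curve ::
  "('a::topological_space, 'n::finite) chart set \<Rightarrow> ('a, 'n) metric \<Rightarrow> ('a \<Rightarrow> ('a, 'n) tvector) \<Rightarrow>
     real \<Rightarrow> real \<Rightarrow> (real \<Rightarrow> 'a) \<Rightarrow> bool" where
  "future_causal_curve A g T a b \<gamma> \<longleftrightarrow>
     causal_curve A g a b \<gamma> \<and>
     (\<forall>t\<in>{a..b}. g (\<gamma> t) (velocity A {a..b} \<gamma> t) (T (\<gamma> t)) < 0)"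

definition Jplus ::
  "('a::topological_space, 'n::finite) chart set \<Rightarrow> ('a, 'n) metric \<Rightarrow> ('a \<Rightarrow> ('a, 'n) tvector) \<Rightarrow>
     'a set \<Rightarrow> ('a \<times> 'a) set" where
  "Jplus A g T S =
     {(x, y). x \<in> S \<and> y \<in> S \<and>
        (x = y \<or> (\<exists>a b \<gamma>. future_causal_curve A g T a b \<gamma> \<and> \<gamma> a = x \<and> \<gamma> b = y \<and> \<gamma> ` {a..b} \<subseteq> S))}"

definition causally_convex ::
  "('a::topological_space, 'n::finite) chart set \<Rightarrow> ('a, 'n) metric \<Rightarrow> 'a set \<Rightarrow> 'a set \<Rightarrow> bool" where
  "causally_convex A g U B \<longleftrightarrow>
     U \<subseteq> B \<and>
     (\<forall>a b \<gamma>. causal_curve A g a b \<gamma> \<and> \<gamma> ` {a..b} \<subseteq> B \<and> \<gamma> a \<in> U \<and> \<gamma> b \<in> U \<longrightarrow> \<gamma> ` {a..b} \<subseteq> U)"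

definition strongly_causal ::
  "('a::topological_space, 'n::finite) chart set \<Rightarrow> ('a, 'n) metric \<Rightarrow> 'a set \<Rightarrow> bool" where
  "strongly_causal A g B \<longleftrightarrow>
     open B \<and>
     (\<forall>x\<in>B. \<forall>W. open W \<and> x \<in> W \<longrightarrow> (\<exists>V. open V \<and> x \<in> V \<and> V \<subseteq> W \<and> causally_convex A g V B))"

definition causally_simple ::
  "('a::topological_space, 'n::finite) chart set \<Rightarrow> ('a, 'n) metric \<Rightarrow> ('a \<Rightarrow> ('a, 'n) tvector) \<Rightarrow>
     'a set \<Rightarrow> bool" where
  "causally_simple A g T S \<longleftrightarrow>
     open S \<and> strongly_causal A g S \<and> closedin (top_of_set (S \<times> S)) (Jplus A g T S)"

definition globally_hyperbolic ::
  "('a::topological_space, 'n::finite) chart set \<Rightarrow> ('a, 'n) metric \<Rightarrow> ('a \<Rightarrow> ('a, 'n) tvector) \<Rightarrow>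
     'a set \<Rightarrow> bool" where
  "globally_hyperbolic A g T S \<longleftrightarrow>
     causally_simple A g T S \<and>
     (\<forall>x\<in>S. \<forall>y\<in>S. compact ({z. (x, z) \<in> Jplus A g T S} \<inter> {z. (z, y) \<in> Jplus A g T S}))"

definition local_base_at :: "'a::topological_space \<Rightarrow> (nat \<Rightarrow> 'a set) \<Rightarrow> bool" where
  "local_base_at p C \<longleftrightarrow>
     (\<forall>i. open (C i) \<and> p \<in> C i) \<and> (\<forall>U. open U \<and> p \<in> U \<longrightarrow> (\<exists>i. C i \<subseteq> U))"

end

theory Submission
  imports Defs
begin

text \<open>All sets \<open>C\<^sub>i\<close> lie in one chart around \<open>p\<close>. There the geodesics are the solutions of
\<open>x' = u\<close>, \<open>u' = S x u\<close>, where the spray \<open>S\<close> is locally Lipschitz in \<open>x\<close> and quadratic in \<open>u\<close>.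

\<^emph>\<open>Geodesics.\<close> One perturbation estimate, \<open>spray_solutions_close\<close>, does most of the work: over the
unit interval, the difference of two slow solutions is affine up to a small multiple of the
difference of the initial data. It shows that slow geodesics are determined by their initial velocity
and by their two endpoints, with Lipschitz dependence both ways. Existence for given endpoints is a
fixed point argument (\<open>spray_solution_joining\<close>). Thus the inverse of the exponential map is
constructed directly as an injective continuous map, and its image is open by invariance of domain;
the exponential map itself is never differentiated.

\<^emph>\<open>The neighbourhoods.\<close> Choose a covector \<open>\<tau>\<close> that is uniformly positive on future directed causal
vectors near \<open>p\<close>, and let the lens with centre \<open>q\<close> be the set where the two barriers
\<open>\<plusminus> \<tau> \<bullet> (z - q) + a |z - q|\<^sup>2\<close> are less than \<open>\<epsilon>\<close>. If \<open>a\<close> dominates the Christoffel symbols, then the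
barriers with centre \<open>p\<close> are strictly convex along geodesics, so that geodesics between points of a
closed lens run inside the lens. If the lens is small enough relative to \<open>1/a\<close>, then the differentials of
the barriers are timelike: along a future directed causal curve one barrier increases and the other
decreases. Hence a causal curve with endpoints in a lens stays in the lens. For the common centre \<open>p\<close>
this is the causal convexity of each \<open>C\<^sub>i\<close> in the larger ones; for other centres it is strong
causality. It also puts the causal diamond of \<open>x\<close> and \<open>y\<close> into a compact part of the lens, where
the barriers do not exceed their values at \<open>y\<close> and at \<open>x\<close>, respectively.

\<^emph>\<open>Closedness of the causal relation.\<close> The main point is that the endpoints of a causal curve are
joined by a causal geodesic. The Gauss lemma cannot be obtained by differentiating the exponential
map, which is only Lipschitz. Instead, let \<open>energy x y\<close> be the square \<open>g(P,P)\<close> of the final velocity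
\<open>P\<close> of the geodesic from \<open>x\<close> to \<open>y\<close>. The first variation formula (\<open>first_variation\<close>) needs
only that geodesics depend on their endpoints in a Lipschitz way, and yields that \<open>energy x\<close> has
derivative \<open>2 g(P, \<cdot>)\<close>. So the energy decreases along every future directed causal curve that starts
in the timelike future of \<open>x\<close>, and such a curve cannot leave it. For a causal curve that starts
at \<open>x\<close> itself, push the base point slightly into the past and pass to the limit. The causal relation
of a lens is therefore given by two weak inequalities for the initial velocity of the connecting
geodesic, which depends continuously on the two points (\<open>causal_pair\<close>).

\<^emph>\<open>Passage to the manifold.\<close> Geodesics and the exponential map refer to all charts. Written with
the metric instead of its inverse, the geodesic equation is an Euler--Lagrange equation; its
invariance under changes of charts then follows from the symmetry of the second derivatives of the
transition maps (\<open>spray_change_of_chart\<close>).\<close>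

section \<open>Calculus on an interval\<close>

lemma vector_derivative_lipschitz:
  fixes f :: "real \<Rightarrow> 'e::real_normed_vector"
  assumes "\<And>t. t \<in> {a..b} \<Longrightarrow> (f has_vector_derivative f' t) (at t within {a..b})"
    and "\<And>t. t \<in> {a..b} \<Longrightarrow> norm (f' t) \<le> B"
    and "s \<in> {a..b}" "t \<in> {a..b}"
  shows "norm (f s - f t) \<le> B * \<bar>s - t\<bar>"
proof -
  have "norm (f s - f t) \<le> B * norm (s - t)"
  proof (rule differentiable_bound[where S = "{a..b}" and f' = "\<lambda>t h. h *\<^sub>R f' t"])
    show "onorm (\<lambda>h. h *\<^sub>R f' x) \<le> B" if "x \<in> {a..b}" for x
      using assms(2)[OF that] by (intro onorm_le) (auto simp: mult.commute[of B] intro: mult_left_mono)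
  qed (use assms in \<open>auto simp: has_vector_derivative_def\<close>)
  then show ?thesis by simp
qed

lemma norm_attains_sup_unit_interval:
  fixes f :: "real \<Rightarrow> 'e::real_normed_vector"
  assumes "continuous_on {0..1} f"
  obtains t0 where "t0 \<in> {0..1}" "\<And>t. t \<in> {0..1} \<Longrightarrow> norm (f t) \<le> norm (f t0)"
proof -
  have "\<exists>t0\<in>{0..1}. \<forall>t\<in>{0..1}. norm (f t) \<le> norm (f t0)"
    using assms by (intro continuous_attains_sup) (auto intro: continuous_intros)
  then show ?thesis using that by blast
qed

lemma mean_value_within:
  fixes f :: "real \<Rightarrow> real"
  assumes "\<And>r. r \<in> {a..b} \<Longrightarrow> (f has_real_derivative f' r) (at r within {a..b})"
    and "s < t" "s \<in> {a..b}" "t \<in> {a..b}"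
  shows "\<exists>\<xi>. s < \<xi> \<and> \<xi> < t \<and> \<xi> \<in> {a..b} \<and> f t - f s = (t - s) * f' \<xi>"
proof -
  have sub: "{s..t} \<subseteq> {a..b}" using assms by auto
  have "\<exists>\<xi>\<in>{s<..<t}. f t - f s = (\<lambda>h. f' \<xi> * h) (t - s)"
  proof (rule mvt_simple[OF \<open>s < t\<close>])
    fix r assume "s \<le> r" "r \<le> t"
    then have "(f has_real_derivative f' r) (at r within {s..t})"
      using assms(1)[of r] sub by (auto intro: DERIV_subset)
    then show "(f has_derivative (\<lambda>h. f' r * h)) (at r within {s..t})"
      by (simp add: has_field_derivative_def)
  qed
  then obtain \<xi> where "\<xi> \<in> {s<..<t}" "f t - f s = f' \<xi> * (t - s)" by blast
  then show ?thesis using sub by (intro exI[of _ \<xi>]) auto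
qed

lemma nondecreasing_within:
  fixes f :: "real \<Rightarrow> real"
  assumes "\<And>r. r \<in> {a..b} \<Longrightarrow> (f has_real_derivative f' r) (at r within {a..b})"
    and "\<And>r. r \<in> {a..b} \<Longrightarrow> 0 \<le> f' r"
    and "s \<le> t" "s \<in> {a..b}" "t \<in> {a..b}"
  shows "f s \<le> f t"
proof (cases "s = t")
  case False
  then obtain \<xi> where "\<xi> \<in> {a..b}" "f t - f s = (t - s) * f' \<xi>"
    using mean_value_within[OF assms(1), of s t] assms by auto
  moreover from this have "0 \<le> (t - s) * f' \<xi>" using assms by auto
  ultimately show ?thesis by simp
qed simp

text \<open>Used to propagate the time orientation of causal vectors along curves: their product with the time
orientation is continuous and never zero.\<close>

lemma nonvanishing_negative:
  fixes f :: "real \<Rightarrow> real"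
  assumes "continuous_on {a..b} f" "\<And>t. t \<in> {a..b} \<Longrightarrow> f t \<noteq> 0"
    and "s \<in> {a..b}" "f s < 0" "t \<in> {a..b}"
  shows "f t < 0"
proof (rule ccontr)
  assume "\<not> f t < 0"
  then have "0 \<le> f t" by simp
  have "connected (f ` {a..b})" using assms(1) by (intro connected_continuous_image) auto
  moreover have "f s \<in> f ` {a..b}" "f t \<in> f ` {a..b}" using assms by auto
  ultimately have "0 \<in> f ` {a..b}"
    using \<open>0 \<le> f t\<close> \<open>f s < 0\<close> unfolding connected_iff_interval by (meson less_imp_le)
  then show False using assms(2) by auto
qed

section \<open>Solutions of the geodesic equation\<close>

definition spray_solution ::
  "('e::real_normed_vector \<Rightarrow> 'e \<Rightarrow> 'e) \<Rightarrow> real set \<Rightarrow> (real \<Rightarrow> 'e) \<Rightarrow> (real \<Rightarrow> 'e) \<Rightarrow> bool" where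
  "spray_solution S I x u \<longleftrightarrow>
     (\<forall>t\<in>I. (x has_vector_derivative u t) (at t within I) \<and>
            (u has_vector_derivative S (x t) (u t)) (at t within I))"

text \<open>The form of the estimate is that of a quadratic map with coefficients that are bounded and Lipschitz
in \<open>x\<close>; one constant serves for both.\<close>

definition spray_bound ::
  "('e::real_normed_vector \<Rightarrow> 'e \<Rightarrow> 'e) \<Rightarrow> 'e set \<Rightarrow> real \<Rightarrow> bool" where
  "spray_bound S U K \<longleftrightarrow>
     0 \<le> K \<and> (\<forall>x\<in>U. \<forall>u s. S x (s *\<^sub>R u) = s\<^sup>2 *\<^sub>R S x u) \<and>
     (\<forall>x\<in>U. \<forall>y\<in>U. \<forall>u v \<rho>. norm u \<le> \<rho> \<longrightarrow> norm v \<le> \<rho> \<longrightarrow>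
        norm (S x u - S y v) \<le> K * (\<rho>\<^sup>2 * norm (x - y) + \<rho> * norm (u - v)))"

lemma spray_boundD:
  assumes "spray_bound S U K" "x \<in> U" "y \<in> U" "norm u \<le> \<rho>" "norm v \<le> \<rho>"
  shows "norm (S x u - S y v) \<le> K * (\<rho>\<^sup>2 * norm (x - y) + \<rho> * norm (u - v))"
  using assms unfolding spray_bound_def by blast

lemma spray_bound_subset: "spray_bound S U K \<Longrightarrow> V \<subseteq> U \<Longrightarrow> spray_bound S V K"
  unfolding spray_bound_def by blast

lemma spray_bound_zero: "spray_bound S U K \<Longrightarrow> x \<in> U \<Longrightarrow> S x 0 = 0"
  unfolding spray_bound_def by (metis power_zero_numeral scaleR_zero_left)

lemma spray_bound_norm:
  assumes "spray_bound S U K" "x \<in> U" "norm u \<le> \<rho>"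
  shows "norm (S x u) \<le> K * \<rho>\<^sup>2"
proof -
  have "0 \<le> K" using assms(1) by (simp add: spray_bound_def)
  have "norm (S x u - S x 0) \<le> K * ((norm u)\<^sup>2 * norm (x - x) + norm u * norm (u - 0))"
    using assms(1,2) unfolding spray_bound_def by (metis norm_ge_zero norm_zero order_refl)
  then have "norm (S x u) \<le> K * (norm u)\<^sup>2"
    by (simp add: spray_bound_zero[OF assms(1,2)] power2_eq_square)
  also have "\<dots> \<le> K * \<rho>\<^sup>2"
    using \<open>0 \<le> K\<close> assms(3) by (intro mult_left_mono power_mono) auto
  finally show ?thesis .
qed

lemma spray_solution_continuous:
  assumes "spray_solution S I x u"
  shows "continuous_on I x" "continuous_on I u"
  using assms unfolding spray_solution_def
  by (meson continuous_on_eq_continuous_within has_vector_derivative_continuous)+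

lemma spray_solution_subset:
  "spray_solution S I x u \<Longrightarrow> J \<subseteq> I \<Longrightarrow> spray_solution S J x u"
  unfolding spray_solution_def by (meson has_vector_derivative_within_subset subsetD)

lemma spray_solution_cong:
  assumes "spray_solution S I x u" "\<And>t. t \<in> I \<Longrightarrow> x t = y t" "\<And>t. t \<in> I \<Longrightarrow> u t = v t"
  shows "spray_solution S I y v"
  using assms unfolding spray_solution_def
  by (metis (no_types, lifting) has_vector_derivative_transform)

text \<open>A change of parameter with factor \<open>k\<close> multiplies the velocity by \<open>k\<close> and the acceleration by
\<open>k\<^sup>2\<close>, in accordance with the homogeneity of the spray.\<close>

lemma spray_solution_affine:
  assumes "spray_solution S I x u" and S: "spray_bound S U K"
    and U: "\<And>t. t \<in> I \<Longrightarrow> x t \<in> U" and J: "\<And>s. s \<in> J \<Longrightarrow> a + k * s \<in> I"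
  shows "spray_solution S J (\<lambda>s. x (a + k * s)) (\<lambda>s. k *\<^sub>R u (a + k * s))"
  unfolding spray_solution_def
proof (intro ballI conjI)
  fix s assume s: "s \<in> J"
  have sub: "(\<lambda>s. a + k * s) ` J \<subseteq> I" using J by auto
  have aff: "((\<lambda>s. a + k * s) has_vector_derivative k) (at s within J)"
    by (auto intro!: derivative_eq_intros)
  have 1: "(x has_vector_derivative u (a + k * s)) (at (a + k * s) within (\<lambda>s. a + k * s) ` J)"
    and 2: "(u has_vector_derivative S (x (a + k * s)) (u (a + k * s)))
              (at (a + k * s) within (\<lambda>s. a + k * s) ` J)"
    using assms(1) J[OF s] sub unfolding spray_solution_def
    by (meson has_vector_derivative_within_subset)+
  show "((\<lambda>s. x (a + k * s)) has_vector_derivative k *\<^sub>R u (a + k * s)) (at s within J)"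
    using vector_diff_chain_within[OF aff 1] by (simp add: o_def)
  have "((\<lambda>s. u (a + k * s)) has_vector_derivative k *\<^sub>R S (x (a + k * s)) (u (a + k * s)))
          (at s within J)"
    using vector_diff_chain_within[OF aff 2] by (simp add: o_def)
  then have "((\<lambda>s. k *\<^sub>R u (a + k * s)) has_vector_derivative
      k *\<^sub>R (k *\<^sub>R S (x (a + k * s)) (u (a + k * s)))) (at s within J)"
    by (auto intro!: derivative_eq_intros)
  moreover have "S (x (a + k * s)) (k *\<^sub>R u (a + k * s)) = k\<^sup>2 *\<^sub>R S (x (a + k * s)) (u (a + k * s))"
    using S U[OF J[OF s]] unfolding spray_bound_def by blast
  ultimately show "((\<lambda>s. k *\<^sub>R u (a + k * s)) has_vector_derivative
      S (x (a + k * s)) (k *\<^sub>R u (a + k * s))) (at s within J)"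
    by (simp add: power2_eq_square)
qed

lemma spray_solution_const:
  assumes "spray_bound S U K" "x \<in> U"
  shows "spray_solution S I (\<lambda>_. x) (\<lambda>_. 0)"
  using spray_bound_zero[OF assms] by (simp add: spray_solution_def)

text \<open>The basic perturbation estimate. The smallness of \<open>\<rho>\<close> makes the difference of the accelerations at
most a quarter of the \<open>C\<^sup>1\<close> distance of the solutions, so that this distance can be absorbed into the
initial data. Specialised to equal initial data, equal starting points or equal endpoints it gives
all uniqueness and Lipschitz statements about geodesics.\<close>

lemma spray_solutions_close:
  assumes S: "spray_bound S U K"
    and X: "spray_solution S {0..1} x u" and Y: "spray_solution S {0..1} y v"
    and xU: "\<And>t. t \<in> {0..1} \<Longrightarrow> x t \<in> U" and yU: "\<And>t. t \<in> {0..1} \<Longrightarrow> y t \<in> U"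
    and u: "\<And>t. t \<in> {0..1} \<Longrightarrow> norm (u t) \<le> \<rho>" and v: "\<And>t. t \<in> {0..1} \<Longrightarrow> norm (v t) \<le> \<rho>"
    and small: "K * (\<rho>\<^sup>2 + \<rho>) \<le> 1/4"
  defines "d \<equiv> norm (x 0 - y 0) + norm (u 0 - v 0)"
  shows "\<And>t. t \<in> {0..1} \<Longrightarrow> norm ((u t - v t) - (u 0 - v 0)) \<le> d / 2"
    and "\<And>t. t \<in> {0..1} \<Longrightarrow> norm (u t - v t) \<le> 2 * d"
    and "\<And>t. t \<in> {0..1} \<Longrightarrow> norm (x t - y t) \<le> 2 * d"
    and "norm ((x 1 - y 1) - (x 0 - y 0) - (u 0 - v 0)) \<le> d / 2"
proof -
  have K: "0 \<le> K" using S by (simp add: spray_bound_def)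
  have \<rho>: "0 \<le> \<rho>" using u[of 0] by (smt (verit) atLeastAtMost_iff norm_ge_zero)
  have "continuous_on {0..1} (\<lambda>t. u t - v t)"
    using X Y by (intro continuous_intros spray_solution_continuous)
  then obtain t0 where t0: "t0 \<in> {0..1}" "\<And>t. t \<in> {0..1} \<Longrightarrow> norm (u t - v t) \<le> norm (u t0 - v t0)"
    using norm_attains_sup_unit_interval by blast
  \<comment> \<open>The a priori unknown distance of the velocities, to be absorbed below.\<close>
  define W where "W = norm (u t0 - v t0)"
  define a where "a = norm (x 0 - y 0)"
  define b where "b = norm (u 0 - v 0)"
  have W: "norm (u t - v t) \<le> W" if "t \<in> {0..1}" for t using t0(2)[OF that] by (simp add: W_def)
  have dw: "((\<lambda>t. x t - y t) has_vector_derivative u t - v t) (at t within {0..1})"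
    if "t \<in> {0..1}" for t
    using X Y that by (auto simp: spray_solution_def intro!: derivative_eq_intros)
  have dw': "((\<lambda>t. u t - v t) has_vector_derivative S (x t) (u t) - S (y t) (v t)) (at t within {0..1})"
    if "t \<in> {0..1}" for t
    using X Y that by (auto simp: spray_solution_def intro!: derivative_eq_intros)
  have w: "norm (x t - y t) \<le> a + W" if t: "t \<in> {0..1}" for t
  proof -
    have "norm ((x t - y t) - (x 0 - y 0)) \<le> W * \<bar>t - 0\<bar>"
      by (rule vector_derivative_lipschitz[OF dw W]) (use t in auto)
    also have "\<dots> \<le> W * 1" using t by (intro mult_left_mono) (auto simp: W_def)
    finally show ?thesis unfolding a_def
      using norm_triangle_sub[of "x t - y t" "x 0 - y 0"] by linarith
  qed
  have w'': "norm (S (x t) (u t) - S (y t) (v t)) \<le> (a + W) / 4" if t: "t \<in> {0..1}" for t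
  proof -
    have "norm (S (x t) (u t) - S (y t) (v t))
        \<le> K * (\<rho>\<^sup>2 * norm (x t - y t) + \<rho> * norm (u t - v t))"
      using S xU[OF t] yU[OF t] u[OF t] v[OF t] unfolding spray_bound_def by blast
    also have "\<dots> \<le> K * (\<rho>\<^sup>2 * (a + W) + \<rho> * (a + W))"
      using K \<rho> w[OF t] W[OF t] by (intro mult_left_mono add_mono) (auto simp: a_def intro: add_increasing)
    also have "\<dots> = (K * (\<rho>\<^sup>2 + \<rho>)) * (a + W)" by (simp add: algebra_simps)
    also have "\<dots> \<le> 1/4 * (a + W)"
      using small by (intro mult_right_mono) (auto simp: a_def W_def)
    finally show ?thesis by simp
  qed
  have w': "norm ((u t - v t) - (u 0 - v 0)) \<le> (a + W) / 4" if t: "t \<in> {0..1}" for t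
  proof -
    have "norm ((u t - v t) - (u 0 - v 0)) \<le> (a + W) / 4 * \<bar>t - 0\<bar>"
      by (rule vector_derivative_lipschitz[OF dw' w'']) (use t in auto)
    also have "\<dots> \<le> (a + W) / 4 * 1" using t by (intro mult_left_mono) (auto simp: W_def a_def)
    finally show ?thesis by simp
  qed
  have "W \<le> b + (a + W) / 4"
    using w'[OF t0(1)] norm_triangle_sub[of "u t0 - v t0" "u 0 - v 0"] unfolding W_def b_def
    by linarith
  then have aW: "3 * (a + W) \<le> 4 * (a + b)" by (simp add: field_simps)
  have ab: "0 \<le> a + b" "d = a + b" by (auto simp: a_def b_def d_def)
  have a0: "0 \<le> a" by (simp add: a_def)
  have c1: "(a + W) / 4 \<le> d / 2"
    using aW ab by simp
  have c2: "W \<le> 2 * d"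
    using aW ab a0 by simp
  have c3: "a + W \<le> 2 * d"
    using aW ab by simp
  show 1: "norm ((u t - v t) - (u 0 - v 0)) \<le> d / 2" if "t \<in> {0..1}" for t
    using order_trans[OF w'[OF that] c1] .
  show "norm (u t - v t) \<le> 2 * d" if "t \<in> {0..1}" for t
    using order_trans[OF W[OF that] c2] .
  show "norm (x t - y t) \<le> 2 * d" if "t \<in> {0..1}" for t
    using order_trans[OF w[OF that] c3] .
  have "norm ((x 1 - y 1 - 1 *\<^sub>R (u 0 - v 0)) - (x 0 - y 0 - 0 *\<^sub>R (u 0 - v 0))) \<le> d / 2 * \<bar>1 - 0\<bar>"
  proof (rule vector_derivative_lipschitz[where f = "\<lambda>t. x t - y t - t *\<^sub>R (u 0 - v 0)"
        and f' = "\<lambda>t. (u t - v t) - (u 0 - v 0)" and a = 0 and b = 1])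
    show "((\<lambda>t. x t - y t - t *\<^sub>R (u 0 - v 0)) has_vector_derivative (u t - v t) - (u 0 - v 0))
        (at t within {0..1})" if "t \<in> {0..1}" for t
      by (rule derivative_eq_intros dw[OF that] refl)+ simp
  qed (use 1 in auto)
  then show "norm ((x 1 - y 1) - (x 0 - y 0) - (u 0 - v 0)) \<le> d / 2"
    by (simp add: algebra_simps)
qed

text \<open>A geodesic parametrised by the unit interval in a small region is slow, because its acceleration is
too small, relative to the square of its speed, to let it turn around. This is why uniqueness among
slow geodesics is uniqueness among all geodesics in a small ball.\<close>

lemma spray_solution_speed_bound:
  assumes S: "spray_bound S U K" and X: "spray_solution S {0..1} x u"
    and xU: "\<And>t. t \<in> {0..1} \<Longrightarrow> x t \<in> U"
    and D: "\<And>s t. s \<in> {0..1} \<Longrightarrow> t \<in> {0..1} \<Longrightarrow> norm (x s - x t) \<le> D"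
    and small: "4 * K * D < 1" and t: "t \<in> {0..1}"
  shows "norm (u t) \<le> 4 * D"
proof -
  have K: "0 \<le> K" using S by (simp add: spray_bound_def)
  have "continuous_on {0..1} u"
    using X by (rule spray_solution_continuous)
  then obtain s0 where s0: "s0 \<in> {0..1}" "\<And>t. t \<in> {0..1} \<Longrightarrow> norm (u t) \<le> norm (u s0)"
    using norm_attains_sup_unit_interval by blast
  define V where "V = norm (u s0)"
  have V: "0 \<le> V" by (simp add: V_def)
  have du: "norm (u s - u t) \<le> K * V\<^sup>2 * \<bar>s - t\<bar>" if "s \<in> {0..1}" "t \<in> {0..1}" for s t
  proof (rule vector_derivative_lipschitz[where a = 0 and b = 1 and f' = "\<lambda>t. S (x t) (u t)"])
    show "norm (S (x t) (u t)) \<le> K * V\<^sup>2" if "t \<in> {0..1}" for t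
      using spray_bound_norm[OF S xU[OF that]] s0(2)[OF that] by (simp add: V_def)
  qed (use X that in \<open>auto simp: spray_solution_def\<close>)
  \<comment> \<open>During the time \<open>\<tau>\<close> the velocity changes by at most half of the maximal speed \<open>V\<close>,
  so the displacement is at least \<open>\<tau> V / 2\<close>.\<close>
  have *: "\<tau> * V \<le> 2 * D" if \<tau>: "0 < \<tau>" "\<tau> \<le> 1/2" "\<tau> * (K * V) \<le> 1/2" for \<tau>
  proof -
    obtain s1 where s1: "s1 \<in> {0..1}" "\<bar>s1 - s0\<bar> = \<tau>"
    proof (cases "s0 \<le> 1/2")
      case True then show ?thesis using that[of "s0 + \<tau>"] \<tau> s0(1) by auto
    next
      case False then show ?thesis using that[of "s0 - \<tau>"] \<tau> s0(1) by auto
    qed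
    define p where "p = min s0 s1"
    define q where "q = max s0 s1"
    have pq: "p \<le> q" "q - p = \<tau>" "{p..q} \<subseteq> {0..1}" "s0 \<in> {p..q}" "s1 \<in> {p..q}"
      using s0(1) s1 by (auto simp: p_def q_def min_def max_def)
    have "norm ((x s1 - s1 *\<^sub>R u s0) - (x s0 - s0 *\<^sub>R u s0)) \<le> K * V\<^sup>2 * \<tau> * \<bar>s1 - s0\<bar>"
    proof (rule vector_derivative_lipschitz[where f = "\<lambda>t. x t - t *\<^sub>R u s0" and f' = "\<lambda>t. u t - u s0"
          and a = p and b = q])
      fix t assume t: "t \<in> {p..q}"
      have "(x has_vector_derivative u t) (at t within {p..q})"
        using X t pq unfolding spray_solution_def
        by (meson has_vector_derivative_within_subset subsetD)
      then show "((\<lambda>t. x t - t *\<^sub>R u s0) has_vector_derivative u t - u s0) (at t within {p..q})"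
        by (auto intro!: derivative_eq_intros)
      have "norm (u t - u s0) \<le> K * V\<^sup>2 * \<bar>t - s0\<bar>" using du t pq by auto
      also have "\<dots> \<le> K * V\<^sup>2 * \<tau>" using t pq K by (intro mult_left_mono) auto
      finally show "norm (u t - u s0) \<le> K * V\<^sup>2 * \<tau>" .
    qed (use pq in auto)
    also have "\<dots> = (\<tau> * (K * V)) * (\<tau> * V)" using s1 by (simp add: power2_eq_square)
    also have "\<dots> \<le> 1/2 * (\<tau> * V)" using \<tau> V by (intro mult_right_mono) auto
    finally have "norm ((s1 - s0) *\<^sub>R u s0 - (x s1 - x s0)) \<le> 1/2 * (\<tau> * V)"
      by (subst norm_minus_commute) (simp add: algebra_simps)
    moreover have "norm ((s1 - s0) *\<^sub>R u s0) = \<tau> * V" using s1 by (simp add: V_def)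
    ultimately have "\<tau> * V - norm (x s1 - x s0) \<le> 1/2 * (\<tau> * V)"
      using norm_triangle_ineq2[of "(s1 - s0) *\<^sub>R u s0" "x s1 - x s0"] by linarith
    then show ?thesis using D[OF s1(1) s0(1)] by linarith
  qed
  have "V \<le> 4 * D"
  proof (cases "K * V \<le> 1")
    case True
    then show ?thesis using *[of "1/2"] by simp
  next
    case False
    then have KV: "1 < K * V" by simp
    have "1 / (2 * (K * V)) * V \<le> 2 * D"
      using KV by (intro *) (auto simp: field_simps)
    moreover have "K \<noteq> 0" "V \<noteq> 0" using KV by auto
    ultimately have "1 \<le> 4 * K * D" using K by (simp add: field_simps)
    then show ?thesis using small by linarith
  qed
  then show ?thesis using s0(2)[OF t] by (simp add: V_def)
qed

text \<open>After rescaling a short parameter interval to the unit interval the two solutions are slow.\<close>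

lemma spray_solution_local_unique:
  assumes S: "spray_bound S (cball z r) K" and r: "0 < r" and ab: "a < b"
    and X: "spray_solution S {a..b} x u" and Y: "spray_solution S {a..b} y v"
    and init: "x a = z" "y a = z" "u a = v a"
  shows "\<exists>c. a < c \<and> c \<le> b \<and> (\<forall>t\<in>{a..c}. x t = y t)"
proof -
  have K: "0 \<le> K" using S by (simp add: spray_bound_def)
  have near: "\<exists>\<delta>>0. \<forall>t\<in>{a..b}. \<bar>t - a\<bar> < \<delta> \<longrightarrow> dist (f t) (f a) < e"
    if "continuous_on {a..b} f" "0 < e" for f :: "real \<Rightarrow> 'a" and e
  proof -
    have "a \<in> {a..b}" using ab by simp
    then show ?thesis using that unfolding continuous_on_iff dist_real_def by blast
  qed
  note cont = spray_solution_continuous[OF X] spray_solution_continuous[OF Y]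
  obtain \<delta>1 where \<delta>1: "\<delta>1 > 0" "\<And>t. t \<in> {a..b} \<Longrightarrow> \<bar>t - a\<bar> < \<delta>1 \<Longrightarrow> dist (x t) z < r"
    using near[OF cont(1) r] init by auto
  obtain \<delta>2 where \<delta>2: "\<delta>2 > 0" "\<And>t. t \<in> {a..b} \<Longrightarrow> \<bar>t - a\<bar> < \<delta>2 \<Longrightarrow> dist (y t) z < r"
    using near[OF cont(3) r] init by auto
  obtain \<delta>3 where \<delta>3: "\<delta>3 > 0" "\<And>t. t \<in> {a..b} \<Longrightarrow> \<bar>t - a\<bar> < \<delta>3 \<Longrightarrow> dist (u t) (u a) < 1"
    using near[OF cont(2), of 1] by auto
  obtain \<delta>4 where \<delta>4: "\<delta>4 > 0" "\<And>t. t \<in> {a..b} \<Longrightarrow> \<bar>t - a\<bar> < \<delta>4 \<Longrightarrow> dist (v t) (v a) < 1"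
    using near[OF cont(4), of 1] by auto
  define M where "M = norm (u a) + 1"
  have M: "M > 0" by (simp add: M_def add_nonneg_pos)
  have "((\<lambda>k::real. K * ((k * M)\<^sup>2 + k * M)) \<longlongrightarrow> K * ((0 * M)\<^sup>2 + 0 * M)) (at_right 0)"
    by (intro tendsto_intros)
  then have "\<forall>\<^sub>F k in at_right 0. K * ((k * M)\<^sup>2 + k * M) < 1/4"
    by (rule order_tendstoD) simp
  then obtain k0 where k0: "k0 > 0" "\<And>k. 0 < k \<Longrightarrow> k < k0 \<Longrightarrow> K * ((k * M)\<^sup>2 + k * M) < 1/4"
    by (auto simp: eventually_at_right_field)
  define k where "k = Min {\<delta>1/2, \<delta>2/2, \<delta>3/2, \<delta>4/2, k0/2, b - a}"
  have k: "0 < k" "k < \<delta>1" "k < \<delta>2" "k < \<delta>3" "k < \<delta>4" "k < k0" "k \<le> b - a"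
    using \<delta>1 \<delta>2 \<delta>3 \<delta>4 k0 ab by (auto simp: k_def min_def)
  have sc: "a + k * s \<in> {a..b}" "\<bar>a + k * s - a\<bar> \<le> k" if "s \<in> {0..1}" for s
  proof -
    have *: "0 \<le> k * s" "k * s \<le> k" using that k by (auto intro: mult_left_le)
    show "\<bar>a + k * s - a\<bar> \<le> k" using * by linarith
    have "a \<le> a + k * s" "a + k * s \<le> b" using * k(7) by linarith+
    then show "a + k * s \<in> {a..b}" by simp
  qed
  have bnd: "norm w \<le> M" if "dist w (u a) < 1" for w :: 'a
    using that norm_triangle_sub[of w "u a"] by (simp add: M_def dist_norm)
  have sub: "{a..a+k} \<subseteq> {a..b}" using k by auto
  have inU: "x t \<in> cball z r" "y t \<in> cball z r" if "t \<in> {a..a+k}" for t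
    using \<delta>1(2)[of t] \<delta>2(2)[of t] that k by (auto simp: dist_commute intro: less_imp_le)
  have sc': "a + k * s \<in> {a..a+k}" if "s \<in> {0..1}" for s
    using that k by (auto intro: mult_left_le)
  have X': "spray_solution S {0..1} (\<lambda>s. x (a + k * s)) (\<lambda>s. k *\<^sub>R u (a + k * s))"
    using spray_solution_affine[OF spray_solution_subset[OF X sub] S inU(1) sc'] .
  have Y': "spray_solution S {0..1} (\<lambda>s. y (a + k * s)) (\<lambda>s. k *\<^sub>R v (a + k * s))"
    using spray_solution_affine[OF spray_solution_subset[OF Y sub] S inU(2) sc'] .
  have nu: "norm (k *\<^sub>R u (a + k * s)) \<le> k * M" "norm (k *\<^sub>R v (a + k * s)) \<le> k * M"
    if s: "s \<in> {0..1}" for s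
  proof -
    have "\<bar>a + k * s - a\<bar> < \<delta>3" "\<bar>a + k * s - a\<bar> < \<delta>4" using sc(2)[OF s] k by linarith+
    then have "norm (u (a + k * s)) \<le> M" "norm (v (a + k * s)) \<le> M"
      using bnd[OF \<delta>3(2)] bnd[of "v (a + k * s)"] \<delta>4(2) sc(1)[OF s] init(3) by metis+
    then show "norm (k *\<^sub>R u (a + k * s)) \<le> k * M" "norm (k *\<^sub>R v (a + k * s)) \<le> k * M"
      using k by auto
  qed
  have "norm (x (a + k * s) - y (a + k * s)) \<le> 2 * (norm (x (a + k * 0) - y (a + k * 0)) +
      norm (k *\<^sub>R u (a + k * 0) - k *\<^sub>R v (a + k * 0)))" if "s \<in> {0..1}" for s
    by (rule spray_solutions_close(3)[OF S X' Y' _ _ nu(1) nu(2)])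
       (use inU sc' k0(2)[of k] k that in auto)
  then have eq: "x (a + k * s) = y (a + k * s)" if "s \<in> {0..1}" for s
    using that init by simp
  have "x t = y t" if "t \<in> {a..a+k}" for t
    using eq[of "(t - a) / k"] that k by (simp add: field_simps)
  then show ?thesis using k by (intro exI[of _ "a + k"]) auto
qed

lemma spray_continuous_on:
  fixes S :: "'e::real_normed_vector \<Rightarrow> 'e \<Rightarrow> 'e"
  assumes S: "spray_bound S U K"
  shows "continuous_on (U \<times> cball 0 \<rho>) (\<lambda>(x, u). S x u)"
proof (rule continuous_on_subset[where s = "U \<times> cball 0 \<bar>\<rho>\<bar>"])
  have K: "0 \<le> K" using S by (simp add: spray_bound_def)
  have "(K * (\<rho>\<^sup>2 + \<bar>\<rho>\<bar>))-lipschitz_on (U \<times> cball 0 \<bar>\<rho>\<bar>) (\<lambda>(x, u). S x u)"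
  proof (rule lipschitz_onI)
    fix p q :: "'e \<times> 'e" assume pq: "p \<in> U \<times> cball 0 \<bar>\<rho>\<bar>" "q \<in> U \<times> cball 0 \<bar>\<rho>\<bar>"
    have "norm (S (fst p) (snd p) - S (fst q) (snd q))
        \<le> K * (\<bar>\<rho>\<bar>\<^sup>2 * norm (fst p - fst q) + \<bar>\<rho>\<bar> * norm (snd p - snd q))"
      using pq by (intro spray_boundD[OF S]) (auto simp: mem_Times_iff)
    also have "\<dots> \<le> K * (\<bar>\<rho>\<bar>\<^sup>2 * dist p q + \<bar>\<rho>\<bar> * dist p q)"
      using K dist_fst_le[of p q] dist_snd_le[of p q]
      by (intro mult_left_mono add_mono) (auto simp: dist_norm)
    finally show "dist (case p of (x, u) \<Rightarrow> S x u) (case q of (x, u) \<Rightarrow> S x u)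
        \<le> K * (\<rho>\<^sup>2 + \<bar>\<rho>\<bar>) * dist p q"
      by (simp add: dist_norm case_prod_beta algebra_simps)
  qed (use K in auto)
  then show "continuous_on (U \<times> cball 0 \<bar>\<rho>\<bar>) (\<lambda>(x, u). S x u)"
    by (rule lipschitz_on_continuous_on)
qed (auto simp: abs_if)

text \<open>The velocity of the solution is a fixed point of a contraction: from a velocity \<open>u\<close> one computes the
curve \<open>X u\<close>, its acceleration \<open>f u\<close> and the primitive \<open>F u\<close> of the latter, and adds to \<open>F u\<close> the
constant that makes the mean velocity equal to \<open>q - p\<close>.\<close>

lemma spray_solution_joining:
  fixes S :: "'e::euclidean_space \<Rightarrow> 'e \<Rightarrow> 'e"
  assumes S: "spray_bound S U K" and U: "cball p \<rho> \<subseteq> U" and \<rho>: "0 \<le> \<rho>"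
    and near: "norm (q - p) \<le> \<rho> / 2" and small: "K * (\<rho>\<^sup>2 + \<rho>) \<le> 1/4"
  shows "\<exists>x u. spray_solution S {0..1} x u \<and> x 0 = p \<and> x 1 = q \<and>
           (\<forall>t\<in>{0..1}. norm (u t) \<le> \<rho> \<and> x t \<in> cball p \<rho>)"
proof -
  have K: "0 \<le> K" using S by (simp add: spray_bound_def)
  define X where "X u s = p + integral {0..s} u" for u :: "real \<Rightarrow> 'e" and s
  define f where "f u s = S (X u s) (u s)" for u :: "real \<Rightarrow> 'e" and s
  define F where "F u s = integral {0..s} (f u)" for u :: "real \<Rightarrow> 'e" and s
  define \<Phi> where "\<Phi> u s = q - p + F u s - integral {0..1} (F u)" for u :: "real \<Rightarrow> 'e" and s
  define ok where "ok u \<longleftrightarrow> continuous_on {0..1} u \<and> (\<forall>s\<in>{0..1}. norm (u s) \<le> \<rho>)"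
    for u :: "real \<Rightarrow> 'e"
  have int_le: "norm (integral {0..s} h) \<le> B"
    if "continuous_on {0..1} h" "\<And>t. t \<in> {0..1} \<Longrightarrow> norm (h t) \<le> B" "s \<in> {0..1}"
    for h :: "real \<Rightarrow> 'e" and s B
  proof -
    have "norm (integral {0..s} h) \<le> B * (s - 0)"
      using that by (intro integral_bound) (auto intro: continuous_on_subset)
    also have "\<dots> \<le> B"
      using that order_trans[OF norm_ge_zero that(2)[of 0]] by (auto intro: mult_left_le)
    finally show ?thesis .
  qed
  have der: "((\<lambda>s. integral {0..s} h) has_vector_derivative h s) (at s within {0..1})"
    if "continuous_on {0..1} h" "s \<in> {0..1}" for h :: "real \<Rightarrow> 'e" and s
    using integral_has_vector_derivative[OF that] .
  have contI: "continuous_on {0..1} (\<lambda>s. integral {0..s} h)"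
    if "continuous_on {0..1} h" for h :: "real \<Rightarrow> 'e"
    using der[OF that] by (meson continuous_on_eq_continuous_within has_vector_derivative_continuous)
  have Xc: "continuous_on {0..1} (X u)" and Xin: "\<And>s. s \<in> {0..1} \<Longrightarrow> X u s \<in> cball p \<rho>"
    if "ok u" for u
    using that contI int_le[of u \<rho>] unfolding X_def ok_def
    by (auto intro!: continuous_intros simp: dist_norm)
  have fc: "continuous_on {0..1} (f u)" if "ok u" for u
  proof -
    have "continuous_on {0..1} ((\<lambda>(x, u). S x u) \<circ> (\<lambda>s. (X u s, u s)))"
    proof (rule continuous_on_compose)
      show "continuous_on {0..1} (\<lambda>s. (X u s, u s))"
        using that Xc[OF that] by (auto simp: ok_def intro!: continuous_intros)
      show "continuous_on ((\<lambda>s. (X u s, u s)) ` {0..1}) (\<lambda>(x, u). S x u)"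
        by (rule continuous_on_subset[OF spray_continuous_on[OF S, of \<rho>]])
           (use that Xin[OF that] U in \<open>auto simp: ok_def simp del: mem_cball\<close>)
    qed
    then show ?thesis by (simp add: f_def o_def)
  qed
  have fb: "norm (f u s) \<le> K * \<rho>\<^sup>2" if "ok u" "s \<in> {0..1}" for u s
    unfolding f_def
    using that Xin[OF that] U by (intro spray_bound_norm[OF S]) (auto simp: ok_def)
  have Fc: "continuous_on {0..1} (F u)" if "ok u" for u
    unfolding F_def using contI[OF fc[OF that]] .
  have Fb: "norm (F u s) \<le> K * \<rho>\<^sup>2" if "ok u" "s \<in> {0..1}" for u s
    unfolding F_def using int_le[OF fc fb] that by blast
  have \<Phi>_ok: "ok (\<Phi> u)" if "ok u" for u
    unfolding ok_def
  proof (intro conjI ballI)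
    show "continuous_on {0..1} (\<Phi> u)" unfolding \<Phi>_def by (intro continuous_intros Fc that)
    fix s :: real assume s: "s \<in> {0..1}"
    have "norm (\<Phi> u s) \<le> norm (q - p) + norm (F u s) + norm (integral {0..1} (F u))"
      unfolding \<Phi>_def by (meson add_mono norm_triangle_ineq norm_triangle_ineq4 order_refl order_trans)
    also have "\<dots> \<le> \<rho> / 2 + K * \<rho>\<^sup>2 + K * \<rho>\<^sup>2"
      by (intro add_mono near Fb[OF that s] int_le[OF Fc[OF that] Fb[OF that]]) auto
    also have "\<dots> = \<rho> / 2 + 2 * \<rho> * (K * \<rho>)" by (simp add: power2_eq_square)
    also have "\<dots> \<le> \<rho> / 2 + 2 * \<rho> * (1/4)"
    proof -
      have "0 \<le> K * \<rho>\<^sup>2" using K by simp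
      then have "K * \<rho> \<le> 1/4" using small by (simp add: distrib_left)
      then show ?thesis using \<rho> by (intro add_left_mono mult_left_mono) auto
    qed
    finally show "norm (\<Phi> u s) \<le> \<rho>" by simp
  qed
  have \<Phi>_contr: "norm (\<Phi> u s - \<Phi> v s) \<le> 1/2 * D"
    if u: "ok u" and v: "ok v" and s: "s \<in> {0..1}"
      and D: "\<And>t. t \<in> {0..1} \<Longrightarrow> norm (u t - v t) \<le> D" for u v s D
  proof -
    have D0: "0 \<le> D" using order_trans[OF norm_ge_zero D[of 0]] by simp
    have uv: "u integrable_on {0..t}" "v integrable_on {0..t}"
        "f u integrable_on {0..t}" "f v integrable_on {0..t}"
        "F u integrable_on {0..t}" "F v integrable_on {0..t}" if "t \<in> {0..1}" for t
      using u v fc[OF u] fc[OF v] Fc[OF u] Fc[OF v] that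
      by (auto simp: ok_def intro!: integrable_continuous_interval intro: continuous_on_subset)
    have X: "norm (X u t - X v t) \<le> D" if t: "t \<in> {0..1}" for t
    proof -
      have "X u t - X v t = integral {0..t} (\<lambda>r. u r - v r)"
        using uv[OF t] by (simp add: X_def integral_diff)
      then show ?thesis
        using int_le[of "\<lambda>r. u r - v r" D t] u v D t by (auto simp: ok_def intro!: continuous_intros)
    qed
    have f: "norm (f u t - f v t) \<le> D / 4" if t: "t \<in> {0..1}" for t
    proof -
      have "norm (f u t - f v t) \<le> K * (\<rho>\<^sup>2 * norm (X u t - X v t) + \<rho> * norm (u t - v t))"
        unfolding f_def using Xin[OF u t] Xin[OF v t] U u v t
        by (intro spray_boundD[OF S]) (auto simp: ok_def)
      also have "\<dots> \<le> K * (\<rho>\<^sup>2 * D + \<rho> * D)"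
        using K \<rho> X[OF t] D[OF t] by (intro mult_left_mono add_mono) auto
      also have "\<dots> = (K * (\<rho>\<^sup>2 + \<rho>)) * D" by (simp add: algebra_simps)
      also have "\<dots> \<le> 1/4 * D" using small D0 by (intro mult_right_mono) auto
      finally show ?thesis by simp
    qed
    have F: "norm (F u t - F v t) \<le> D / 4" if t: "t \<in> {0..1}" for t
    proof -
      have "F u t - F v t = integral {0..t} (\<lambda>r. f u r - f v r)"
        using uv[OF t] by (simp add: F_def integral_diff)
      then show ?thesis
        using int_le[of "\<lambda>r. f u r - f v r" "D/4" t] fc[OF u] fc[OF v] f t
        by (auto intro!: continuous_intros)
    qed
    have "norm (integral {0..1} (\<lambda>r. F u r - F v r)) \<le> D / 4"
      using int_le[of "\<lambda>r. F u r - F v r" "D/4" 1] Fc[OF u] Fc[OF v] F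
      by (auto intro!: continuous_intros)
    moreover have "\<Phi> u s - \<Phi> v s = (F u s - F v s) - integral {0..1} (\<lambda>r. F u r - F v r)"
      using uv[of 1] by (simp add: \<Phi>_def integral_diff)
    ultimately show ?thesis
      using F[OF s] norm_triangle_ineq4[of "F u s - F v s" "integral {0..1} (\<lambda>r. F u r - F v r)"]
      by simp
  qed
  \<comment> \<open>Velocities are extended to the whole line by constants, which places them in the complete space
  of bounded continuous functions.\<close>
  define cl where "cl t = min 1 (max 0 t)" for t :: real
  have cl: "cl t \<in> {0..1}" "t \<in> {0..1} \<Longrightarrow> cl t = t" for t by (auto simp: cl_def)
  have clc: "continuous_on UNIV cl" unfolding cl_def by (intro continuous_intros)
  define E where "E = PiC UNIV (\<lambda>_::real. cball (0::'e) \<rho>)"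
  have E: "w \<in> E \<longleftrightarrow> (\<forall>t. norm (apply_bcontfun w t) \<le> \<rho>)" for w
    by (auto simp: E_def mem_PiC_iff)
  have Eok: "ok (apply_bcontfun w)" if "w \<in> E" for w
    using that by (simp add: E ok_def)
  have bc: "(\<lambda>t. \<Phi> (apply_bcontfun w) (cl t)) \<in> bcontfun" if "w \<in> E" for w
  proof (rule bcontfun_normI)
    note o = \<Phi>_ok[OF Eok[OF that]]
    show "continuous_on UNIV (\<lambda>t. \<Phi> (apply_bcontfun w) (cl t))"
      using o cl(1) by (intro continuous_on_compose2[OF _ clc, of "{0..1}"]) (auto simp: ok_def)
    show "norm (\<Phi> (apply_bcontfun w) (cl t)) \<le> \<rho>" for t
      using o cl(1)[of t] unfolding ok_def by blast
  qed
  define G where "G w = Bcontfun (\<lambda>t. \<Phi> (apply_bcontfun w) (cl t))" for w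
  have G: "apply_bcontfun (G w) t = \<Phi> (apply_bcontfun w) (cl t)" if "w \<in> E" for w t
    using bc[OF that] by (simp add: G_def Bcontfun_inverse)
  have "\<exists>!w. w \<in> E \<and> G w = w"
  proof (rule Banach_fix[of E "1/2"])
    show "complete E" unfolding E_def complete_eq_closed by (intro closed_PiC) auto
    have "const_bcontfun 0 \<in> E" using \<rho> by (auto simp: E const_bcontfun.rep_eq)
    then show "E \<noteq> {}" by blast
    show "G ` E \<subseteq> E"
      using \<Phi>_ok[OF Eok] cl(1) by (fastforce simp: E G ok_def)
    show "dist (G v) (G w) \<le> 1/2 * dist v w" if "v \<in> E" "w \<in> E" for v w
    proof (rule dist_bound)
      fix t
      show "dist (apply_bcontfun (G v) t) (apply_bcontfun (G w) t) \<le> 1/2 * dist v w"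
        unfolding G[OF that(1)] G[OF that(2)] dist_norm[of "\<Phi> _ _"]
        using dist_bounded[of v _ w]
        by (intro \<Phi>_contr Eok that cl(1)) (auto simp: dist_norm[symmetric])
    qed
  qed auto
  then obtain w where w: "w \<in> E" "G w = w" by blast
  define u where "u = apply_bcontfun w"
  have ok: "ok u" using Eok w by (simp add: u_def)
  have fixpt: "u s = \<Phi> u s" if "s \<in> {0..1}" for s
    using G[OF w(1), of s] w(2) cl(2)[OF that] by (simp add: u_def)
  have "spray_solution S {0..1} (X u) u"
    unfolding spray_solution_def
  proof (intro ballI conjI)
    fix s :: real assume s: "s \<in> {0..1}"
    show "(X u has_vector_derivative u s) (at s within {0..1})"
      unfolding X_def using der[of u s] ok s by (auto simp: ok_def intro!: derivative_eq_intros)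
    have "(F u has_vector_derivative S (X u s) (u s)) (at s within {0..1})"
      unfolding F_def using der[OF fc[OF ok] s] by (simp add: f_def)
    then have "(\<Phi> u has_vector_derivative S (X u s) (u s)) (at s within {0..1})"
      unfolding \<Phi>_def by (auto intro!: derivative_eq_intros)
    then show "(u has_vector_derivative S (X u s) (u s)) (at s within {0..1})"
      by (rule has_vector_derivative_transform[rotated 2]) (use fixpt s in auto)
  qed
  moreover have "X u 1 = q"
  proof -
    have "integral {0..1} u = integral {0..1} (\<lambda>s. (q - p - integral {0..1} (F u)) + F u s)"
      using fixpt by (intro integral_cong) (simp add: \<Phi>_def)
    also have "\<dots> = q - p"
      using Fc[OF ok] by (subst integral_add) (auto intro!: integrable_continuous_interval)
    finally show ?thesis by (simp add: X_def)
  qed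
  moreover have "X u 0 = p" by (simp add: X_def)
  ultimately show ?thesis using ok Xin[OF ok] unfolding ok_def by blast
qed

section \<open>Symmetry of second derivatives\<close>

text \<open>The mean value theorem is applied first in the direction of \<open>u\<close> and then in that of \<open>v\<close>. Since the
left-hand side is symmetric in \<open>u\<close> and \<open>v\<close>, mixed second derivatives agree in the limit.\<close>

lemma second_difference_mean_value:
  fixes f :: "'e::real_normed_vector \<Rightarrow> real"
  assumes d: "0 < d" and f: "\<And>y. y \<in> ball x d \<Longrightarrow> (f has_derivative f' y) (at y)"
    and f': "\<And>y. y \<in> ball x d \<Longrightarrow> ((\<lambda>z. f' z u) has_derivative f'' y) (at y)"
    and s: "0 < s" "s * (norm u + norm v) < d"
  shows "\<exists>z\<in>ball x d. f (x + s *\<^sub>R u + s *\<^sub>R v) - f (x + s *\<^sub>R u) - f (x + s *\<^sub>R v) + f x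
           = s\<^sup>2 * f'' z v"
proof -
  have inb: "x + r *\<^sub>R u + q *\<^sub>R v \<in> ball x d" if "0 \<le> r" "r \<le> s" "0 \<le> q" "q \<le> s" for r q
  proof -
    have "norm (r *\<^sub>R u + q *\<^sub>R v) \<le> r * norm u + q * norm v"
      using that by (intro order_trans[OF norm_triangle_ineq]) simp
    also have "\<dots> \<le> s * norm u + s * norm v"
      using that by (intro add_mono mult_right_mono) auto
    also have "\<dots> < d" using s by (simp add: distrib_left)
    finally have "dist (x + (r *\<^sub>R u + q *\<^sub>R v)) x < d" by (simp add: dist_norm)
    then show ?thesis by (simp add: add.assoc dist_commute)
  qed
  have line: "((\<lambda>r. g (p + r *\<^sub>R w)) has_real_derivative g' w) (at r)"
    if "(g has_derivative g') (at (p + r *\<^sub>R w))" for g g' and p w :: 'e and r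
  proof -
    have "((\<lambda>r. p + r *\<^sub>R w) has_derivative (\<lambda>h. h *\<^sub>R w)) (at r)"
      by (auto intro!: derivative_eq_intros)
    from has_derivative_compose[OF this that]
    have "((\<lambda>r. g (p + r *\<^sub>R w)) has_derivative (\<lambda>h. g' (h *\<^sub>R w))) (at r)" .
    moreover have "(\<lambda>h. g' (h *\<^sub>R w)) = (*) (g' w)"
      using linear_scale[OF has_derivative_linear[OF that]] by (auto simp: mult.commute)
    ultimately show ?thesis by (simp add: has_field_derivative_def)
  qed
  have "\<exists>\<xi>>0. \<xi> < s \<and> (f ((x + s *\<^sub>R v) + s *\<^sub>R u) - f (x + s *\<^sub>R u))
      - (f ((x + s *\<^sub>R v) + 0 *\<^sub>R u) - f (x + 0 *\<^sub>R u))
      = (s - 0) * (f' ((x + s *\<^sub>R v) + \<xi> *\<^sub>R u) u - f' (x + \<xi> *\<^sub>R u) u)"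
  proof (rule MVT2[OF s(1), where f = "\<lambda>r. f ((x + s *\<^sub>R v) + r *\<^sub>R u) - f (x + r *\<^sub>R u)"])
    fix r assume r: "0 \<le> r" "r \<le> s"
    show "((\<lambda>r. f ((x + s *\<^sub>R v) + r *\<^sub>R u) - f (x + r *\<^sub>R u)) has_real_derivative
        f' ((x + s *\<^sub>R v) + r *\<^sub>R u) u - f' (x + r *\<^sub>R u) u) (at r)"
      using inb[of r s] inb[of r 0] r s
      by (intro DERIV_diff line f) (auto simp: algebra_simps)
  qed
  then obtain \<xi> where \<xi>: "0 < \<xi>" "\<xi> < s"
    "f (x + s *\<^sub>R u + s *\<^sub>R v) - f (x + s *\<^sub>R u) - f (x + s *\<^sub>R v) + f x
      = s * (f' ((x + \<xi> *\<^sub>R u) + s *\<^sub>R v) u - f' ((x + \<xi> *\<^sub>R u) + 0 *\<^sub>R v) u)"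
    by (auto simp: algebra_simps)
  have "\<exists>\<eta>>0. \<eta> < s \<and> f' ((x + \<xi> *\<^sub>R u) + s *\<^sub>R v) u - f' ((x + \<xi> *\<^sub>R u) + 0 *\<^sub>R v) u
      = (s - 0) * f'' ((x + \<xi> *\<^sub>R u) + \<eta> *\<^sub>R v) v"
    by (rule MVT2[OF s(1), where f = "\<lambda>r. f' ((x + \<xi> *\<^sub>R u) + r *\<^sub>R v) u"])
       (intro line f' inb; use \<xi> in simp)
  then obtain \<eta> where \<eta>: "0 < \<eta>" "\<eta> < s" "f' ((x + \<xi> *\<^sub>R u) + s *\<^sub>R v) u - f' ((x + \<xi> *\<^sub>R u) + 0 *\<^sub>R v) u
      = s * f'' ((x + \<xi> *\<^sub>R u) + \<eta> *\<^sub>R v) v" by auto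
  show ?thesis
    using \<xi> \<eta> inb[of \<xi> \<eta>]
    by (intro bexI[of _ "x + \<xi> *\<^sub>R u + \<eta> *\<^sub>R v"]) (auto simp: power2_eq_square)
qed

lemma symmetric_second_derivative_real:
  fixes f :: "'e::real_normed_vector \<Rightarrow> real"
  assumes U: "open U" "x \<in> U" and f: "\<And>y. y \<in> U \<Longrightarrow> (f has_derivative f' y) (at y)"
    and f': "\<And>y w. y \<in> U \<Longrightarrow> ((\<lambda>z. f' z w) has_derivative f'' w y) (at y)"
    and cont: "\<And>w w'. continuous_on U (\<lambda>y. f'' w y w')"
  shows "f'' u x v = f'' v x u"
proof (rule ccontr)
  assume ne: "f'' u x v \<noteq> f'' v x u"
  define e where "e = \<bar>f'' u x v - f'' v x u\<bar> / 2"
  have e: "0 < e" using ne by (simp add: e_def)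
  have near: "\<exists>d>0. \<forall>y\<in>ball x d. \<bar>f'' w y w' - f'' w x w'\<bar> < e" for w w'
  proof -
    have "isCont (\<lambda>y. f'' w y w') x"
      using cont[of w w'] U by (simp add: continuous_on_eq_continuous_at)
    then have "\<exists>d>0. \<forall>y. dist y x < d \<longrightarrow> dist (f'' w y w') (f'' w x w') < e"
      using e unfolding continuous_at_eps_delta by blast
    then show ?thesis by (auto simp: dist_commute dist_real_def)
  qed
  obtain d1 where d1: "d1 > 0" "\<And>y. y \<in> ball x d1 \<Longrightarrow> \<bar>f'' u y v - f'' u x v\<bar> < e"
    using near[of u v] by blast
  obtain d2 where d2: "d2 > 0" "\<And>y. y \<in> ball x d2 \<Longrightarrow> \<bar>f'' v y u - f'' v x u\<bar> < e"
    using near[of v u] by blast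
  obtain d3 where d3: "d3 > 0" "ball x d3 \<subseteq> U" using U openE by blast
  define d where "d = Min {d1, d2, d3}"
  have d: "0 < d" "ball x d \<subseteq> ball x d1" "ball x d \<subseteq> ball x d2" "ball x d \<subseteq> U"
    using d1 d2 d3 by (auto simp: d_def)
  define s where "s = d / (norm u + norm v + 1)"
  have np: "norm u + norm v + 1 > 0" by (simp add: add_nonneg_pos)
  then have s: "0 < s" "s * (norm u + norm v) < d" "s * (norm v + norm u) < d"
    using d(1) by (auto simp: s_def field_simps)
  note fd = f[OF subsetD[OF d(4)]] and fd' = f'[OF subsetD[OF d(4)]]
  obtain z where z: "z \<in> ball x d"
    "f (x + s *\<^sub>R u + s *\<^sub>R v) - f (x + s *\<^sub>R u) - f (x + s *\<^sub>R v) + f x = s\<^sup>2 * f'' u z v"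
    using second_difference_mean_value[OF d(1) fd fd' s(1,2)] by blast
  obtain z' where z': "z' \<in> ball x d"
    "f (x + s *\<^sub>R v + s *\<^sub>R u) - f (x + s *\<^sub>R v) - f (x + s *\<^sub>R u) + f x = s\<^sup>2 * f'' v z' u"
    using second_difference_mean_value[OF d(1) fd fd' s(1,3)] by blast
  have "s\<^sup>2 * f'' u z v = s\<^sup>2 * f'' v z' u"
    using z(2) z'(2) by (simp add: algebra_simps)
  then have "f'' u z v = f'' v z' u" using s by simp
  moreover have "\<bar>f'' u z v - f'' u x v\<bar> < e" using z(1) d(2) by (intro d1(2)) auto
  moreover have "\<bar>f'' v z' u - f'' v x u\<bar> < e" using z'(1) d(3) by (intro d2(2)) auto
  ultimately show False by (auto simp: e_def abs_if split: if_splits)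
qed

lemma symmetric_second_derivative:
  fixes f :: "'e::real_normed_vector \<Rightarrow> 'b::euclidean_space"
  assumes U: "open U" "x \<in> U" and f: "\<And>y. y \<in> U \<Longrightarrow> (f has_derivative f' y) (at y)"
    and f': "\<And>y w. y \<in> U \<Longrightarrow> ((\<lambda>z. f' z w) has_derivative f'' w y) (at y)"
    and cont: "\<And>w w'. continuous_on U (\<lambda>y. f'' w y w')"
  shows "f'' u x v = f'' v x u"
proof (rule euclidean_eqI)
  fix b :: 'b assume "b \<in> Basis"
  show "f'' u x v \<bullet> b = f'' v x u \<bullet> b"
    by (rule symmetric_second_derivative_real[OF U, of "\<lambda>y. f y \<bullet> b" "\<lambda>y w. f' y w \<bullet> b"
        "\<lambda>w y w'. f'' w y w' \<bullet> b"])
       (auto intro!: has_derivative_inner_left continuous_intros f f' cont)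
qed

section \<open>Lorentzian geometry of a coordinate ball\<close>

text \<open>The matrix of the metric in a chart, as a bilinear form.\<close>

definition mform :: "real^'n^'n \<Rightarrow> real^'n \<Rightarrow> real^'n \<Rightarrow> real" where
  "mform M u v = u \<bullet> (M *v v)"

lemma bounded_bilinear_matrix_vector:
  "bounded_bilinear (\<lambda>(M::real^'n^'m) v. M *v v)"
  unfolding bilinear_conv_bounded_bilinear[symmetric] bilinear_def linear_iff
  by (auto simp: matrix_vector_mult_add_rdistrib matrix_vector_right_distrib
      scaleR_matrix_vector_assoc[symmetric] matrix_vector_mult_scaleR)

lemma mform_simps:
  "mform M (u + u') v = mform M u v + mform M u' v"
  "mform M (u - u') v = mform M u v - mform M u' v"
  "mform M (c *\<^sub>R u) v = c * mform M u v"
  "mform M u (v + v') = mform M u v + mform M u v'"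
  "mform M u (v - v') = mform M u v - mform M u v'"
  "mform M u (c *\<^sub>R v) = c * mform M u v"
  "mform (M + M') u v = mform M u v + mform M' u v"
  "mform (M - M') u v = mform M u v - mform M' u v"
  "mform (c *\<^sub>R M) u v = c * mform M u v"
  "mform M 0 v = 0" "mform M u 0 = 0" "mform 0 u v = 0"
  "mform M (- u) v = - mform M u v" "mform M u (- v) = - mform M u v"
  by (simp_all only: mform_def inner_add_left inner_add_right inner_diff_left inner_diff_right
      inner_scaleR_left inner_scaleR_right inner_zero_left inner_zero_right inner_minus_left
      inner_minus_right matrix_vector_right_distrib matrix_vector_mult_diff_distrib
      matrix_vector_mult_add_rdistrib matrix_vector_mult_diff_rdistrib matrix_vector_mult_scaleR
      scaleR_matrix_vector_assoc[symmetric] matrix_vector_mult_0 matrix_vector_mult_0_right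
      linear_neg[OF matrix_vector_mul_linear])

lemma continuous_on_mform [continuous_intros]:
  assumes "continuous_on I M" "continuous_on I u" "continuous_on I v"
  shows "continuous_on I (\<lambda>t. mform (M t) (u t) (v t))"
  unfolding mform_def
  by (intro continuous_intros bounded_bilinear.continuous_on[OF bounded_bilinear_matrix_vector] assms)

lemma tendsto_mform [tendsto_intros]:
  assumes "(M \<longlongrightarrow> M0) F" "(u \<longlongrightarrow> u0) F" "(v \<longlongrightarrow> v0) F"
  shows "((\<lambda>t. mform (M t) (u t) (v t)) \<longlongrightarrow> mform M0 u0 v0) F"
  unfolding mform_def
  by (intro tendsto_intros bounded_bilinear.tendsto[OF bounded_bilinear_matrix_vector] assms)

lemma mform_has_real_derivative:
  assumes "(M has_vector_derivative M') (at t within I)"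
    and "(u has_vector_derivative u') (at t within I)" "(v has_vector_derivative v') (at t within I)"
  shows "((\<lambda>t. mform (M t) (u t) (v t)) has_real_derivative
           mform M' (u t) (v t) + mform (M t) u' (v t) + mform (M t) (u t) v') (at t within I)"
proof -
  have "((\<lambda>t. M t *v v t) has_vector_derivative M t *v v' + M' *v v t) (at t within I)"
    using bounded_bilinear.has_vector_derivative[OF bounded_bilinear_matrix_vector assms(1,3)] .
  from bounded_bilinear.has_vector_derivative[OF bounded_bilinear_inner assms(2) this]
  show ?thesis
    unfolding has_real_derivative_iff_has_vector_derivative mform_def
    by (rule has_vector_derivative_eq_rhs) (simp add: inner_add_right)
qed

text \<open>A Lorentzian metric \<open>G\<close> on a coordinate ball, its derivative \<open>DG\<close>, its geodesic spray \<open>S\<close>, a time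
orientation \<open>T\<close>, and a covector \<open>\<tau>\<close> that bounds future directed causal vectors. There are three
scales: all data are controlled by the constant \<open>K\<close> on the ball of radius \<open>R\<close>; geodesics of speed at
most \<open>\<rho>\<close> that start in the ball of radius \<open>r\<close> do not leave the ball of radius \<open>R\<close> during a unit of
time; and any two points of the ball of radius \<open>r\<close> are joined by such a geodesic. The last inequality
makes the lenses below small relative to the strength \<open>a\<close> of their curvature.\<close>

locale local_lorentz =
  fixes G :: "real^'n \<Rightarrow> real^'n^'n" and DG :: "real^'n \<Rightarrow> real^'n \<Rightarrow> real^'n^'n"
    and S :: "real^'n \<Rightarrow> real^'n \<Rightarrow> real^'n" and T :: "real^'n \<Rightarrow> real^'n"
    and \<tau> z0 :: "real^'n" and R K m \<rho> r a :: real
  assumes S: "spray_bound S (cball z0 R) K"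
    and G_derivative: "x \<in> cball z0 R \<Longrightarrow> (G has_derivative DG x) (at x)"
    and G_taylor: "x \<in> cball z0 R \<Longrightarrow> y \<in> cball z0 R \<Longrightarrow>
      \<bar>mform (G y - G x - DG x (y - x)) u v\<bar> \<le> K * (norm (y - x))\<^sup>2 * norm u * norm v"
    and G_lipschitz: "x \<in> cball z0 R \<Longrightarrow> y \<in> cball z0 R \<Longrightarrow>
      \<bar>mform (G y - G x) u v\<bar> \<le> K * norm (y - x) * norm u * norm v"
    and G_bound: "x \<in> cball z0 R \<Longrightarrow> \<bar>mform (G x) u v\<bar> \<le> K * norm u * norm v"
    and G_sym: "x \<in> cball z0 R \<Longrightarrow> mform (G x) u v = mform (G x) v u"
    and euler_lagrange: "x \<in> cball z0 R \<Longrightarrow>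
      mform (G x) (S x u) w = 1/2 * mform (DG x w) u u - mform (DG x u) u w"
    and T_timelike: "x \<in> cball z0 R \<Longrightarrow> mform (G x) (T x) (T x) < 0"
    and causal_T: "x \<in> cball z0 R \<Longrightarrow> u \<noteq> 0 \<Longrightarrow> mform (G x) u u \<le> 0 \<Longrightarrow> mform (G x) u (T x) \<noteq> 0"
    and future_future: "x \<in> cball z0 R \<Longrightarrow> mform (G x) u u < 0 \<Longrightarrow> mform (G x) u (T x) < 0 \<Longrightarrow>
      mform (G x) v v \<le> 0 \<Longrightarrow> mform (G x) v (T x) < 0 \<Longrightarrow> mform (G x) u v < 0"
    and T_continuous: "continuous_on (cball z0 R) T"
    and tau_bound: "x \<in> cball z0 R \<Longrightarrow> mform (G x) u u \<le> 0 \<Longrightarrow> mform (G x) u (T x) < 0 \<Longrightarrow>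
      m * norm u \<le> \<tau> \<bullet> u"
    and r: "0 < r" "r \<le> \<rho> / 8" "r + \<rho> \<le> R"
    and \<rho>: "K * (\<rho>\<^sup>2 + \<rho>) \<le> 1/4"
    and R: "2 * K * R \<le> 1"
    and a: "a = K * norm \<tau> + 1" "4 * a * r < m"
begin

lemma K: "0 \<le> K" using S by (simp add: spray_bound_def)

lemma rho_pos: "0 < \<rho>" using r by simp

lemma ball_subset: "cball z0 r \<subseteq> cball z0 R"
  using r rho_pos by (intro cball_subset_cball_iff[THEN iffD2]) auto

lemma a_ge_1: "1 \<le> a" using a K by simp

lemma G_continuous: "continuous_on (cball z0 R) G"
  using G_derivative by (meson continuous_at_imp_continuous_on has_derivative_continuous)

subsection \<open>The geodesics of a small ball\<close>

definition joins :: "real^'n \<Rightarrow> real^'n \<Rightarrow> (real \<Rightarrow> real^'n) \<Rightarrow> (real \<Rightarrow> real^'n) \<Rightarrow> bool" where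
  "joins x y X U \<longleftrightarrow> spray_solution S {0..1} X U \<and> X 0 = x \<and> X 1 = y \<and>
     (\<forall>t\<in>{0..1}. norm (U t) \<le> \<rho> \<and> X t \<in> cball z0 R)"

lemma joinsD:
  assumes "joins x y X U"
  shows "spray_solution S {0..1} X U" "X 0 = x" "X 1 = y"
    "\<And>t. t \<in> {0..1} \<Longrightarrow> norm (U t) \<le> \<rho>" "\<And>t. t \<in> {0..1} \<Longrightarrow> X t \<in> cball z0 R"
    "x \<in> cball z0 R" "y \<in> cball z0 R"
  using assms unfolding joins_def by (auto simp del: mem_cball)

lemma joins_exists:
  assumes "x \<in> cball z0 r" "y \<in> cball z0 r"
  shows "\<exists>X U. joins x y X U"
proof -
  have sub: "cball x \<rho> \<subseteq> cball z0 R"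
    using assms(1) r(3) by (intro cball_subset_cball_iff[THEN iffD2]) (auto simp: dist_commute)
  have "norm (y - x) \<le> \<rho> / 2"
    using assms r(2) rho_pos dist_triangle[of y x z0] by (simp add: dist_norm norm_minus_commute)
  then obtain X U where "spray_solution S {0..1} X U" "X 0 = x" "X 1 = y"
      "\<forall>t\<in>{0..1}. norm (U t) \<le> \<rho> \<and> X t \<in> cball x \<rho>"
    using spray_solution_joining[OF S sub _ _ \<rho>, of y] rho_pos by auto
  then show ?thesis using sub unfolding joins_def by blast
qed

lemma joins_const: "x \<in> cball z0 R \<Longrightarrow> joins x x (\<lambda>_. x) (\<lambda>_. 0)"
  using spray_solution_const[OF S] rho_pos by (auto simp: joins_def simp del: mem_cball)

text \<open>The perturbation estimate in terms of endpoints: the velocity of the difference is close to the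
difference of the endpoints, so it can be traded for the latter.\<close>

lemma joins_close:
  assumes J: "joins x y X U" "joins x' y' X' U'"
  shows "norm (U 0 - U' 0) \<le> 2 * norm (y - y') + 3 * norm (x - x')"
    and "\<And>t. t \<in> {0..1} \<Longrightarrow> norm (U t - U' t) \<le> 8 * (norm (x - x') + norm (y - y'))"
    and "\<And>t. t \<in> {0..1} \<Longrightarrow> norm (X t - X' t) \<le> 8 * (norm (x - x') + norm (y - y'))"
    and "norm (y - y') \<le> 2 * (norm (x - x') + norm (U 0 - U' 0))"
proof -
  note c = spray_solutions_close[OF S joinsD(1)[OF J(1)] joinsD(1)[OF J(2)]
      joinsD(5)[OF J(1)] joinsD(5)[OF J(2)] joinsD(4)[OF J(1)] joinsD(4)[OF J(2)] \<rho>,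
      unfolded joinsD(2,3)[OF J(1)] joinsD(2,3)[OF J(2)]]
  have "norm (U 0 - U' 0) \<le> norm ((y - y') - (x - x')) + norm ((y - y') - (x - x') - (U 0 - U' 0))"
    using norm_triangle_ineq4[of "(y - y') - (x - x')" "(y - y') - (x - x') - (U 0 - U' 0)"] by simp
  also have "\<dots> \<le> norm (y - y') + norm (x - x') + (norm (x - x') + norm (U 0 - U' 0)) / 2"
    by (intro add_mono c(4) norm_triangle_ineq4)
  finally show 1: "norm (U 0 - U' 0) \<le> 2 * norm (y - y') + 3 * norm (x - x')"
    by (simp add: field_simps)
  have d: "2 * (norm (x - x') + norm (U 0 - U' 0)) \<le> 8 * (norm (x - x') + norm (y - y'))"
    using 1 norm_ge_zero[of "y - y'"] by (simp add: distrib_left del: norm_ge_zero)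
  show "norm (U t - U' t) \<le> 8 * (norm (x - x') + norm (y - y'))" if "t \<in> {0..1}" for t
    by (rule order_trans[OF c(2) d]) (use that in auto)
  show "norm (X t - X' t) \<le> 8 * (norm (x - x') + norm (y - y'))" if "t \<in> {0..1}" for t
    by (rule order_trans[OF c(3) d]) (use that in auto)
  show "norm (y - y') \<le> 2 * (norm (x - x') + norm (U 0 - U' 0))"
    using c(3)[of 1] joinsD(3)[OF J(1)] joinsD(3)[OF J(2)] by simp
qed

lemma joins_unique:
  assumes "joins x y X U" "joins x y X' U'" "t \<in> {0..1}"
  shows "X t = X' t" "U t = U' t"
  using joins_close(2,3)[OF assms] by auto

text \<open>The map \<open>vel0 x\<close> is the inverse of the exponential map at \<open>x\<close>, and \<open>vel1 x y\<close> is the gradient at \<open>y\<close>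
of half the energy of the geodesic from \<open>x\<close>.\<close>

definition vel0 :: "real^'n \<Rightarrow> real^'n \<Rightarrow> real^'n" where
  "vel0 x y = (SOME v. \<exists>X U. joins x y X U \<and> v = U 0)"

definition vel1 :: "real^'n \<Rightarrow> real^'n \<Rightarrow> real^'n" where
  "vel1 x y = (SOME v. \<exists>X U. joins x y X U \<and> v = U 1)"

lemma vel_eq:
  assumes "joins x y X U"
  shows "vel0 x y = U 0" "vel1 x y = U 1"
proof -
  have "\<exists>X U. joins x y X U \<and> vel0 x y = U 0"
    unfolding vel0_def by (rule someI_ex) (use assms in blast)
  then show "vel0 x y = U 0" using joins_unique(2)[OF assms, of _ _ 0] by auto
  have "\<exists>X U. joins x y X U \<and> vel1 x y = U 1"
    unfolding vel1_def by (rule someI_ex) (use assms in blast)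
  then show "vel1 x y = U 1" using joins_unique(2)[OF assms, of _ _ 1] by auto
qed

lemma vel0_refl: "x \<in> cball z0 R \<Longrightarrow> vel0 x x = 0"
  using vel_eq(1)[OF joins_const] .

lemma vel_lipschitz:
  assumes "x \<in> cball z0 r" "y \<in> cball z0 r" "x' \<in> cball z0 r" "y' \<in> cball z0 r"
  shows "norm (vel0 x y - vel0 x' y') \<le> 8 * (norm (x - x') + norm (y - y'))"
    and "norm (vel1 x y - vel1 x' y') \<le> 8 * (norm (x - x') + norm (y - y'))"
    and "norm (y - y') \<le> 2 * (norm (x - x') + norm (vel0 x y - vel0 x' y'))"
proof -
  obtain X U where J: "joins x y X U" using joins_exists assms by blast
  obtain X' U' where J': "joins x' y' X' U'" using joins_exists assms by blast
  show "norm (vel0 x y - vel0 x' y') \<le> 8 * (norm (x - x') + norm (y - y'))"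
    and "norm (vel1 x y - vel1 x' y') \<le> 8 * (norm (x - x') + norm (y - y'))"
    and "norm (y - y') \<le> 2 * (norm (x - x') + norm (vel0 x y - vel0 x' y'))"
    unfolding vel_eq[OF J] vel_eq[OF J'] using joins_close(2,4)[OF J J'] by auto
qed

lemma vel_continuous:
  "continuous_on (cball z0 r \<times> cball z0 r) (\<lambda>(x, y). vel0 x y)"
  "continuous_on (cball z0 r \<times> cball z0 r) (\<lambda>(x, y). vel1 x y)"
proof -
  have L: "16-lipschitz_on (cball z0 r \<times> cball z0 r) (\<lambda>(x, y). v x y)"
    if v: "\<And>x y x' y'. x \<in> cball z0 r \<Longrightarrow> y \<in> cball z0 r \<Longrightarrow> x' \<in> cball z0 r \<Longrightarrow> y' \<in> cball z0 r \<Longrightarrow>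
        norm (v x y - v x' y') \<le> 8 * (norm (x - x') + norm (y - y'))" for v :: "real^'n \<Rightarrow> real^'n \<Rightarrow> real^'n"
  proof (rule lipschitz_onI)
    fix p q :: "(real^'n) \<times> (real^'n)"
    assume p: "p \<in> cball z0 r \<times> cball z0 r" and q: "q \<in> cball z0 r \<times> cball z0 r"
    have "norm (v (fst p) (snd p) - v (fst q) (snd q))
        \<le> 8 * (norm (fst p - fst q) + norm (snd p - snd q))"
      using p q by (intro v) (auto simp: mem_Times_iff simp del: mem_cball)
    also have "\<dots> \<le> 8 * (dist p q + dist p q)"
      using dist_fst_le[of p q] dist_snd_le[of p q]
      by (intro mult_left_mono add_mono) (auto simp: dist_norm)
    finally show "dist (case p of (x, y) \<Rightarrow> v x y) (case q of (x, y) \<Rightarrow> v x y) \<le> 16 * dist p q"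
      by (simp add: dist_norm case_prod_beta)
  qed simp
  show "continuous_on (cball z0 r \<times> cball z0 r) (\<lambda>(x, y). vel0 x y)"
    "continuous_on (cball z0 r \<times> cball z0 r) (\<lambda>(x, y). vel1 x y)"
    using lipschitz_on_continuous_on[OF L[OF vel_lipschitz(1)]]
      lipschitz_on_continuous_on[OF L[OF vel_lipschitz(2)]] by auto
qed

text \<open>The constant curve at \<open>x\<close> is also a geodesic. Comparison with it bounds the velocity, and shows that
the velocity of a geodesic between distinct points never vanishes.\<close>

lemma joins_speed:
  assumes J: "joins x y X U" and t: "t \<in> {0..1}"
  shows "norm (U t) \<le> 8 * norm (y - x)" and "norm (U 1 - (y - x)) \<le> 64 * K * (norm (y - x))\<^sup>2"
    and "x \<noteq> y \<Longrightarrow> U t \<noteq> 0"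
proof -
  note C = joins_const[OF joinsD(6)[OF J]]
  have u: "norm (U t) \<le> 8 * norm (y - x)" if "t \<in> {0..1}" for t
    using joins_close(2)[OF J C that] by simp
  then show "norm (U t) \<le> 8 * norm (y - x)" using t .
  have du: "norm (U s - U 1) \<le> 64 * K * (norm (y - x))\<^sup>2" if s: "s \<in> {0..1}" for s
  proof -
    have "norm (U s - U 1) \<le> K * (8 * norm (y - x))\<^sup>2 * \<bar>s - 1\<bar>"
    proof (rule vector_derivative_lipschitz[where a = 0 and b = 1 and f' = "\<lambda>t. S (X t) (U t)"])
      show "norm (S (X t) (U t)) \<le> K * (8 * norm (y - x))\<^sup>2" if "t \<in> {0..1}" for t
        using spray_bound_norm[OF S joinsD(5)[OF J that] u[OF that]] .
    qed (use joinsD(1)[OF J] s in \<open>auto simp: spray_solution_def\<close>)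
    also have "\<dots> \<le> K * (8 * norm (y - x))\<^sup>2" using s K by (intro mult_left_le) auto
    finally show ?thesis by (simp add: power_mult_distrib)
  qed
  have "norm ((X 1 - 1 *\<^sub>R U 1) - (X 0 - 0 *\<^sub>R U 1)) \<le> 64 * K * (norm (y - x))\<^sup>2 * \<bar>1 - 0\<bar>"
  proof (rule vector_derivative_lipschitz[where a = 0 and b = 1 and f' = "\<lambda>t. U t - U 1" and
        f = "\<lambda>t. X t - t *\<^sub>R U 1"])
    show "((\<lambda>t. X t - t *\<^sub>R U 1) has_vector_derivative U t - U 1) (at t within {0..1})"
      if "t \<in> {0..1}" for t
      using joinsD(1)[OF J] that unfolding spray_solution_def
      by (auto intro!: derivative_eq_intros)
  qed (use du in auto)
  then have "norm (y - x - U 1) \<le> 64 * K * (norm (y - x))\<^sup>2"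
    using joinsD(2,3)[OF J] by (simp add: algebra_simps)
  then show "norm (U 1 - (y - x)) \<le> 64 * K * (norm (y - x))\<^sup>2" by (simp add: norm_minus_commute)
  show "U t \<noteq> 0" if "x \<noteq> y"
  proof
    assume "U t = 0"
    have "norm (U t - U 0) \<le> norm (U 0) / 2"
      using spray_solutions_close(1)[OF S joinsD(1)[OF J] joinsD(1)[OF C] joinsD(5)[OF J]
          joinsD(5)[OF C] joinsD(4)[OF J] joinsD(4)[OF C] \<rho> t] joinsD(2)[OF J] by simp
    then have "U 0 = 0" using \<open>U t = 0\<close> by simp
    then have "norm (y - x) \<le> 0" using joins_close(4)[OF J C] by simp
    then show False using that by simp
  qed
qed

lemma joins_scale:
  assumes J: "joins x y X U" and s: "s \<in> {0..1}"
  shows "joins x (X s) (\<lambda>t. X (s * t)) (\<lambda>t. s *\<^sub>R U (s * t))"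
proof -
  have st: "0 + s * t \<in> {0..1}" if "t \<in> {0..1}" for t
    using s that by (auto intro: mult_le_one)
  have "spray_solution S {0..1} (\<lambda>t. X (0 + s * t)) (\<lambda>t. s *\<^sub>R U (0 + s * t))"
    by (rule spray_solution_affine[OF joinsD(1)[OF J] S joinsD(5)[OF J] st])
  moreover have "norm (s *\<^sub>R U (s * t)) \<le> \<rho>" if "t \<in> {0..1}" for t
  proof -
    have "norm (s *\<^sub>R U (s * t)) \<le> 1 * norm (U (s * t))" using s by (auto intro: mult_left_le_one_le)
    then show ?thesis using joinsD(4)[OF J st[OF that]] by simp
  qed
  ultimately show ?thesis
    using joinsD(2)[OF J] joinsD(5)[OF J st] unfolding joins_def by (auto simp del: mem_cball)
qed

text \<open>This extends the uniqueness of slow geodesics to geodesics in the small ball that are not known to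
be slow in advance.\<close>

lemma joins_if_in_small_ball:
  assumes X: "spray_solution S {0..1} X U" and r': "\<And>t. t \<in> {0..1} \<Longrightarrow> X t \<in> cball z0 r"
  shows "joins (X 0) (X 1) X U"
proof -
  have XR: "X t \<in> cball z0 R" if "t \<in> {0..1}" for t using r'[OF that] ball_subset by blast
  have D: "norm (X s - X t) \<le> 2 * r" if "s \<in> {0..1}" "t \<in> {0..1}" for s t
    using r'[OF that(1)] r'[OF that(2)] dist_triangle[of "X s" "X t" z0]
    by (simp add: dist_norm norm_minus_commute)
  have "K * (8 * r) \<le> K * (\<rho>\<^sup>2 + \<rho>)" using K r by (intro mult_left_mono) (auto intro: add_increasing)
  then have "4 * K * (2 * r) < 1" using \<rho> by simp
  then have "norm (U t) \<le> \<rho>" if "t \<in> {0..1}" for t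
    using spray_solution_speed_bound[OF S X XR D _ that] r by simp
  then show ?thesis using X XR unfolding joins_def by blast
qed

subsection \<open>Causality of geodesics\<close>

lemma metric_along_curve:
  assumes "(X has_vector_derivative X') (at t within I)" "X t \<in> cball z0 R"
    and "(u has_vector_derivative u') (at t within I)" "(v has_vector_derivative v') (at t within I)"
  shows "((\<lambda>t. mform (G (X t)) (u t) (v t)) has_real_derivative
     mform (DG (X t) X') (u t) (v t) + mform (G (X t)) u' (v t) + mform (G (X t)) (u t) v')
     (at t within I)"
proof -
  have "((G \<circ> X) has_vector_derivative DG (X t) X') (at t within I)"
    using vector_derivative_diff_chain_within[OF assms(1)]
      has_derivative_at_withinI[OF G_derivative[OF assms(2)]] by blast
  then have "((\<lambda>t. G (X t)) has_vector_derivative DG (X t) X') (at t within I)"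
    by (simp add: o_def)
  then show ?thesis by (rule mform_has_real_derivative[OF _ assms(3,4)])
qed

text \<open>The Euler--Lagrange equation, tested with the velocity itself.\<close>

lemma energy_constant:
  assumes J: "joins x y X U" and t: "s \<in> {0..1}" "t \<in> {0..1}"
  shows "mform (G (X s)) (U s) (U s) = mform (G (X t)) (U t) (U t)"
proof -
  have d: "((\<lambda>t. mform (G (X t)) (U t) (U t)) has_real_derivative 0) (at t within {0..1})"
    if "t \<in> {0..1}" for t
  proof -
    have "((\<lambda>t. mform (G (X t)) (U t) (U t)) has_real_derivative
       mform (DG (X t) (U t)) (U t) (U t) + mform (G (X t)) (S (X t) (U t)) (U t) +
       mform (G (X t)) (U t) (S (X t) (U t))) (at t within {0..1})"
      using joinsD(1,5)[OF J] that unfolding spray_solution_def by (intro metric_along_curve) auto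
    then show ?thesis
      using euler_lagrange[OF joinsD(5)[OF J that]] G_sym[OF joinsD(5)[OF J that]] by simp
  qed
  have *: "mform (G (X s)) (U s) (U s) = mform (G (X t)) (U t) (U t)"
    if "s < t" "s \<in> {0..1}" "t \<in> {0..1}" for s t
    using mean_value_within[OF d that] by auto
  show ?thesis
  proof (cases s t rule: linorder_cases)
    case less
    then show ?thesis by (rule *[OF _ t])
  next
    case greater
    then show ?thesis by (rule *[OF _ t(2,1), symmetric])
  qed simp
qed

text \<open>The function \<open>t \<mapsto> 2 g(U, X' - X)\<close> has, by the Euler--Lagrange equation, the linearisation of
the energy density as its derivative. The energies being constant in \<open>t\<close>, the mean value theorem
replaces the integration of the variation formula: the error is the quadratic remainder at a single
parameter \<open>\<xi>\<close>.\<close>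

lemma first_variation:
  assumes J: "joins x y X U" and J': "joins x y' X' U'"
  shows "\<bar>mform (G y') (U' 1) (U' 1) - mform (G y) (U 1) (U 1) - 2 * mform (G y) (U 1) (y' - y)\<bar>
    \<le> 64 * K * (\<rho> + 1)\<^sup>2 * (norm (y' - y))\<^sup>2"
proof -
  define e where "e = 8 * norm (y' - y)"
  have e: "norm (X' t - X t) \<le> e" "norm (U' t - U t) \<le> e" if "t \<in> {0..1}" for t
    using joins_close(2,3)[OF J' J that] by (auto simp: e_def)
  have d: "((\<lambda>t. 2 * mform (G (X t)) (U t) (X' t - X t)) has_real_derivative
      mform (DG (X t) (X' t - X t)) (U t) (U t) + 2 * mform (G (X t)) (U t) (U' t - U t))
      (at t within {0..1})" if t: "t \<in> {0..1}" for t
  proof -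
    have "((\<lambda>t. mform (G (X t)) (U t) (X' t - X t)) has_real_derivative
       mform (DG (X t) (U t)) (U t) (X' t - X t) + mform (G (X t)) (S (X t) (U t)) (X' t - X t) +
       mform (G (X t)) (U t) (U' t - U t)) (at t within {0..1})"
      using joinsD(1,5)[OF J] joinsD(1,5)[OF J'] t unfolding spray_solution_def
      by (intro metric_along_curve has_vector_derivative_diff) auto
    from DERIV_cmult[OF this, of 2] show ?thesis
      using euler_lagrange[OF joinsD(5)[OF J t]] by (simp add: algebra_simps)
  qed
  \<comment> \<open>The boundary term at \<open>0\<close> vanishes because both geodesics start at \<open>x\<close>.\<close>
  obtain \<xi> where \<xi>: "\<xi> \<in> {0..1}" "2 * mform (G (X 1)) (U 1) (X' 1 - X 1)
      - 2 * mform (G (X 0)) (U 0) (X' 0 - X 0)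
      = (1 - 0) * (mform (DG (X \<xi>) (X' \<xi> - X \<xi>)) (U \<xi>) (U \<xi>) + 2 * mform (G (X \<xi>)) (U \<xi>) (U' \<xi> - U \<xi>))"
    using mean_value_within[OF d, of 0 1] by auto
  define w where "w = X' \<xi> - X \<xi>"
  define w' where "w' = U' \<xi> - U \<xi>"
  note XR = joinsD(5)[OF J \<xi>(1)] joinsD(5)[OF J' \<xi>(1)]
  have U: "norm (U \<xi>) \<le> \<rho>" using joinsD(4)[OF J \<xi>(1)] .
  have w: "norm w \<le> e" "norm w' \<le> e" using e[OF \<xi>(1)] by (auto simp: w_def w'_def)
  have e0: "0 \<le> e" by (simp add: e_def)
  have en: "mform (G y) (U 1) (U 1) = mform (G (X \<xi>)) (U \<xi>) (U \<xi>)"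
      "mform (G y') (U' 1) (U' 1) = mform (G (X' \<xi>)) (U \<xi> + w') (U \<xi> + w')"
    using energy_constant[OF J, of 1 \<xi>] energy_constant[OF J', of 1 \<xi>] \<xi>(1) joinsD(3)[OF J]
      joinsD(3)[OF J'] by (auto simp: w'_def)
  have bv: "2 * mform (G y) (U 1) (y' - y)
      = mform (DG (X \<xi>) w) (U \<xi>) (U \<xi>) + 2 * mform (G (X \<xi>)) (U \<xi>) w'"
    using \<xi>(2) joinsD(2,3)[OF J] joinsD(2,3)[OF J'] by (simp add: mform_simps w_def w'_def)
  have "mform (G y') (U' 1) (U' 1) - mform (G y) (U 1) (U 1) - 2 * mform (G y) (U 1) (y' - y)
      = mform (G (X' \<xi>) - G (X \<xi>) - DG (X \<xi>) w) (U \<xi>) (U \<xi>)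
        + mform (G (X' \<xi>) - G (X \<xi>)) (U \<xi>) w' + mform (G (X' \<xi>) - G (X \<xi>)) w' (U \<xi>)
        + mform (G (X' \<xi>)) w' w'"
    unfolding en bv using G_sym[OF XR(1), of w' "U \<xi>"] by (simp add: mform_simps)
  also have "\<bar>\<dots>\<bar> \<le> K * e\<^sup>2 * \<rho> * \<rho> + K * e * \<rho> * e + K * e * e * \<rho> + K * e * e"
  proof (intro order_trans[OF abs_triangle_ineq] add_mono)
    have "\<bar>mform (G (X' \<xi>) - G (X \<xi>) - DG (X \<xi>) w) (U \<xi>) (U \<xi>)\<bar>
        \<le> K * (norm w)\<^sup>2 * norm (U \<xi>) * norm (U \<xi>)"
      unfolding w_def by (rule G_taylor[OF XR])
    also have "\<dots> \<le> K * e\<^sup>2 * \<rho> * \<rho>"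
      using K w U e0 rho_pos by (intro mult_mono power_mono) auto
    finally show "\<bar>mform (G (X' \<xi>) - G (X \<xi>) - DG (X \<xi>) w) (U \<xi>) (U \<xi>)\<bar> \<le> K * e\<^sup>2 * \<rho> * \<rho>" .
    have "\<bar>mform (G (X' \<xi>) - G (X \<xi>)) (U \<xi>) w'\<bar> \<le> K * norm w * norm (U \<xi>) * norm w'"
      unfolding w_def by (rule G_lipschitz[OF XR])
    also have "\<dots> \<le> K * e * \<rho> * e"
      using K w U e0 rho_pos by (intro mult_mono) auto
    finally show "\<bar>mform (G (X' \<xi>) - G (X \<xi>)) (U \<xi>) w'\<bar> \<le> K * e * \<rho> * e" .
    have "\<bar>mform (G (X' \<xi>) - G (X \<xi>)) w' (U \<xi>)\<bar> \<le> K * norm w * norm w' * norm (U \<xi>)"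
      unfolding w_def by (rule G_lipschitz[OF XR])
    also have "\<dots> \<le> K * e * e * \<rho>"
      using K w U e0 rho_pos by (intro mult_mono) auto
    finally show "\<bar>mform (G (X' \<xi>) - G (X \<xi>)) w' (U \<xi>)\<bar> \<le> K * e * e * \<rho>" .
    have "\<bar>mform (G (X' \<xi>)) w' w'\<bar> \<le> K * norm w' * norm w'" by (rule G_bound[OF XR(2)])
    also have "\<dots> \<le> K * e * e" using K w e0 by (intro mult_mono) auto
    finally show "\<bar>mform (G (X' \<xi>)) w' w'\<bar> \<le> K * e * e" .
  qed
  also have "\<dots> = 64 * K * (\<rho> + 1)\<^sup>2 * (norm (y' - y))\<^sup>2"
    by (simp add: e_def power2_eq_square algebra_simps)
  finally show ?thesis .
qed

definition energy :: "real^'n \<Rightarrow> real^'n \<Rightarrow> real" where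
  "energy x y = mform (G y) (vel1 x y) (vel1 x y)"

lemma energy_derivative:
  assumes x: "x \<in> cball z0 r" and y: "y \<in> cball z0 r"
  shows "(energy x has_derivative (\<lambda>w. 2 * mform (G y) (vel1 x y) w)) (at y within cball z0 r)"
proof (rule has_derivativeI_sandwich[where e = 1 and H = "\<lambda>y'. 64 * K * (\<rho> + 1)\<^sup>2 * norm (y' - y)"])
  show "bounded_linear (\<lambda>w. 2 * mform (G y) (vel1 x y) w)"
    by (intro linear_conv_bounded_linear[THEN iffD1] linearI) (simp_all add: mform_simps)
  fix y' assume y': "y' \<in> cball z0 r" "y' \<noteq> y"
  obtain X U where J: "joins x y X U" using joins_exists x y by blast
  obtain X' U' where J': "joins x y' X' U'" using joins_exists x y' by blast
  have "\<bar>energy x y' - energy x y - 2 * mform (G y) (vel1 x y) (y' - y)\<bar>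
      \<le> 64 * K * (\<rho> + 1)\<^sup>2 * (norm (y' - y))\<^sup>2"
    using first_variation[OF J J'] by (simp add: energy_def vel_eq[OF J] vel_eq[OF J'])
  then show "norm (energy x y' - energy x y - 2 * mform (G y) (vel1 x y) (y' - y)) / norm (y' - y)
      \<le> 64 * K * (\<rho> + 1)\<^sup>2 * norm (y' - y)"
    using y'(2) by (simp add: divide_le_eq power2_eq_square mult.assoc)
next
  have "((\<lambda>y'. 64 * K * (\<rho> + 1)\<^sup>2 * norm (y' - y)) \<longlongrightarrow> 64 * K * (\<rho> + 1)\<^sup>2 * norm (y - y))
      (at y within cball z0 r)"
    by (intro tendsto_intros)
  then show "((\<lambda>y'. 64 * K * (\<rho> + 1)\<^sup>2 * norm (y' - y)) \<longlongrightarrow> 0) (at y within cball z0 r)" by simp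
qed simp

definition future_curve :: "(real \<Rightarrow> real^'n) \<Rightarrow> (real \<Rightarrow> real^'n) \<Rightarrow> real \<Rightarrow> real \<Rightarrow> bool" where
  "future_curve c c' \<alpha> \<beta> \<longleftrightarrow> \<alpha> < \<beta> \<and>
     (\<forall>t\<in>{\<alpha>..\<beta>}. (c has_vector_derivative c' t) (at t within {\<alpha>..\<beta>}) \<and> c t \<in> cball z0 r \<and>
        mform (G (c t)) (c' t) (c' t) \<le> 0 \<and> mform (G (c t)) (c' t) (T (c t)) < 0)"

lemma future_curveD:
  assumes "future_curve c c' \<alpha> \<beta>"
  shows "\<alpha> < \<beta>" "\<And>t. t \<in> {\<alpha>..\<beta>} \<Longrightarrow> (c has_vector_derivative c' t) (at t within {\<alpha>..\<beta>})"
    "\<And>t. t \<in> {\<alpha>..\<beta>} \<Longrightarrow> c t \<in> cball z0 r" "\<And>t. t \<in> {\<alpha>..\<beta>} \<Longrightarrow> c t \<in> cball z0 R"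
    "\<And>t. t \<in> {\<alpha>..\<beta>} \<Longrightarrow> mform (G (c t)) (c' t) (c' t) \<le> 0"
    "\<And>t. t \<in> {\<alpha>..\<beta>} \<Longrightarrow> mform (G (c t)) (c' t) (T (c t)) < 0"
    "continuous_on {\<alpha>..\<beta>} c"
  using assms ball_subset unfolding future_curve_def
  by (blast, blast, blast, blast, blast, blast,
      meson continuous_on_eq_continuous_within has_vector_derivative_continuous)

text \<open>As long as the final velocity of the geodesic from \<open>x\<close> to \<open>c t\<close> is future directed and timelike, its
product with the future directed causal vector \<open>c' t\<close> is negative, so the energy decreases. Hence
there is no first parameter at which it stops being timelike or future directed.\<close>

lemma timelike_along_future_curve:
  assumes c: "future_curve c c' \<alpha> \<beta>" and x: "x \<in> cball z0 r"
    and init: "energy x (c \<alpha>) < 0" "mform (G (c \<alpha>)) (vel1 x (c \<alpha>)) (T (c \<alpha>)) < 0"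
  shows "energy x (c \<beta>) < 0 \<and> mform (G (c \<beta>)) (vel1 x (c \<beta>)) (T (c \<beta>)) < 0"
proof -
  define P where "P t = vel1 x (c t)" for t
  define f where "f t = energy x (c t)" for t
  define h where "h t = mform (G (c t)) (P t) (T (c t))" for t
  note cD = future_curveD[OF c]
  have fP: "f t = mform (G (c t)) (P t) (P t)" for t by (simp add: f_def energy_def P_def)
  have Pc: "continuous_on {\<alpha>..\<beta>} P"
  proof -
    have "continuous_on {\<alpha>..\<beta>} ((\<lambda>(x, y). vel1 x y) \<circ> (\<lambda>t. (x, c t)))"
      by (intro continuous_on_compose continuous_intros cD(7)
          continuous_on_subset[OF vel_continuous(2)]) (use x cD(3) in auto)
    then show ?thesis by (simp add: o_def P_def[abs_def])
  qed
  have Gc: "continuous_on {\<alpha>..\<beta>} (\<lambda>t. G (c t))" and Tc: "continuous_on {\<alpha>..\<beta>} (\<lambda>t. T (c t))"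
    by (rule continuous_on_compose2[OF G_continuous cD(7)]
          continuous_on_compose2[OF T_continuous cD(7)]; use cD(4) in blast)+
  have fc: "continuous_on {\<alpha>..\<beta>} f" and hc: "continuous_on {\<alpha>..\<beta>} h"
    unfolding fP[abs_def] h_def by (intro continuous_intros Gc Tc Pc)+
  have df: "(f has_real_derivative 2 * mform (G (c t)) (P t) (c' t)) (at t within {\<alpha>..\<beta>})"
    if t: "t \<in> {\<alpha>..\<beta>}" for t
  proof -
    have "(energy x has_derivative (\<lambda>w. 2 * mform (G (c t)) (vel1 x (c t)) w)) (at (c t) within c ` {\<alpha>..\<beta>})"
      using energy_derivative[OF x cD(3)[OF t]] cD(3) by (auto intro: has_derivative_subset simp del: mem_cball)
    from vector_derivative_diff_chain_within[OF cD(2)[OF t] this]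
    show ?thesis
      by (simp add: has_real_derivative_iff_has_vector_derivative o_def f_def[abs_def] P_def)
  qed
  \<comment> \<open>This set is closed; its least element would be the first parameter of failure.\<close>
  define bad where "bad = {t \<in> {\<alpha>..\<beta>}. 0 \<le> f t} \<union> {t \<in> {\<alpha>..\<beta>}. 0 \<le> h t}"
  have "bad = {}"
  proof (rule ccontr)
    assume ne: "bad \<noteq> {}"
    have "closed bad"
      unfolding bad_def
      by (intro closed_Un continuous_on_closed_Collect_le fc hc continuous_on_const closed_atLeastAtMost)
    moreover have "bad \<subseteq> {\<alpha>..\<beta>}" by (auto simp: bad_def)
    ultimately have "compact bad"
      by (metis compact_Icc compact_Int_closed inf.absorb_iff2)
    then obtain u where u: "u \<in> bad" "\<And>t. t \<in> bad \<Longrightarrow> u \<le> t"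
      using compact_attains_inf[OF _ ne] by blast
    have u1: "u \<in> {\<alpha>..\<beta>}" using u(1) by (auto simp: bad_def)
    have good: "f t < 0 \<and> h t < 0" if "t \<in> {\<alpha>..\<beta>}" "t < u" for t
    proof -
      have "\<not> 0 \<le> f t" "\<not> 0 \<le> h t" using u(2)[of t] that by (auto simp: bad_def)
      then show ?thesis by simp
    qed
    have "\<alpha> \<notin> bad" using init by (auto simp: bad_def f_def h_def P_def)
    then have "\<alpha> < u" using u u1 by (metis atLeastAtMost_iff order_le_imp_less_or_eq)
    then obtain \<xi> where \<xi>: "\<xi> < u" "\<xi> \<in> {\<alpha>..\<beta>}"
        "f u - f \<alpha> = (u - \<alpha>) * (2 * mform (G (c \<xi>)) (P \<xi>) (c' \<xi>))"
      using mean_value_within[OF df \<open>\<alpha> < u\<close>] u1 by auto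
    have "mform (G (c \<xi>)) (P \<xi>) (c' \<xi>) < 0"
    proof (rule future_future[OF cD(4)[OF \<xi>(2)] _ _ cD(5)[OF \<xi>(2)] cD(6)[OF \<xi>(2)]])
      show "mform (G (c \<xi>)) (P \<xi>) (P \<xi>) < 0" using good[OF \<xi>(2,1)] unfolding fP by blast
      show "mform (G (c \<xi>)) (P \<xi>) (T (c \<xi>)) < 0" using good[OF \<xi>(2,1)] unfolding h_def by blast
    qed
    then have "f u < f \<alpha>"
      using \<xi>(3) \<open>\<alpha> < u\<close> by (smt (verit) mult_pos_neg)
    then have fu: "f u < 0" using init by (simp add: f_def)
    have "h t \<noteq> 0" if "t \<in> {\<alpha>..u}" for t
    proof (cases "t = u")
      case True
      have "P u \<noteq> 0" using fu by (auto simp: fP mform_simps)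
      then show ?thesis using causal_T[OF cD(4)[OF u1], of "P u"] fu True by (simp add: fP h_def)
    next
      case False
      then show ?thesis using good[of t] that u1 by auto
    qed
    then have "h u < 0"
      using nonvanishing_negative[of \<alpha> u h \<alpha> u] init(2) \<open>\<alpha> < u\<close> u1
        continuous_on_subset[OF hc, of "{\<alpha>..u}"] by (auto simp: h_def P_def)
    then show False using fu u(1) by (auto simp: bad_def)
  qed
  then have "\<not> 0 \<le> f \<beta>" "\<not> 0 \<le> h \<beta>" using cD(1) by (auto simp: bad_def)
  then show ?thesis by (simp add: f_def h_def P_def)
qed

text \<open>The geodesic from \<open>x - \<delta> T x\<close> to \<open>x\<close> has the velocity \<open>\<delta> T x\<close> up to an error of order \<open>\<delta>\<^sup>2\<close>.\<close>

lemma past_point_timelike: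
  assumes x: "x \<in> ball z0 r"
  shows "\<forall>\<^sub>F \<delta> in at_right 0. x - \<delta> *\<^sub>R T x \<in> cball z0 r \<and> energy (x - \<delta> *\<^sub>R T x) x < 0 \<and>
    mform (G x) (vel1 (x - \<delta> *\<^sub>R T x) x) (T x) < 0"
proof -
  have xc: "x \<in> cball z0 r" using x by auto
  then have xR: "x \<in> cball z0 R" using ball_subset by blast
  define q where "q \<delta> = vel1 (x - \<delta> *\<^sub>R T x) x /\<^sub>R \<delta>" for \<delta>
  have "((\<lambda>\<delta>. x - \<delta> *\<^sub>R T x) \<longlongrightarrow> x - 0 *\<^sub>R T x) (at_right 0)" by (intro tendsto_intros)
  then have "\<forall>\<^sub>F \<delta> in at_right 0. x - \<delta> *\<^sub>R T x \<in> ball z0 r"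
    using x by (intro topological_tendstoD) auto
  then have in_ball: "\<forall>\<^sub>F \<delta> in at_right 0. x - \<delta> *\<^sub>R T x \<in> cball z0 r"
    by eventually_elim auto
  have pos: "\<forall>\<^sub>F \<delta> in at_right (0::real). 0 < \<delta>" by (simp add: eventually_at_right_less)
  have bd: "\<forall>\<^sub>F \<delta> in at_right 0. norm (q \<delta> - T x) \<le> 64 * K * (norm (T x))\<^sup>2 * \<delta>"
    using in_ball pos
  proof eventually_elim
    fix \<delta> :: real assume \<delta>: "x - \<delta> *\<^sub>R T x \<in> cball z0 r" "0 < \<delta>"
    obtain X U where J: "joins (x - \<delta> *\<^sub>R T x) x X U" using joins_exists[OF \<delta>(1) xc] by blast
    have "norm (vel1 (x - \<delta> *\<^sub>R T x) x - \<delta> *\<^sub>R T x) \<le> 64 * K * (norm (\<delta> *\<^sub>R T x))\<^sup>2"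
      using joins_speed(2)[OF J, of 1] by (simp add: vel_eq[OF J])
    moreover have "vel1 (x - \<delta> *\<^sub>R T x) x - \<delta> *\<^sub>R T x = \<delta> *\<^sub>R (q \<delta> - T x)"
      using \<delta>(2) by (simp add: q_def scaleR_right_diff_distrib)
    ultimately have "norm (q \<delta> - T x) * \<delta> \<le> 64 * K * (norm (\<delta> *\<^sub>R T x))\<^sup>2"
      using \<delta>(2) by (simp add: mult.commute)
    then have "norm (q \<delta> - T x) * \<delta> \<le> (64 * K * (norm (T x))\<^sup>2 * \<delta>) * \<delta>"
      by (simp add: power_mult_distrib power2_eq_square mult_ac)
    then show "norm (q \<delta> - T x) \<le> 64 * K * (norm (T x))\<^sup>2 * \<delta>"
      using \<delta>(2) by (rule mult_right_le_imp_le)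
  qed
  have "((\<lambda>\<delta>. 64 * K * (norm (T x))\<^sup>2 * \<delta>) \<longlongrightarrow> 64 * K * (norm (T x))\<^sup>2 * 0) (at_right 0)"
    by (intro tendsto_intros)
  then have "((\<lambda>\<delta>. q \<delta> - T x) \<longlongrightarrow> 0) (at_right 0)"
    by (intro Lim_null_comparison[OF bd]) simp
  then have q: "(q \<longlongrightarrow> T x) (at_right 0)" by (simp add: LIM_zero_iff)
  have "((\<lambda>\<delta>. mform (G x) (q \<delta>) (q \<delta>)) \<longlongrightarrow> mform (G x) (T x) (T x)) (at_right 0)"
    by (intro tendsto_intros q)
  then have e1: "\<forall>\<^sub>F \<delta> in at_right 0. mform (G x) (q \<delta>) (q \<delta>) < 0"
    by (rule order_tendstoD) (rule T_timelike[OF xR])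
  have "((\<lambda>\<delta>. mform (G x) (q \<delta>) (T x)) \<longlongrightarrow> mform (G x) (T x) (T x)) (at_right 0)"
    by (intro tendsto_intros q)
  then have e2: "\<forall>\<^sub>F \<delta> in at_right 0. mform (G x) (q \<delta>) (T x) < 0"
    by (rule order_tendstoD) (rule T_timelike[OF xR])
  show ?thesis
    using in_ball pos e1 e2
  proof eventually_elim
    fix \<delta> :: real
    assume \<delta>: "x - \<delta> *\<^sub>R T x \<in> cball z0 r" "0 < \<delta>" "mform (G x) (q \<delta>) (q \<delta>) < 0"
      "mform (G x) (q \<delta>) (T x) < 0"
    have v: "vel1 (x - \<delta> *\<^sub>R T x) x = \<delta> *\<^sub>R q \<delta>" using \<delta>(2) by (simp add: q_def)
    show "x - \<delta> *\<^sub>R T x \<in> cball z0 r \<and> energy (x - \<delta> *\<^sub>R T x) x < 0 \<and>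
      mform (G x) (vel1 (x - \<delta> *\<^sub>R T x) x) (T x) < 0"
      using \<delta> by (simp add: energy_def v mform_simps mult_less_0_iff del: mem_cball)
  qed
qed

lemma future_curve_ends_distinct:
  assumes c: "future_curve c c' \<alpha> \<beta>"
  shows "c \<alpha> \<noteq> c \<beta>"
proof -
  note cD = future_curveD[OF c]
  have m: "0 < m" using a r a_ge_1 by (smt (verit) mult_pos_pos)
  have d: "((\<lambda>t. \<tau> \<bullet> c t) has_real_derivative \<tau> \<bullet> c' t) (at t within {\<alpha>..\<beta>})"
    if "t \<in> {\<alpha>..\<beta>}" for t
    unfolding has_real_derivative_iff_has_vector_derivative
    using cD(2)[OF that] by (rule bounded_linear.has_vector_derivative[OF bounded_linear_inner_right])
  obtain \<xi> where \<xi>: "\<xi> \<in> {\<alpha>..\<beta>}" "\<tau> \<bullet> c \<beta> - \<tau> \<bullet> c \<alpha> = (\<beta> - \<alpha>) * (\<tau> \<bullet> c' \<xi>)"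
    using mean_value_within[OF d cD(1)] cD(1) by auto
  have "c' \<xi> \<noteq> 0" using cD(6)[OF \<xi>(1)] by (auto simp: mform_simps)
  then have "0 < m * norm (c' \<xi>)" using m by simp
  then have "0 < \<tau> \<bullet> c' \<xi>" using tau_bound[OF cD(4-6)[OF \<xi>(1)]] by linarith
  then show ?thesis using \<xi>(2) cD(1) by auto
qed

text \<open>By \<open>past_point_timelike\<close>, the curve starts in the timelike future of \<open>c \<alpha> - \<delta> T (c \<alpha>)\<close>, so
\<open>timelike_along_future_curve\<close> applies with this base point; then \<open>\<delta>\<close> tends to \<open>0\<close>.\<close>

lemma causal_end_velocity:
  assumes c: "future_curve c c' \<alpha> \<beta>" and \<alpha>: "c \<alpha> \<in> ball z0 r"
  shows "mform (G (c \<beta>)) (vel1 (c \<alpha>) (c \<beta>)) (vel1 (c \<alpha>) (c \<beta>)) \<le> 0 \<and>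
    mform (G (c \<beta>)) (vel1 (c \<alpha>) (c \<beta>)) (T (c \<beta>)) \<le> 0"
proof -
  define x where "x = c \<alpha>"
  define y where "y = c \<beta>"
  have xy: "x \<in> cball z0 r" "y \<in> cball z0 r"
    using future_curveD(1,3)[OF c] by (auto simp: x_def y_def simp del: mem_cball)
  define P where "P \<delta> = vel1 (x - \<delta> *\<^sub>R T x) y" for \<delta>
  have ev: "\<forall>\<^sub>F \<delta> in at_right 0. x - \<delta> *\<^sub>R T x \<in> cball z0 r \<and>
      mform (G y) (P \<delta>) (P \<delta>) < 0 \<and> mform (G y) (P \<delta>) (T y) < 0"
    using past_point_timelike[OF \<alpha>]
  proof eventually_elim
    case (elim \<delta>)
    then show ?case
      using timelike_along_future_curve[OF c, of "x - \<delta> *\<^sub>R T x"]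
      by (simp add: P_def energy_def x_def y_def del: mem_cball)
  qed
  have "((\<lambda>\<delta>. 8 * norm (\<delta> *\<^sub>R T x)) \<longlongrightarrow> 8 * norm (0 *\<^sub>R T x)) (at_right 0)"
    by (intro tendsto_intros)
  then have z: "((\<lambda>\<delta>. 8 * norm (\<delta> *\<^sub>R T x)) \<longlongrightarrow> 0) (at_right 0)" by simp
  have "\<forall>\<^sub>F \<delta> in at_right 0. norm (P \<delta> - vel1 x y) \<le> 8 * norm (\<delta> *\<^sub>R T x)"
    using ev
  proof eventually_elim
    case (elim \<delta>)
    then show ?case
      using vel_lipschitz(2)[OF _ xy(2) xy, of "x - \<delta> *\<^sub>R T x"] by (simp add: P_def del: mem_cball)
  qed
  from Lim_null_comparison[OF this z] have P: "(P \<longlongrightarrow> vel1 x y) (at_right 0)"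
    by (simp add: LIM_zero_iff)
  have "((\<lambda>\<delta>. mform (G y) (P \<delta>) (P \<delta>)) \<longlongrightarrow> mform (G y) (vel1 x y) (vel1 x y)) (at_right 0)"
    by (intro tendsto_intros P)
  then have 1: "mform (G y) (vel1 x y) (vel1 x y) \<le> 0"
    by (rule tendsto_upperbound) (use ev in \<open>auto elim: eventually_mono\<close>)
  have "((\<lambda>\<delta>. mform (G y) (P \<delta>) (T y)) \<longlongrightarrow> mform (G y) (vel1 x y) (T y)) (at_right 0)"
    by (intro tendsto_intros P)
  then have 2: "mform (G y) (vel1 x y) (T y) \<le> 0"
    by (rule tendsto_upperbound) (use ev in \<open>auto elim: eventually_mono\<close>)
  from 1 2 show ?thesis by (simp add: x_def y_def)
qed

text \<open>The energy is constant, and a nonzero causal vector is never orthogonal to \<open>T\<close>; so both signs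
propagate along the geodesic.\<close>

lemma joins_future:
  assumes J: "joins x y X U" and ne: "x \<noteq> y" and s: "s \<in> {0..1}"
    and c: "mform (G (X s)) (U s) (U s) \<le> 0" "mform (G (X s)) (U s) (T (X s)) \<le> 0" and t: "t \<in> {0..1}"
  shows "mform (G (X t)) (U t) (U t) \<le> 0 \<and> mform (G (X t)) (U t) (T (X t)) < 0"
proof -
  have causal: "mform (G (X t)) (U t) (U t) \<le> 0" if "t \<in> {0..1}" for t
    using energy_constant[OF J that s] c(1) by simp
  have nz: "mform (G (X t)) (U t) (T (X t)) \<noteq> 0" if "t \<in> {0..1}" for t
    using causal_T[OF joinsD(5)[OF J that] joins_speed(3)[OF J that ne] causal[OF that]] .
  note cont = spray_solution_continuous[OF joinsD(1)[OF J]]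
  have "continuous_on {0..1} (\<lambda>t. mform (G (X t)) (U t) (T (X t)))"
    by (intro continuous_intros cont continuous_on_compose2[OF G_continuous cont(1)]
        continuous_on_compose2[OF T_continuous cont(1)]) (use joinsD(5)[OF J] in blast)+
  from nonvanishing_negative[OF this nz s _ t] have "mform (G (X t)) (U t) (T (X t)) < 0"
    using nz[OF s] c(2) by simp
  then show ?thesis using causal[OF t] by simp
qed

text \<open>The inequalities are weak, so that the relation is closed and contains the diagonal, where the
velocity vanishes. For \<open>x \<noteq> y\<close> they say that the geodesic from \<open>x\<close> to \<open>y\<close> is causal and future
directed.\<close>

definition causal_pair :: "real^'n \<Rightarrow> real^'n \<Rightarrow> bool" where
  "causal_pair x y \<longleftrightarrow>
     mform (G x) (vel0 x y) (vel0 x y) \<le> 0 \<and> mform (G x) (vel0 x y) (T x) \<le> 0"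

lemma causal_pair_refl: "x \<in> cball z0 R \<Longrightarrow> causal_pair x x"
  by (simp add: causal_pair_def vel0_refl mform_simps)

lemma causal_pair_if_future_curve:
  assumes c: "future_curve c c' \<alpha> \<beta>" and \<alpha>: "c \<alpha> \<in> ball z0 r"
  shows "causal_pair (c \<alpha>) (c \<beta>)"
proof -
  have "c \<alpha> \<in> cball z0 r" "c \<beta> \<in> cball z0 r"
    using future_curveD(1,3)[OF c] by (auto simp del: mem_cball)
  then obtain X U where J: "joins (c \<alpha>) (c \<beta>) X U" using joins_exists by blast
  from joins_future[OF J future_curve_ends_distinct[OF c], of 1 0] causal_end_velocity[OF c \<alpha>]
  show ?thesis
    by (auto simp: causal_pair_def vel_eq[OF J] joinsD(2,3)[OF J])
qed

lemma future_curve_if_causal_pair: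
  assumes J: "joins x y X U" and ne: "x \<noteq> y" and c: "causal_pair x y"
    and ball: "\<And>t. t \<in> {0..1} \<Longrightarrow> X t \<in> cball z0 r"
  shows "future_curve X U 0 1"
proof -
  have "mform (G (X t)) (U t) (U t) \<le> 0 \<and> mform (G (X t)) (U t) (T (X t)) < 0"
    if "t \<in> {0..1}" for t
    using joins_future[OF J ne, of 0 t] c that
    by (simp add: causal_pair_def vel_eq[OF J] joinsD(2)[OF J])
  then show ?thesis
    using joinsD(1)[OF J] ball unfolding future_curve_def spray_solution_def by simp
qed

lemma closed_causal_pair:
  "closed {p \<in> cball z0 r \<times> cball z0 r. causal_pair (fst p) (snd p)}"
proof -
  let ?C = "cball z0 r \<times> cball z0 r"
  have v: "continuous_on ?C (\<lambda>p. vel0 (fst p) (snd p))"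
    using vel_continuous(1) by (simp add: case_prod_beta)
  have Gc: "continuous_on ?C (\<lambda>p. G (fst p))" and Tc: "continuous_on ?C (\<lambda>p. T (fst p))"
    using ball_subset
    by (auto intro!: continuous_on_compose2[OF G_continuous] continuous_on_compose2[OF T_continuous]
        continuous_intros simp del: mem_cball)
  have 1: "closed {p \<in> ?C. mform (G (fst p)) (vel0 (fst p) (snd p)) (vel0 (fst p) (snd p)) \<le> 0}"
    and 2: "closed {p \<in> ?C. mform (G (fst p)) (vel0 (fst p) (snd p)) (T (fst p)) \<le> 0}"
    by (intro continuous_on_closed_Collect_le continuous_intros v Gc Tc closed_Times closed_cball)+
  have "{p \<in> ?C. causal_pair (fst p) (snd p)} =
      {p \<in> ?C. mform (G (fst p)) (vel0 (fst p) (snd p)) (vel0 (fst p) (snd p)) \<le> 0} \<inter>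
      {p \<in> ?C. mform (G (fst p)) (vel0 (fst p) (snd p)) (T (fst p)) \<le> 0}"
    by (auto simp: causal_pair_def)
  then show ?thesis using closed_Int[OF 1 2] by simp
qed

subsection \<open>Lens-shaped sets\<close>

definition barrier :: "real^'n \<Rightarrow> real \<Rightarrow> real^'n \<Rightarrow> real" where
  "barrier q \<sigma> z = \<sigma> * (\<tau> \<bullet> (z - q)) + a * ((z - q) \<bullet> (z - q))"

definition lens :: "real^'n \<Rightarrow> real \<Rightarrow> (real^'n) set" where
  "lens q \<epsilon> = {z. barrier q 1 z < \<epsilon> \<and> barrier q (-1) z < \<epsilon>}"

definition closed_lens :: "real^'n \<Rightarrow> real \<Rightarrow> (real^'n) set" where
  "closed_lens q \<epsilon> = {z. barrier q 1 z \<le> \<epsilon> \<and> barrier q (-1) z \<le> \<epsilon>}"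

lemma continuous_on_barrier: "continuous_on A (barrier q \<sigma>)"
  unfolding barrier_def by (intro continuous_intros)

lemma open_lens: "open (lens q \<epsilon>)"
  unfolding lens_def Collect_conj_eq
  by (intro open_Int open_Collect_less continuous_on_barrier continuous_on_const)

lemma closed_closed_lens: "closed (closed_lens q \<epsilon>)"
  unfolding closed_lens_def Collect_conj_eq
  by (intro closed_Int closed_Collect_le continuous_on_barrier continuous_on_const)

lemma center_in_lens: "0 < \<epsilon> \<Longrightarrow> q \<in> lens q \<epsilon>"
  by (simp add: lens_def barrier_def)

lemma dist_le_barrier: "2 * (dist q z)\<^sup>2 \<le> barrier q 1 z + barrier q (-1) z"
proof -
  have "1 * ((z - q) \<bullet> (z - q)) \<le> a * ((z - q) \<bullet> (z - q))"
    using a_ge_1 by (intro mult_right_mono) auto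
  then show ?thesis
    by (simp add: barrier_def dist_norm norm_minus_commute[of q] power2_norm_eq_inner)
qed

lemma lens_subset_ball:
  assumes "0 < s" "\<epsilon> \<le> s\<^sup>2"
  shows "lens q \<epsilon> \<subseteq> ball q s" "closed_lens q \<epsilon> \<subseteq> cball q s"
proof -
  show "lens q \<epsilon> \<subseteq> ball q s"
  proof
    fix z assume "z \<in> lens q \<epsilon>"
    then have "(dist q z)\<^sup>2 < s\<^sup>2" using dist_le_barrier[of q z] assms by (simp add: lens_def)
    then show "z \<in> ball q s" using assms power_less_imp_less_base[of "dist q z" 2 s] by simp
  qed
  show "closed_lens q \<epsilon> \<subseteq> cball q s"
  proof
    fix z assume "z \<in> closed_lens q \<epsilon>"
    then have "barrier q 1 z \<le> s\<^sup>2" "barrier q (-1) z \<le> s\<^sup>2" using assms by (auto simp: closed_lens_def)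
    then have "(dist q z)\<^sup>2 \<le> s\<^sup>2" using dist_le_barrier[of q z] by linarith
    then show "z \<in> cball q s" using assms power2_le_imp_le[of "dist q z" s] by simp
  qed
qed

lemma lens_subset_closed_lens: "lens q \<epsilon> \<subseteq> closed_lens q \<epsilon>"
  by (auto simp: lens_def closed_lens_def)

lemma closed_lens_subset_lens: "\<epsilon> < \<epsilon>' \<Longrightarrow> closed_lens q \<epsilon> \<subseteq> lens q \<epsilon>'"
  by (auto simp: lens_def closed_lens_def)

lemma barrier_derivative:
  assumes "(c has_vector_derivative c') (at t within I)"
  shows "((\<lambda>t. barrier q \<sigma> (c t)) has_real_derivative \<sigma> * (\<tau> \<bullet> c') + 2 * a * ((c t - q) \<bullet> c')) (at t within I)"
proof -
  have d: "((\<lambda>t. c t - q) has_vector_derivative c') (at t within I)"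
    using assms by (auto intro!: derivative_eq_intros)
  have 1: "((\<lambda>t. \<tau> \<bullet> (c t - q)) has_real_derivative \<tau> \<bullet> c') (at t within I)"
    unfolding has_real_derivative_iff_has_vector_derivative
    by (rule bounded_linear.has_vector_derivative[OF bounded_linear_inner_right d])
  have 2: "((\<lambda>t. (c t - q) \<bullet> (c t - q)) has_real_derivative (c t - q) \<bullet> c' + c' \<bullet> (c t - q)) (at t within I)"
    unfolding has_real_derivative_iff_has_vector_derivative
    by (rule bounded_bilinear.has_vector_derivative[OF bounded_bilinear_inner d d])
  show ?thesis
    unfolding barrier_def
    by (rule DERIV_cong[OF DERIV_add[OF DERIV_cmult[OF 1] DERIV_cmult[OF 2]]])
       (simp add: inner_commute)
qed

text \<open>The second derivative of the barrier along a geodesic of velocity \<open>u\<close> is \<open>2 a |u|\<^sup>2\<close> plus terms with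
the acceleration. The latter are at most \<open>(K |\<tau>| + a) |u|\<^sup>2\<close>, and \<open>a = K |\<tau>| + 1\<close>.\<close>

lemma barrier_strictly_convex:
  assumes J: "joins x y X U" and ne: "x \<noteq> y" and \<sigma>: "\<bar>\<sigma>\<bar> = 1"
    and e: "barrier z0 \<sigma> x \<le> \<epsilon>" "barrier z0 \<sigma> y \<le> \<epsilon>" and t: "0 < t" "t < 1"
  shows "barrier z0 \<sigma> (X t) < \<epsilon>"
proof (rule ccontr)
  assume "\<not> barrier z0 \<sigma> (X t) < \<epsilon>"
  then have ge: "\<epsilon> \<le> barrier z0 \<sigma> (X t)" by simp
  define g' where "g' t = \<sigma> * (\<tau> \<bullet> U t) + 2 * a * ((X t - z0) \<bullet> U t)" for t
  define g'' where "g'' t = \<sigma> * (\<tau> \<bullet> S (X t) (U t)) +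
     2 * a * ((X t - z0) \<bullet> S (X t) (U t) + U t \<bullet> U t)" for t
  have dX: "(X has_vector_derivative U t) (at t within {0..1})"
    and dU: "(U has_vector_derivative S (X t) (U t)) (at t within {0..1})" if "t \<in> {0..1}" for t
    using joinsD(1)[OF J] that by (auto simp: spray_solution_def)
  have d1: "((\<lambda>t. barrier z0 \<sigma> (X t)) has_real_derivative g' t) (at t within {0..1})"
    if "t \<in> {0..1}" for t
    unfolding g'_def by (rule barrier_derivative[OF dX[OF that]])
  have d2: "(g' has_real_derivative g'' t) (at t within {0..1})" if t: "t \<in> {0..1}" for t
  proof -
    have dz: "((\<lambda>t. X t - z0) has_vector_derivative U t) (at t within {0..1})"
      using dX[OF t] by (auto intro!: derivative_eq_intros)
    have 1: "((\<lambda>t. \<tau> \<bullet> U t) has_real_derivative \<tau> \<bullet> S (X t) (U t)) (at t within {0..1})"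
      unfolding has_real_derivative_iff_has_vector_derivative
      by (rule bounded_linear.has_vector_derivative[OF bounded_linear_inner_right dU[OF t]])
    have 2: "((\<lambda>t. (X t - z0) \<bullet> U t) has_real_derivative
        (X t - z0) \<bullet> S (X t) (U t) + U t \<bullet> U t) (at t within {0..1})"
      unfolding has_real_derivative_iff_has_vector_derivative
      by (rule bounded_bilinear.has_vector_derivative[OF bounded_bilinear_inner dz dU[OF t]])
    show ?thesis
      unfolding g'_def g''_def by (rule DERIV_add[OF DERIV_cmult[OF 1] DERIV_cmult[OF 2]])
  qed
  have pos: "0 < g'' t" if t: "t \<in> {0..1}" for t
  proof -
    define N where "N = (norm (U t))\<^sup>2"
    have N: "0 < N" using joins_speed(3)[OF J t ne] by (simp add: N_def)
    have XR: "X t \<in> cball z0 R" using joinsD(5)[OF J t] .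
    have SN: "norm (S (X t) (U t)) \<le> K * N"
      unfolding N_def by (rule spray_bound_norm[OF S XR]) simp
    have "\<bar>\<sigma> * (\<tau> \<bullet> S (X t) (U t))\<bar> \<le> norm \<tau> * norm (S (X t) (U t))"
      using \<sigma> Cauchy_Schwarz_ineq2[of \<tau> "S (X t) (U t)"] by (simp add: abs_mult)
    also have "\<dots> \<le> norm \<tau> * (K * N)" using SN by (intro mult_left_mono) auto
    finally have 1: "- (K * norm \<tau> * N) \<le> \<sigma> * (\<tau> \<bullet> S (X t) (U t))" by (simp add: abs_le_iff mult.commute mult.left_commute)
    have "\<bar>(X t - z0) \<bullet> S (X t) (U t)\<bar> \<le> norm (X t - z0) * norm (S (X t) (U t))"
      by (rule Cauchy_Schwarz_ineq2)
    also have "\<dots> \<le> R * (K * N)"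
      using XR SN by (intro mult_mono) (auto simp: dist_norm norm_minus_commute intro: order_trans[OF norm_ge_zero])
    also have "\<dots> \<le> 1/2 * N" using R N by (simp add: mult.commute mult.left_commute)
    finally have 2: "1/2 * N \<le> (X t - z0) \<bullet> S (X t) (U t) + U t \<bullet> U t"
      by (simp add: N_def power2_norm_eq_inner abs_le_iff)
    have "a * N \<le> 2 * a * ((X t - z0) \<bullet> S (X t) (U t) + U t \<bullet> U t)"
      using mult_left_mono[OF 2, of "2 * a"] a_ge_1 by simp
    with 1 have "a * N - K * norm \<tau> * N \<le> g'' t" by (simp add: g''_def)
    moreover have "a * N - K * norm \<tau> * N = N" using a(1) by (simp add: algebra_simps)
    ultimately show ?thesis using N by simp
  qed
  obtain \<xi>1 where \<xi>1: "\<xi>1 < t" "\<xi>1 \<in> {0..1}" "barrier z0 \<sigma> (X t) - barrier z0 \<sigma> (X 0) = (t - 0) * g' \<xi>1"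
    using mean_value_within[OF d1, of 0 t] t by auto
  obtain \<xi>2 where \<xi>2: "t < \<xi>2" "\<xi>2 \<in> {0..1}" "barrier z0 \<sigma> (X 1) - barrier z0 \<sigma> (X t) = (1 - t) * g' \<xi>2"
    using mean_value_within[OF d1, of t 1] t by auto
  have "0 \<le> t * g' \<xi>1" using \<xi>1(3) e ge joinsD(2)[OF J] by simp
  then have g1: "0 \<le> g' \<xi>1" using t by (simp add: zero_le_mult_iff)
  have "(1 - t) * g' \<xi>2 \<le> 0" using \<xi>2(3) e ge joinsD(3)[OF J] by simp
  then have g2: "g' \<xi>2 \<le> 0" using t by (simp add: mult_le_0_iff)
  obtain \<xi> where \<xi>: "\<xi> \<in> {0..1}" "g' \<xi>2 - g' \<xi>1 = (\<xi>2 - \<xi>1) * g'' \<xi>"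
    using mean_value_within[OF d2, of \<xi>1 \<xi>2] \<xi>1 \<xi>2 by auto
  have "0 < (\<xi>2 - \<xi>1) * g'' \<xi>" using pos[OF \<xi>(1)] \<xi>1 \<xi>2 by simp
  then show False using \<xi>(2) g1 g2 by linarith
qed

lemma closed_lens_joins:
  assumes "joins x y X U" "x \<noteq> y" "x \<in> closed_lens z0 \<epsilon>" "y \<in> closed_lens z0 \<epsilon>" "0 < t" "t < 1"
  shows "X t \<in> lens z0 \<epsilon>"
  using barrier_strictly_convex[OF assms(1,2) _ _ _ assms(5,6), of 1 \<epsilon>]
    barrier_strictly_convex[OF assms(1,2) _ _ _ assms(5,6), of "-1" \<epsilon>] assms(3,4)
  by (simp add: lens_def closed_lens_def)

lemma lens_joins:
  assumes J: "joins x y X U" and x: "x \<in> lens z0 \<epsilon>" and y: "y \<in> lens z0 \<epsilon>" and t: "t \<in> {0..1}"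
  shows "X t \<in> lens z0 \<epsilon>"
proof (cases "x = y \<or> t = 0 \<or> t = 1")
  case True
  have "X t = x" if "x = y"
    using joins_unique(1)[OF J, of "\<lambda>_. x" "\<lambda>_. 0" t] joins_const[OF joinsD(6)[OF J]] that t by simp
  then show ?thesis using True x y joinsD(2,3)[OF J] by auto
next
  case False
  then show ?thesis
    using closed_lens_joins[OF J, of \<epsilon> t] x y t lens_subset_closed_lens by auto
qed

text \<open>The sign \<open>\<sigma>\<close> is \<open>1\<close> for future directed curves and \<open>-1\<close> for past directed ones. The linear part of the
barrier changes at least at the rate \<open>m |c'|\<close>, the quadratic part at most at the rate \<open>4 a r |c'|\<close>.\<close>

lemma barrier_along_causal:
  assumes c: "\<And>t. t \<in> {\<alpha>..\<beta>} \<Longrightarrow> (c has_vector_derivative c' t) (at t within {\<alpha>..\<beta>})"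
    and ball: "\<And>t. t \<in> {\<alpha>..\<beta>} \<Longrightarrow> c t \<in> cball z0 r" and q: "q \<in> cball z0 r"
    and causal: "\<And>t. t \<in> {\<alpha>..\<beta>} \<Longrightarrow> mform (G (c t)) (c' t) (c' t) \<le> 0"
    and future: "\<And>t. t \<in> {\<alpha>..\<beta>} \<Longrightarrow> \<sigma> * mform (G (c t)) (c' t) (T (c t)) < 0"
    and \<sigma>: "\<bar>\<sigma>\<bar> = 1" and st: "s \<le> t" "s \<in> {\<alpha>..\<beta>}" "t \<in> {\<alpha>..\<beta>}"
  shows "barrier q \<sigma> (c s) \<le> barrier q \<sigma> (c t)" "barrier q (- \<sigma>) (c t) \<le> barrier q (- \<sigma>) (c s)"
proof -
  have key: "2 * a * \<bar>(c t - q) \<bullet> c' t\<bar> \<le> \<sigma> * (\<tau> \<bullet> c' t)" if t: "t \<in> {\<alpha>..\<beta>}" for t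
  proof -
    have \<sigma>2: "\<sigma> * \<sigma> = 1" using \<sigma> by (metis abs_mult_self_eq mult_1)
    have cR: "c t \<in> cball z0 R" using ball[OF t] ball_subset by blast
    have "m * norm (\<sigma> *\<^sub>R c' t) \<le> \<tau> \<bullet> (\<sigma> *\<^sub>R c' t)"
      using causal[OF t] future[OF t] \<sigma>2
      by (intro tau_bound[OF cR]) (simp_all add: mform_simps flip: mult.assoc)
    then have 1: "m * norm (c' t) \<le> \<sigma> * (\<tau> \<bullet> c' t)" using \<sigma> by simp
    have "norm (c t - q) \<le> 2 * r"
      using ball[OF t] q dist_triangle[of "c t" q z0] by (simp add: dist_norm norm_minus_commute)
    then have "\<bar>(c t - q) \<bullet> c' t\<bar> \<le> (2 * r) * norm (c' t)"
      by (intro order_trans[OF Cauchy_Schwarz_ineq2] mult_right_mono) auto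
    then have "2 * a * \<bar>(c t - q) \<bullet> c' t\<bar> \<le> 2 * a * ((2 * r) * norm (c' t))"
      using a_ge_1 by (intro mult_left_mono) auto
    also have "\<dots> \<le> m * norm (c' t)"
      using mult_right_mono[OF less_imp_le[OF a(2)], of "norm (c' t)"] by (simp add: mult.assoc)
    finally show ?thesis using 1 by linarith
  qed
  have k1: "0 \<le> \<sigma> * (\<tau> \<bullet> c' t) + 2 * a * ((c t - q) \<bullet> c' t)"
    and k2: "0 \<le> - (- \<sigma> * (\<tau> \<bullet> c' t) + 2 * a * ((c t - q) \<bullet> c' t))" if "t \<in> {\<alpha>..\<beta>}" for t
  proof -
    have "\<bar>2 * a * ((c t - q) \<bullet> c' t)\<bar> \<le> \<sigma> * (\<tau> \<bullet> c' t)"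
      using key[OF that] a_ge_1 by (simp add: abs_mult)
    then show "0 \<le> \<sigma> * (\<tau> \<bullet> c' t) + 2 * a * ((c t - q) \<bullet> c' t)"
      "0 \<le> - (- \<sigma> * (\<tau> \<bullet> c' t) + 2 * a * ((c t - q) \<bullet> c' t))" by linarith+
  qed
  show "barrier q \<sigma> (c s) \<le> barrier q \<sigma> (c t)"
    by (rule nondecreasing_within[OF barrier_derivative[OF c] k1 st])
  have "- barrier q (- \<sigma>) (c s) \<le> - barrier q (- \<sigma>) (c t)"
    by (rule nondecreasing_within[OF DERIV_minus[OF barrier_derivative[OF c]] k2 st])
  then show "barrier q (- \<sigma>) (c t) \<le> barrier q (- \<sigma>) (c s)" by simp
qed

lemma lens_causally_convex:
  assumes c: "\<And>t. t \<in> {\<alpha>..\<beta>} \<Longrightarrow> (c has_vector_derivative c' t) (at t within {\<alpha>..\<beta>})"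
    and ball: "\<And>t. t \<in> {\<alpha>..\<beta>} \<Longrightarrow> c t \<in> cball z0 r" and q: "q \<in> cball z0 r"
    and causal: "\<And>t. t \<in> {\<alpha>..\<beta>} \<Longrightarrow> mform (G (c t)) (c' t) (c' t) \<le> 0"
    and future: "\<And>t. t \<in> {\<alpha>..\<beta>} \<Longrightarrow> \<sigma> * mform (G (c t)) (c' t) (T (c t)) < 0"
    and \<sigma>: "\<bar>\<sigma>\<bar> = 1" and e: "c \<alpha> \<in> lens q \<epsilon>" "c \<beta> \<in> lens q \<epsilon>" and t: "t \<in> {\<alpha>..\<beta>}"
  shows "c t \<in> lens q \<epsilon>"
proof -
  note g = barrier_along_causal[OF c ball q causal future \<sigma>]
  have "barrier q \<sigma> (c t) \<le> barrier q \<sigma> (c \<beta>)" "barrier q (- \<sigma>) (c t) \<le> barrier q (- \<sigma>) (c \<alpha>)"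
    using g(1)[of t \<beta>] g(2)[of \<alpha> t] t by auto
  moreover have "\<sigma> = 1 \<or> \<sigma> = -1" using \<sigma> by linarith
  ultimately show ?thesis using e by (auto simp: lens_def)
qed

lemma causal_pair_barrier:
  assumes x: "x \<in> lens z0 \<epsilon>" and y: "y \<in> lens z0 \<epsilon>" and \<epsilon>: "\<epsilon> \<le> r\<^sup>2" and c: "causal_pair x y"
  shows "barrier z0 1 x \<le> barrier z0 1 y" "barrier z0 (-1) y \<le> barrier z0 (-1) x"
proof -
  have "barrier z0 1 x \<le> barrier z0 1 y \<and> barrier z0 (-1) y \<le> barrier z0 (-1) x"
  proof (cases "x = y")
    case False
    note sub = lens_subset_ball(1)[OF r(1) \<epsilon>]
    have xy: "x \<in> cball z0 r" "y \<in> cball z0 r" using x y sub[of z0] by auto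
    obtain X U where J: "joins x y X U" using joins_exists xy by blast
    have "X t \<in> cball z0 r" if "t \<in> {0..1}" for t
      using lens_joins[OF J x y that] sub[of z0] by auto
    from future_curve_if_causal_pair[OF J False c this] have f: "future_curve X U 0 1" by blast
    note fD = future_curveD[OF f]
    have z: "z0 \<in> cball z0 r" using r(1) by simp
    show ?thesis
      using barrier_along_causal[OF fD(2,3) z fD(5), of 1 0 1] fD(6) joinsD(2,3)[OF J] by auto
  qed simp
  then show "barrier z0 1 x \<le> barrier z0 1 y" "barrier z0 (-1) y \<le> barrier z0 (-1) x" by auto
qed

text \<open>The diamond is closed in the set where the barriers are at most their values at \<open>y\<close> and \<open>x\<close>, which is a
compact subset of the lens.\<close>

lemma compact_diamond:
  assumes x: "x \<in> lens z0 \<epsilon>" and y: "y \<in> lens z0 \<epsilon>" and \<epsilon>: "\<epsilon> \<le> r\<^sup>2"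
  shows "compact {z \<in> lens z0 \<epsilon>. causal_pair x z \<and> causal_pair z y}"
proof -
  define D where "D = {z. barrier z0 1 z \<le> barrier z0 1 y} \<inter> {z. barrier z0 (-1) z \<le> barrier z0 (-1) x}"
  have Dl: "D \<subseteq> lens z0 \<epsilon>" using x y by (auto simp: D_def lens_def)
  note sub = lens_subset_ball(1)[OF r(1) \<epsilon>, of z0]
  have ball: "x \<in> cball z0 r" "y \<in> cball z0 r" "D \<subseteq> cball z0 r" using x y sub Dl by auto
  have "closed D"
    unfolding D_def by (intro closed_Int closed_Collect_le continuous_on_barrier continuous_on_const)
  then have D: "compact D"
    using ball(3) by (metis compact_cball compact_Int_closed inf.absorb_iff2)
  have "closed ((\<lambda>z. (x, z)) -` {p \<in> cball z0 r \<times> cball z0 r. causal_pair (fst p) (snd p)})"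
    and "closed ((\<lambda>z. (z, y)) -` {p \<in> cball z0 r \<times> cball z0 r. causal_pair (fst p) (snd p)})"
    by (intro closed_vimage closed_causal_pair continuous_intros)+
  from compact_Int_closed[OF compact_Int_closed[OF D this(1)] this(2)]
  show ?thesis
  proof (rule back_subst[where P = compact])
    show "D \<inter> (\<lambda>z. (x, z)) -` {p \<in> cball z0 r \<times> cball z0 r. causal_pair (fst p) (snd p)} \<inter>
        (\<lambda>z. (z, y)) -` {p \<in> cball z0 r \<times> cball z0 r. causal_pair (fst p) (snd p)}
      = {z \<in> lens z0 \<epsilon>. causal_pair x z \<and> causal_pair z y}"
      using Dl ball causal_pair_barrier[OF _ _ \<epsilon>] x y sub
      by (auto simp: D_def simp del: mem_cball) 
  qed
qed

subsection \<open>The exponential map of a lens\<close>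

lemma vel0_inj: "q \<in> cball z0 r \<Longrightarrow> inj_on (vel0 q) (cball z0 r)"
  by (rule inj_onI) (use vel_lipschitz(3)[of q _ q] in fastforce)

lemma vel0_continuous:
  assumes "q \<in> cball z0 r"
  shows "continuous_on (cball z0 r) (vel0 q)"
proof -
  have "continuous_on (cball z0 r) (\<lambda>y. (\<lambda>(x, y). vel0 x y) (q, y))"
    by (rule continuous_on_compose2[OF vel_continuous(1)])
       (use assms in \<open>auto intro!: continuous_intros\<close>)
  then show ?thesis by simp
qed

lemma open_vel0_image:
  assumes "q \<in> cball z0 r" "open D" "D \<subseteq> cball z0 r"
  shows "open (vel0 q ` D)"
  using assms continuous_on_subset[OF vel0_continuous] inj_on_subset[OF vel0_inj]
  by (intro invariance_of_domain) auto

text \<open>The vector \<open>s v\<close> is the initial velocity of the part of the geodesic that ends at parameter \<open>s\<close>, and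
this point lies in the lens by convexity.\<close>

lemma vel0_image_starshaped:
  assumes q: "q \<in> lens z0 \<epsilon>" and \<epsilon>: "\<epsilon> \<le> r\<^sup>2" and v: "v \<in> vel0 q ` lens z0 \<epsilon>" and s: "s \<in> {0..1}"
  shows "s *\<^sub>R v \<in> vel0 q ` lens z0 \<epsilon>"
proof -
  obtain y where y: "y \<in> lens z0 \<epsilon>" "v = vel0 q y" using v by blast
  note sub = lens_subset_ball(1)[OF r(1) \<epsilon>, of z0]
  obtain X U where J: "joins q y X U" using joins_exists q y sub by (metis ball_subset_cball subsetD)
  have "s *\<^sub>R v = vel0 q (X s)"
    using vel_eq(1)[OF joins_scale[OF J s]] vel_eq(1)[OF J] y(2) by simp
  then show ?thesis using lens_joins[OF J q y(1) s] by blast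
qed

end

section \<open>Locally Lipschitz maps\<close>

text \<open>On open sets this is the local form of \<open>loc_lipschitz_on\<close>, without reference to the set.\<close>

definition lip_near :: "('a::metric_space \<Rightarrow> 'b::real_normed_vector) \<Rightarrow> 'a \<Rightarrow> bool" where
  "lip_near f x \<longleftrightarrow> (\<exists>r>0. \<exists>L. L-lipschitz_on (cball x r) f)"

lemma lip_near_if_loc_lipschitz_on:
  assumes "open U" "x \<in> U" "loc_lipschitz_on U f"
  shows "lip_near f x"
proof -
  obtain r L where r: "0 < r" "L-lipschitz_on (cball x r \<inter> U) f"
    using assms unfolding loc_lipschitz_on_def by blast
  obtain e where e: "0 < e" "cball x e \<subseteq> U" using assms open_contains_cball by blast
  have "L-lipschitz_on (cball x (min r e)) f"
    using r(2) by (rule lipschitz_on_subset) (use e in \<open>auto simp: subset_iff\<close>)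
  then show ?thesis using r(1) e(1) unfolding lip_near_def by (intro exI[of _ "min r e"]) auto
qed

text \<open>Finitely many locally Lipschitz maps have a common radius and a common constant.\<close>

lemma lip_near_family:
  assumes "finite I" "\<And>i. i \<in> I \<Longrightarrow> lip_near (f i) x"
  shows "\<exists>r>0. \<exists>L\<ge>0. \<forall>i\<in>I. L-lipschitz_on (cball x r) (f i) \<and> (\<forall>y\<in>cball x r. norm (f i y) \<le> L)"
  using assms
proof (induction I rule: finite_induct)
  case empty
  then show ?case by (intro exI[of _ 1]) auto
next
  case (insert i I)
  obtain r L where r: "0 < r" "0 \<le> L"
    "\<And>j. j \<in> I \<Longrightarrow> L-lipschitz_on (cball x r) (f j)" "\<And>j y. j \<in> I \<Longrightarrow> y \<in> cball x r \<Longrightarrow> norm (f j y) \<le> L"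
    using insert by blast
  obtain r' L' where r': "0 < r'" "L'-lipschitz_on (cball x r') (f i)"
    using insert.prems unfolding lip_near_def by blast
  have L': "0 \<le> L'" using r'(2) by (rule lipschitz_on_nonneg)
  define R where "R = min r r'"
  define M where "M = L + L' + (norm (f i x) + L' * r')"
  have M: "0 \<le> M" "L \<le> M" "L' \<le> M" "norm (f i x) + L' * r' \<le> M"
    using r L' r' by (auto simp: M_def)
  have sub: "cball x R \<subseteq> cball x r" "cball x R \<subseteq> cball x r'" by (auto simp: R_def)
  have i: "M-lipschitz_on (cball x R) (f i)" by (rule lipschitz_on_mono[OF r'(2) sub(2) M(3)])
  have I: "M-lipschitz_on (cball x R) (f j)" if "j \<in> I" for j
    by (rule lipschitz_on_mono[OF r(3)[OF that] sub(1) M(2)])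
  have bi: "norm (f i y) \<le> M" if y: "y \<in> cball x R" for y
  proof -
    have "dist (f i y) (f i x) \<le> L' * dist y x"
      using r' y sub(2) by (intro lipschitz_onD[OF r'(2)]) auto
    also have "\<dots> \<le> L' * r'" using y L' sub(2) by (intro mult_left_mono) (auto simp: dist_commute)
    finally show ?thesis
      using M(4) norm_triangle_sub[of "f i y" "f i x"] by (simp add: dist_norm)
  qed
  have bI: "norm (f j y) \<le> M" if "j \<in> I" "y \<in> cball x R" for j y
    using r(4)[of j y] that sub(1) M(2) by force
  have R: "0 < R" using r r' by (simp add: R_def)
  show ?case
    by (rule exI[of _ R], rule conjI[OF R], rule exI[of _ M]) (use M(1) i I bi bI in \<open>simp del: mem_cball\<close>)
qed

lemma lip_near_bounded:
  assumes "lip_near f x"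
  obtains r L where "0 < r" "0 \<le> L" "L-lipschitz_on (cball x r) f" "\<And>y. y \<in> cball x r \<Longrightarrow> norm (f y) \<le> L"
  using lip_near_family[of "{()}" "\<lambda>_. f" x] assms by auto

lemma lip_near_const: "lip_near (\<lambda>_. c) x"
  unfolding lip_near_def by (intro exI[of _ 1] conjI exI[of _ 0] lipschitz_on_constant) simp

lemma lip_near_sum:
  fixes f :: "'i \<Rightarrow> 'a::metric_space \<Rightarrow> 'b::real_normed_vector"
  assumes "\<And>i. i \<in> I \<Longrightarrow> lip_near (f i) x"
  shows "lip_near (\<lambda>y. \<Sum>i\<in>I. f i y) x"
proof (cases "finite I")
  case True
  then obtain r L where r: "0 < r" "0 \<le> L" "\<And>i. i \<in> I \<Longrightarrow> L-lipschitz_on (cball x r) (f i)"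
    using lip_near_family[of I f x] assms by blast
  have "(of_nat (card I) * L)-lipschitz_on (cball x r) (\<lambda>y. \<Sum>i\<in>I. f i y)"
  proof (rule lipschitz_onI)
    fix y z assume "y \<in> cball x r" "z \<in> cball x r"
    then have "norm (f i y - f i z) \<le> L * dist y z" if "i \<in> I" for i
      using lipschitz_onD[OF r(3)[OF that]] by (simp add: dist_norm)
    then have "norm (\<Sum>i\<in>I. f i y - f i z) \<le> of_nat (card I) * (L * dist y z)"
      by (rule sum_norm_bound)
    then show "dist (\<Sum>i\<in>I. f i y) (\<Sum>i\<in>I. f i z) \<le> of_nat (card I) * L * dist y z"
      by (simp add: dist_norm sum_subtractf mult.assoc)
  qed (use r in simp)
  then show ?thesis using r(1) unfolding lip_near_def by blast
qed (simp add: lip_near_const)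

lemma lip_near_bilinear:
  assumes b: "bounded_bilinear b" and f: "lip_near f x" and g: "lip_near g x"
  shows "lip_near (\<lambda>y. b (f y) (g y)) x"
proof -
  obtain C where C: "0 < C" "\<And>u v. norm (b u v) \<le> norm u * norm v * C"
    using bounded_bilinear.pos_bounded[OF b] by blast
  obtain r L where r: "0 < r" "0 \<le> L" "L-lipschitz_on (cball x r) f" "\<And>y. y \<in> cball x r \<Longrightarrow> norm (f y) \<le> L"
    using lip_near_bounded[OF f] by blast
  obtain r' L' where r': "0 < r'" "0 \<le> L'" "L'-lipschitz_on (cball x r') g"
      "\<And>y. y \<in> cball x r' \<Longrightarrow> norm (g y) \<le> L'"
    using lip_near_bounded[OF g] by blast
  have "(2 * L * L' * C)-lipschitz_on (cball x (min r r')) (\<lambda>y. b (f y) (g y))"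
  proof (rule lipschitz_onI)
    fix y z assume yz: "y \<in> cball x (min r r')" "z \<in> cball x (min r r')"
    then have in_r: "y \<in> cball x r" "z \<in> cball x r" and in_r': "y \<in> cball x r'" "z \<in> cball x r'" by auto
    have "b (f y) (g y) - b (f z) (g z) = b (f y - f z) (g y) + b (f z) (g y - g z)"
      by (simp add: bounded_bilinear.diff_left[OF b] bounded_bilinear.diff_right[OF b])
    also have "norm \<dots> \<le> norm (f y - f z) * norm (g y) * C + norm (f z) * norm (g y - g z) * C"
      by (intro order_trans[OF norm_triangle_ineq] add_mono C(2))
    also have "\<dots> \<le> (L * dist y z) * L' * C + L * (L' * dist y z) * C"
      using r(2,4) r'(2,4) C(1) in_r in_r' lipschitz_onD[OF r(3) in_r] lipschitz_onD[OF r'(3) in_r']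
      by (intro add_mono mult_mono) (auto simp: dist_norm)
    finally show "dist (b (f y) (g y)) (b (f z) (g z)) \<le> 2 * L * L' * C * dist y z"
      by (simp add: dist_norm algebra_simps)
  qed (use r r' C in simp)
  then show ?thesis using r(1) r'(1) unfolding lip_near_def by (intro exI[of _ "min r r'"]) auto
qed

lemmas lip_near_mult = lip_near_bilinear[OF bounded_bilinear_mult]
lemmas lip_near_scaleR = lip_near_bilinear[OF bounded_bilinear_scaleR]

lemma lip_near_add: "lip_near f x \<Longrightarrow> lip_near g x \<Longrightarrow> lip_near (\<lambda>y. f y + g y) x"
  using lip_near_sum[of UNIV "\<lambda>b. if b then f else g" x] by (simp add: UNIV_bool add.commute)

lemma lip_near_cmult: "lip_near f x \<Longrightarrow> lip_near (\<lambda>y. c *\<^sub>R f y) x"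
  by (rule lip_near_scaleR[OF lip_near_const])

lemma lip_near_minus: "lip_near f x \<Longrightarrow> lip_near (\<lambda>y. - f y) x"
  using lip_near_cmult[of f x "-1"] by simp

lemma lip_near_diff: "lip_near f x \<Longrightarrow> lip_near g x \<Longrightarrow> lip_near (\<lambda>y. f y - g y) x"
  using lip_near_add[OF _ lip_near_minus, of f x g] by simp

lemma lip_near_vec:
  fixes f :: "'i::finite \<Rightarrow> 'a::metric_space \<Rightarrow> 'b::real_normed_vector"
  assumes "\<And>i. lip_near (f i) x"
  shows "lip_near (\<lambda>y. \<chi> i. f i y) x"
proof -
  obtain r L where r: "0 < r" "0 \<le> L" "\<And>i. L-lipschitz_on (cball x r) (f i)"
    using lip_near_family[of "UNIV :: 'i set" f x] assms by auto
  have "(of_nat CARD('i) * L)-lipschitz_on (cball x r) (\<lambda>y. \<chi> i. f i y)"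
  proof (rule lipschitz_onI)
    fix y z assume yz: "y \<in> cball x r" "z \<in> cball x r"
    have "dist (\<chi> i. f i y) (\<chi> i. f i z) \<le> (\<Sum>i\<in>UNIV. dist (f i y) (f i z))"
      unfolding dist_vec_def using L2_set_le_sum[of UNIV "\<lambda>i. dist (f i y) (f i z)"] by simp
    also have "\<dots> \<le> (\<Sum>i\<in>(UNIV::'i set). L * dist y z)"
      by (intro sum_mono lipschitz_onD[OF r(3)] yz)
    finally show "dist (\<chi> i. f i y) (\<chi> i. f i z) \<le> of_nat CARD('i) * L * dist y z" by simp
  qed (use r in simp)
  then show ?thesis using r(1) unfolding lip_near_def by blast
qed

text \<open>Lipschitz bounds for the finitely many partial derivatives bound the operator norm of the
derivative and of its increments.\<close>

lemma C11_estimates: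
  fixes f :: "'e::euclidean_space \<Rightarrow> 'b::real_normed_vector"
  assumes U: "open U" "x0 \<in> U" and f: "\<And>y. y \<in> U \<Longrightarrow> (f has_derivative f' y) (at y)"
    and f': "\<And>v. lip_near (\<lambda>y. f' y v) x0"
  shows "\<exists>r>0. \<exists>L\<ge>0. cball x0 r \<subseteq> U \<and> (\<forall>x\<in>cball x0 r. \<forall>y\<in>cball x0 r.
     norm (f y - f x) \<le> L * norm (y - x) \<and>
     norm (f y - f x - f' x (y - x)) \<le> L * (norm (y - x))\<^sup>2)"
proof -
  obtain r1 L where r1: "0 < r1" "0 \<le> L" "\<And>b. b \<in> Basis \<Longrightarrow> L-lipschitz_on (cball x0 r1) (\<lambda>y. f' y b)"
      "\<And>b y. b \<in> Basis \<Longrightarrow> y \<in> cball x0 r1 \<Longrightarrow> norm (f' y b) \<le> L"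
    using lip_near_family[of "Basis :: 'e set" "\<lambda>b y. f' y b" x0] f' by auto
  obtain e where e: "0 < e" "cball x0 e \<subseteq> U" using U open_contains_cball by blast
  define r where "r = min r1 e"
  have r: "0 < r" "cball x0 r \<subseteq> U" "cball x0 r \<subseteq> cball x0 r1" using r1 e by (auto simp: r_def)
  define M where "M = of_nat DIM('e) * L"
  have M: "0 \<le> M" using r1 by (simp add: M_def)
  have lin: "linear (f' y)" if "y \<in> U" for y using f[OF that] by (rule has_derivative_linear)
  have expand: "h w = (\<Sum>b\<in>Basis. (w \<bullet> b) *\<^sub>R h b)" if "linear h" for h :: "'e \<Rightarrow> 'b" and w
    using linear_sum[OF that, of "\<lambda>b. (w \<bullet> b) *\<^sub>R b" Basis]
    by (simp add: euclidean_representation linear_scale[OF that])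
  have bnd: "norm (h w) \<le> of_nat DIM('e) * B * norm w"
    if h: "linear h" and B: "\<And>b. b \<in> Basis \<Longrightarrow> norm (h b) \<le> B" for h :: "'e \<Rightarrow> 'b" and w B
  proof -
    have "norm (h w) \<le> of_nat DIM('e) * (norm w * B)"
      unfolding expand[OF h, of w]
    proof (rule sum_norm_bound)
      fix b :: 'e assume b: "b \<in> Basis"
      show "norm ((w \<bullet> b) *\<^sub>R h b) \<le> norm w * B"
        using Basis_le_norm[OF b, of w] B[OF b] by (simp add: mult_mono)
    qed
    then show ?thesis by (simp add: mult_ac)
  qed
  have d1: "norm (f' x w) \<le> M * norm w" if "x \<in> cball x0 r" for x w
    unfolding M_def by (rule bnd[OF lin[OF subsetD[OF r(2) that]] r1(4)[OF _ subsetD[OF r(3) that]]])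
  have d2: "norm (f' x w - f' y w) \<le> M * norm (x - y) * norm w"
    if "x \<in> cball x0 r" "y \<in> cball x0 r" for x y w
  proof -
    have "norm (f' x w - f' y w) \<le> of_nat DIM('e) * (L * dist x y) * norm w"
    proof (rule bnd[of "\<lambda>w. f' x w - f' y w"])
      show "linear (\<lambda>w. f' x w - f' y w)" by (intro linear_compose_sub lin subsetD[OF r(2)] that)
      show "norm (f' x b - f' y b) \<le> L * dist x y" if "b \<in> Basis" for b
        using lipschitz_onD[OF r1(3)[OF that], of x y] \<open>x \<in> cball x0 r\<close> \<open>y \<in> cball x0 r\<close> r(3)
        by (simp add: dist_norm subset_iff)
    qed
    then show ?thesis by (simp add: M_def dist_norm mult_ac)
  qed
  have seg: "x + t *\<^sub>R (y - x) \<in> closed_segment x y" if "t \<in> {0..1}" for x y :: 'e and t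
    using that by (auto simp: closed_segment_def algebra_simps intro!: exI[of _ t])
  have sub: "closed_segment x y \<subseteq> cball x0 r" if "x \<in> cball x0 r" "y \<in> cball x0 r" for x y
    using that by (intro closed_segment_subset) auto
  have d3: "norm (f y - f x) \<le> M * norm (y - x)" if "x \<in> cball x0 r" "y \<in> cball x0 r" for x y
  proof (rule differentiable_bound[of "cball x0 r" f f'])
    show "(f has_derivative f' z) (at z within cball x0 r)" if "z \<in> cball x0 r" for z
      by (rule has_derivative_at_withinI[OF f[OF subsetD[OF r(2) that]]])
    show "onorm (f' z) \<le> M" if "z \<in> cball x0 r" for z
      using d1[OF that] by (intro onorm_le)
  qed (use that in \<open>simp_all del: mem_cball\<close>)
  have d4: "norm (f y - f x - f' x (y - x)) \<le> M * (norm (y - x))\<^sup>2"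
    if xy: "x \<in> cball x0 r" "y \<in> cball x0 r" for x y
  proof -
    have "norm (f y - f x - f' x (y - x)) \<le> norm (y - x) * (M * norm (y - x))"
    proof (rule differentiable_bound_linearization[where S = "closed_segment x y" and f' = f'])
      fix z assume z: "z \<in> closed_segment x y"
      then have zr: "z \<in> cball x0 r" using sub[OF xy] by blast
      show "(f has_derivative f' z) (at z within closed_segment x y)"
        by (rule has_derivative_at_withinI[OF f[OF subsetD[OF r(2) zr]]])
      have "norm (f' z w - f' x w) \<le> M * norm (y - x) * norm w" for w
      proof -
        have "norm (f' z w - f' x w) \<le> M * norm (z - x) * norm w" by (rule d2[OF zr xy(1)])
        also have "\<dots> \<le> M * norm (y - x) * norm w"
          using M segment_bound(1)[OF z] by (intro mult_mono) auto
        finally show ?thesis .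
      qed
      then show "onorm (f' z - f' x) \<le> M * norm (y - x)"
        by (intro onorm_le) (simp add: fun_diff_def)
    qed (use seg in auto)
    then show ?thesis by (simp add: power2_eq_square mult_ac)
  qed
  show ?thesis using r M d3 d4 by blast
qed

lemma lip_near_C11:
  fixes f :: "'e::euclidean_space \<Rightarrow> 'b::real_normed_vector"
  assumes "open U" "x0 \<in> U" "\<And>y. y \<in> U \<Longrightarrow> (f has_derivative f' y) (at y)"
    and "\<And>v. lip_near (\<lambda>y. f' y v) x0"
  shows "lip_near f x0"
proof -
  obtain r L where r: "0 < r" "0 \<le> L"
      "\<And>x y. x \<in> cball x0 r \<Longrightarrow> y \<in> cball x0 r \<Longrightarrow> norm (f y - f x) \<le> L * norm (y - x)"
    using C11_estimates[OF assms] by blast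
  then have "L-lipschitz_on (cball x0 r) f" by (intro lipschitz_onI) (auto simp: dist_norm simp del: mem_cball)
  then show ?thesis using r(1) unfolding lip_near_def by blast
qed

lemma Ck1_on_SucD:
  assumes "Ck1_on (Suc k) U f"
  shows "\<And>y. y \<in> U \<Longrightarrow> (f has_derivative frechet_derivative f (at y)) (at y)"
    and "\<And>v. Ck1_on k U (\<lambda>y. frechet_derivative f (at y) v)"
  using assms frechet_derivative_works by auto

lemma lip_near_Ck1_on:
  fixes f :: "'e::euclidean_space \<Rightarrow> 'b::real_normed_vector"
  assumes "open U" "x \<in> U" "Ck1_on k U f"
  shows "lip_near f x"
  using assms(3)
proof (induction k arbitrary: f)
  case 0
  then show ?case using assms by (auto intro: lip_near_if_loc_lipschitz_on)
next
  case (Suc k)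
  show ?case
    by (rule lip_near_C11[OF assms(1,2) Ck1_on_SucD(1)[OF Suc.prems]])
       (use Suc.IH Ck1_on_SucD(2)[OF Suc.prems] in auto)
qed

lemma lip_near_isCont: "lip_near f x \<Longrightarrow> isCont f x"
proof -
  assume "lip_near f x"
  then obtain r L where r: "0 < r" "L-lipschitz_on (cball x r) f" unfolding lip_near_def by blast
  have "continuous_on (ball x r) f"
    using lipschitz_on_continuous_on[OF r(2)] by (rule continuous_on_subset) auto
  then show ?thesis using r(1) by (simp add: continuous_on_eq_continuous_at)
qed

lemma lip_near_compose:
  assumes f: "lip_near f x" and g: "lip_near g (f x)"
  shows "lip_near (\<lambda>y. g (f y)) x"
proof -
  obtain r L where r: "0 < r" "0 \<le> L" "L-lipschitz_on (cball x r) f" using lip_near_bounded[OF f] by blast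
  obtain s M where s: "0 < s" "M-lipschitz_on (cball (f x) s) g" using g unfolding lip_near_def by blast
  define e where "e = min r (s / (L + 1))"
  have e: "0 < e" "e \<le> r" "L * e \<le> s"
  proof -
    show e0: "0 < e" "e \<le> r" using r s by (auto simp: e_def)
    have "L * e \<le> (L + 1) * (s / (L + 1))"
      using r(2) e0(1) by (intro mult_mono) (auto simp: e_def)
    then show "L * e \<le> s" using r(2) by simp
  qed
  have fe: "L-lipschitz_on (cball x e) f" by (rule lipschitz_on_subset[OF r(3)]) (use e in auto)
  have "f ` cball x e \<subseteq> cball (f x) s"
  proof
    fix z assume "z \<in> f ` cball x e"
    then obtain y where y: "y \<in> cball x e" "z = f y" by blast
    have "dist (f x) (f y) \<le> L * dist x y" using y e(1) by (intro lipschitz_onD[OF fe]) auto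
    also have "\<dots> \<le> L * e" using y r(2) by (intro mult_left_mono) auto
    finally show "z \<in> cball (f x) s" using e(3) y(2) by simp
  qed
  then have "M-lipschitz_on (f ` cball x e) g" by (rule lipschitz_on_subset[OF s(2)])
  from lipschitz_on_compose2[OF fe this] show ?thesis using e(1) unfolding lip_near_def by blast
qed

lemma lip_near_if_lipschitz_on:
  assumes "L-lipschitz_on V f" "open V" "x \<in> V"
  shows "lip_near f x"
proof -
  obtain r where "0 < r" "cball x r \<subseteq> V" using assms open_contains_cball by blast
  then show ?thesis using lipschitz_on_subset[OF assms(1)] unfolding lip_near_def by blast
qed

lemma lip_near_linear:
  fixes f :: "'a::euclidean_space \<Rightarrow> 'b::real_normed_vector"
  assumes "linear f"
  shows "lip_near f x"
proof -
  obtain B where B: "0 < B" "\<And>y. norm (f y) \<le> B * norm y" using linear_bounded_pos[OF assms] by blast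
  have "B-lipschitz_on UNIV f"
    using B by (intro lipschitz_onI) (auto simp: dist_norm linear_diff[OF assms, symmetric])
  then show ?thesis by (rule lip_near_if_lipschitz_on) auto
qed

lemma loc_lipschitz_on_if_eq:
  assumes "\<And>x. x \<in> U \<Longrightarrow> lip_near F x" "\<And>x. x \<in> U \<Longrightarrow> f x = F x"
  shows "loc_lipschitz_on U f"
  unfolding loc_lipschitz_on_def
proof
  fix x assume "x \<in> U"
  then obtain r L where r: "0 < r" "L-lipschitz_on (cball x r) F" using assms unfolding lip_near_def by blast
  have "L-lipschitz_on (cball x r \<inter> U) F" by (rule lipschitz_on_subset[OF r(2)]) auto
  then have "L-lipschitz_on (cball x r \<inter> U) f" by (rule lipschitz_on_transform) (use assms(2) in auto)
  then show "\<exists>r>0. \<exists>L. L-lipschitz_on (cball x r \<inter> U) f" using r(1) by blast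
qed

lemma matrix_inv_works:
  fixes M :: "real^'n^'n"
  assumes "invertible M"
  shows "M *v (matrix_inv M *v w) = w" "matrix_inv M *v (M *v w) = w"
proof -
  have "M ** matrix_inv M = mat 1 \<and> matrix_inv M ** M = mat 1"
    unfolding matrix_inv_def by (rule someI_ex) (use assms in \<open>auto simp: invertible_def\<close>)
  then show "M *v (matrix_inv M *v w) = w" "matrix_inv M *v (M *v w) = w"
    by (simp_all add: matrix_vector_mul_assoc)
qed

text \<open>From \<open>A\<^sup>-\<^sup>1 - B\<^sup>-\<^sup>1 = A\<^sup>-\<^sup>1 (B - A) B\<^sup>-\<^sup>1\<close>, with inverses that are bounded near \<open>x0\<close> because \<open>|M x v|\<close>
is bounded below by a multiple of \<open>|v|\<close> there.\<close>

lemma lip_near_matrix_inv: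
  fixes M :: "'a::metric_space \<Rightarrow> real^'n^'n"
  assumes M: "lip_near M x0" and inv: "invertible (M x0)"
  shows "lip_near (\<lambda>x. matrix_inv (M x) $ k $ l) x0"
proof -
  obtain C where C: "0 < C" "\<And>(A::real^'n^'n) v. norm (A *v v) \<le> norm A * norm v * C"
    using bounded_bilinear.pos_bounded[OF bounded_bilinear_matrix_vector] by blast
  obtain r L where r: "0 < r" "0 \<le> L" "L-lipschitz_on (cball x0 r) M"
    using lip_near_bounded[OF M] by blast
  obtain b where b: "0 < b" "\<And>v. b * norm v \<le> norm (M x0 *v v)"
    using linear_inj_bounded_below_pos[OF matrix_vector_mul_linear inj_matrix_vector_mult[OF inv]] by blast
  define k' where "k' = L * C + 1"
  have k': "0 < k'" "L * C \<le> k'" using r(2) C(1) by (auto simp: k'_def add_nonneg_pos)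
  define s where "s = min r (b / (2 * k'))"
  have s: "0 < s" "s \<le> r" "L * s * C \<le> b / 2"
  proof -
    show s0: "0 < s" "s \<le> r" using r b k' by (auto simp: s_def)
    have "(L * C) * s \<le> k' * (b / (2 * k'))"
      using k' s0(1) by (intro mult_mono) (auto simp: s_def)
    also have "\<dots> = b / 2" using k' by simp
    finally show "L * s * C \<le> b / 2" by (simp add: mult_ac)
  qed
  have low: "b / 2 * norm v \<le> norm (M x *v v)" if x: "x \<in> cball x0 s" for x v
  proof -
    have "norm (M x - M x0) \<le> L * dist x x0"
      using lipschitz_onD[OF r(3), of x x0] x s r(1) by (simp add: dist_norm)
    also have "\<dots> \<le> L * s" using x r(2) by (intro mult_left_mono) (auto simp: dist_commute)
    finally have "norm ((M x - M x0) *v v) \<le> (L * s) * norm v * C"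
      using C(1) by (intro order_trans[OF C(2)] mult_right_mono) auto
    also have "\<dots> = (L * s * C) * norm v" by simp
    also have "\<dots> \<le> b / 2 * norm v" using s(3) by (intro mult_right_mono) auto
    finally have "norm (M x *v v - M x0 *v v) \<le> b / 2 * norm v"
      by (simp add: matrix_vector_mult_diff_rdistrib)
    then show ?thesis using b(2)[of v] norm_triangle_ineq2[of "M x0 *v v" "M x *v v"]
      by (simp add: norm_minus_commute)
  qed
  have invx: "invertible (M x)" if "x \<in> cball x0 s" for x
  proof -
    have "inj ((*v) (M x))"
    proof (rule injI)
      fix v w assume "M x *v v = M x *v w"
      then have "b / 2 * norm (v - w) \<le> 0"
        using low[OF that, of "v - w"] by (simp add: matrix_vector_mult_diff_distrib)
      then show "v = w" using b(1) by (simp add: mult_le_0_iff)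
    qed
    then show ?thesis
      using matrix_left_invertible_injective invertible_left_inverse by blast
  qed
  have bound: "norm (matrix_inv (M x) *v w) \<le> 2 / b * norm w" if "x \<in> cball x0 s" for x w
    using low[OF that, of "matrix_inv (M x) *v w"] b(1)
    by (simp add: matrix_inv_works(1)[OF invx[OF that]] field_simps)
  have "((2 / b) * ((2 / b) * (L * C)))-lipschitz_on (cball x0 s) (\<lambda>x. matrix_inv (M x) $ k $ l)"
  proof (rule lipschitz_onI)
    fix x y assume xy: "x \<in> cball x0 s" "y \<in> cball x0 s"
    define e where "e = (axis l 1 :: real^'n)"
    have e: "norm e = 1" by (simp add: e_def)
    have col: "matrix_inv A $ k $ l = (matrix_inv A *v e) $ k" for A :: "real^'n^'n"
      by (simp add: e_def matrix_vector_mul_component cart_eq_inner_axis[symmetric] inner_axis)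
    define w where "w = matrix_inv (M y) *v e"
    have "matrix_inv (M x) *v e - w = matrix_inv (M x) *v ((M y - M x) *v w)"
      by (simp add: matrix_vector_mult_diff_rdistrib matrix_vector_mult_diff_distrib
          matrix_inv_works[OF invx[OF xy(1)]] w_def matrix_inv_works[OF invx[OF xy(2)]])
    then have "norm (matrix_inv (M x) *v e - w) \<le> 2 / b * norm ((M y - M x) *v w)"
      using bound[OF xy(1)] by simp
    also have "\<dots> \<le> 2 / b * ((L * dist x y) * (2 / b) * C)"
    proof (intro mult_left_mono order_trans[OF C(2)] mult_right_mono mult_mono)
      show "norm (M y - M x) \<le> L * dist x y"
        using lipschitz_onD[OF r(3), of y x] xy s(2) by (simp add: dist_norm[of "M y"] dist_commute[of x y])
      show "norm w \<le> 2 / b" using bound[OF xy(2), of e] e by (simp add: w_def)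
    qed (use r b C in auto)
    finally have "norm (matrix_inv (M x) *v e - w) \<le> (2 / b) * ((2 / b) * (L * C)) * dist x y"
      by (simp add: mult_ac)
    then show "dist (matrix_inv (M x) $ k $ l) (matrix_inv (M y) $ k $ l)
        \<le> (2 / b) * ((2 / b) * (L * C)) * dist x y"
      unfolding col dist_real_def w_def
      using component_le_norm_cart[of "matrix_inv (M x) *v e - matrix_inv (M y) *v e" k] by simp
  qed (use r b C in auto)
  then show ?thesis using s(1) unfolding lip_near_def by blast
qed

lemma spray_bound_of_coefficients:
  fixes Gam :: "'n::finite \<Rightarrow> 'n \<Rightarrow> real^'n \<Rightarrow> real^'n"
  assumes "\<And>i j. lip_near (Gam i j) x0"
  shows "\<exists>r>0. \<exists>K. spray_bound (\<lambda>x u. \<Sum>i\<in>UNIV. \<Sum>j\<in>UNIV. (u $ i * u $ j) *\<^sub>R Gam i j x) (cball x0 r) K"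
proof -
  obtain r L where r: "0 < r" "0 \<le> L" "\<And>i j. L-lipschitz_on (cball x0 r) (Gam i j)"
      "\<And>i j y. y \<in> cball x0 r \<Longrightarrow> norm (Gam i j y) \<le> L"
    using lip_near_family[of "UNIV :: ('n \<times> 'n) set" "\<lambda>(i, j). Gam i j" x0] assms by fastforce
  define K where "K = of_nat CARD('n) * (of_nat CARD('n) * (2 * L))"
  have "spray_bound (\<lambda>x u. \<Sum>i\<in>UNIV. \<Sum>j\<in>UNIV. (u $ i * u $ j) *\<^sub>R Gam i j x) (cball x0 r) K"
    unfolding spray_bound_def
  proof (intro conjI ballI allI impI)
    show "0 \<le> K" using r(2) by (simp add: K_def)
    show "(\<Sum>i\<in>UNIV. \<Sum>j\<in>UNIV. ((s *\<^sub>R u) $ i * (s *\<^sub>R u) $ j) *\<^sub>R Gam i j x)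
        = s\<^sup>2 *\<^sub>R (\<Sum>i\<in>UNIV. \<Sum>j\<in>UNIV. (u $ i * u $ j) *\<^sub>R Gam i j x)" for x u s
      by (simp add: scaleR_sum_right power2_eq_square mult_ac)
    fix x y u v :: "real^'n" and \<rho> :: real
    assume x: "x \<in> cball x0 r" and y: "y \<in> cball x0 r" and u: "norm u \<le> \<rho>" and v: "norm v \<le> \<rho>"
    have \<rho>: "0 \<le> \<rho>" using u norm_ge_zero order_trans by blast
    define D where "D = \<rho>\<^sup>2 * norm (x - y) + \<rho> * norm (u - v)"
    have c: "\<bar>w $ i\<bar> \<le> \<rho>" if "norm w \<le> \<rho>" for w :: "real^'n" and i
      using component_le_norm_cart[of w i] that by simp
    have summand: "norm ((u $ i * u $ j) *\<^sub>R Gam i j x - (v $ i * v $ j) *\<^sub>R Gam i j y) \<le> 2 * L * D" for i j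
    proof -
      have "norm (Gam i j x - Gam i j y) \<le> L * norm (x - y)"
        using lipschitz_onD[OF r(3) x y] by (simp add: dist_norm)
      then have 1: "norm ((u $ i * u $ j) *\<^sub>R (Gam i j x - Gam i j y)) \<le> (\<rho> * \<rho>) * (L * norm (x - y))"
        using c[OF u] \<rho> by (simp add: abs_mult mult_mono)
      have uv: "\<bar>u $ i - v $ i\<bar> \<le> norm (u - v)" for i
        using component_le_norm_cart[of "u - v" i] by simp
      have "\<bar>u $ i * u $ j - v $ i * v $ j\<bar> = \<bar>u $ i * (u $ j - v $ j) + (u $ i - v $ i) * v $ j\<bar>"
        by (simp add: algebra_simps)
      also have "\<dots> \<le> \<bar>u $ i\<bar> * \<bar>u $ j - v $ j\<bar> + \<bar>u $ i - v $ i\<bar> * \<bar>v $ j\<bar>"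
        by (simp add: abs_mult[symmetric] abs_triangle_ineq)
      also have "\<dots> \<le> \<rho> * norm (u - v) + norm (u - v) * \<rho>"
        using c[OF u] c[OF v] uv \<rho> by (intro add_mono mult_mono) auto
      finally have 2: "norm ((u $ i * u $ j - v $ i * v $ j) *\<^sub>R Gam i j y) \<le> (2 * \<rho> * norm (u - v)) * L"
        using r(4)[OF y] \<rho> by (simp add: mult_mono)
      have eq: "(u $ i * u $ j) *\<^sub>R Gam i j x - (v $ i * v $ j) *\<^sub>R Gam i j y
          = (u $ i * u $ j) *\<^sub>R (Gam i j x - Gam i j y) + (u $ i * u $ j - v $ i * v $ j) *\<^sub>R Gam i j y"
        by (simp add: algebra_simps)
      have "norm ((u $ i * u $ j) *\<^sub>R Gam i j x - (v $ i * v $ j) *\<^sub>R Gam i j y)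
          \<le> (\<rho> * \<rho>) * (L * norm (x - y)) + (2 * \<rho> * norm (u - v)) * L"
        unfolding eq by (rule order_trans[OF norm_triangle_ineq add_mono[OF 1 2]])
      also have "\<dots> \<le> 2 * L * D"
        using r(2) \<rho> by (simp add: D_def power2_eq_square algebra_simps)
      finally show ?thesis .
    qed
    have "norm (\<Sum>i\<in>UNIV. \<Sum>j\<in>UNIV. (u $ i * u $ j) *\<^sub>R Gam i j x - (v $ i * v $ j) *\<^sub>R Gam i j y)
        \<le> of_nat CARD('n) * (of_nat CARD('n) * (2 * L * D))"
      by (intro sum_norm_bound summand)
    then show "norm ((\<Sum>i\<in>UNIV. \<Sum>j\<in>UNIV. (u $ i * u $ j) *\<^sub>R Gam i j x)
        - (\<Sum>i\<in>UNIV. \<Sum>j\<in>UNIV. (v $ i * v $ j) *\<^sub>R Gam i j y)) \<le> K * (\<rho>\<^sup>2 * norm (x - y) + \<rho> * norm (u - v))"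
      by (simp add: sum_subtractf K_def D_def mult_ac)
  qed
  then show ?thesis using r(1) by blast
qed

section \<open>Lorentzian bilinear forms\<close>

definition lorentz_matrix :: "real^'n^'n \<Rightarrow> bool" where
  "lorentz_matrix M \<longleftrightarrow> (\<forall>u v. mform M u v = mform M v u) \<and>
     (\<exists>(e :: 'n \<Rightarrow> real^'n) k. \<forall>i j. mform M (e i) (e j) = (if i = j then (if i = k then -1 else 1) else 0))"

lemma mform_sum_left: "mform M (\<Sum>i\<in>I. c i *\<^sub>R e i) v = (\<Sum>i\<in>I. c i * mform M (e i) v)"
  by (induction I rule: infinite_finite_induct) (simp_all add: mform_simps)

lemma mform_sum_right: "mform M v (\<Sum>i\<in>I. c i *\<^sub>R e i) = (\<Sum>i\<in>I. c i * mform M v (e i))"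
  by (induction I rule: infinite_finite_induct) (simp_all add: mform_simps)

lemma lorentz_matrix_coordinates:
  fixes M :: "real^'n^'n"
  assumes "lorentz_matrix M"
  obtains X :: "real^'n \<Rightarrow> real^'n" and k where
    "\<And>u v. mform M u v = (\<Sum>i\<in>UNIV - {k}. X u $ i * X v $ i) - X u $ k * X v $ k"
    "\<And>u. X u = 0 \<longleftrightarrow> u = 0" "\<And>c. \<exists>u. X u = c"
proof -
  obtain e :: "'n \<Rightarrow> real^'n" and k where e: "\<And>i j. mform M (e i) (e j) = (if i = j then (if i = k then -1 else 1) else 0)"
    using assms unfolding lorentz_matrix_def by blast
  define E where "E c = (\<Sum>i\<in>UNIV. c $ i *\<^sub>R e i)" for c :: "real^'n"
  have E: "mform M (E c) (E d) = (\<Sum>i\<in>UNIV - {k}. c $ i * d $ i) - c $ k * d $ k" for c d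
  proof -
    have "mform M (E c) (E d) = (\<Sum>i\<in>UNIV. c $ i * (\<Sum>j\<in>UNIV. d $ j * (if i = j then (if i = k then -1 else 1) else 0)))"
    proof -
      have "mform M (e i) (E d) = (\<Sum>j\<in>UNIV. d $ j * (if i = j then (if i = k then -1 else 1) else 0))" for i
        by (simp add: E_def mform_sum_right e)
      then show ?thesis by (simp only: E_def[of c] mform_sum_left)
    qed
    also have "\<dots> = (\<Sum>i\<in>UNIV. c $ i * (d $ i * (if i = k then -1 else 1)))"
      by (intro sum.cong refl arg_cong2[where f = "(*)"]) (simp add: if_distrib[of "\<lambda>x. _ * x"] cong: if_cong)
    also have "\<dots> = c $ k * (d $ k * -1) + (\<Sum>i\<in>UNIV - {k}. c $ i * (d $ i * (if i = k then -1 else 1)))"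
      by (subst sum.remove[of UNIV k]) auto
    also have "(\<Sum>i\<in>UNIV - {k}. c $ i * (d $ i * (if i = k then -1 else 1))) = (\<Sum>i\<in>UNIV - {k}. c $ i * d $ i)"
      by (intro sum.cong) auto
    finally show ?thesis by simp
  qed
  have lin: "linear E"
    unfolding E_def by (intro linearI) (simp_all add: scaleR_add_left sum.distrib scaleR_sum_right)
  have coord: "mform M (E c) (e j) = c $ j * (if j = k then -1 else 1)" for c j
    by (simp add: E_def mform_sum_left e if_distrib[of "\<lambda>x. _ * x"] cong: if_cong)
  have inj: "inj E"
    unfolding linear_injective_0[OF lin]
  proof (intro allI impI)
    fix c assume "E c = 0"
    then have "c $ j = 0" for j using coord[of c j] by (simp add: mform_simps split: if_splits)
    then show "c = 0" by (simp add: vec_eq_iff)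
  qed
  then have surj: "surj E" using linear_injective_imp_surjective[OF lin] by simp
  define X where "X = inv E"
  have EX: "E (X u) = u" for u unfolding X_def using surj by (rule surj_f_inv_f)
  have XE: "X (E c) = c" for c unfolding X_def using inj by (rule inv_f_f)
  show ?thesis
  proof (rule that[of X k])
    show "mform M u v = (\<Sum>i\<in>UNIV - {k}. X u $ i * X v $ i) - X u $ k * X v $ k" for u v
      using E[of "X u" "X v"] by (simp add: EX)
    show "X u = 0 \<longleftrightarrow> u = 0" for u using EX[of u] XE[of 0] linear_0[OF lin] by metis
    show "\<exists>u. X u = c" for c using XE by blast
  qed
qed

lemma lorentz_matrix_nondegenerate:
  fixes M :: "real^'n^'n"
  assumes "lorentz_matrix M" "\<And>v. mform M u v = 0"
  shows "u = 0"
proof -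
  obtain X :: "real^'n \<Rightarrow> real^'n" and k where X:
    "\<And>u v. mform M u v = (\<Sum>i\<in>UNIV - {k}. X u $ i * X v $ i) - X u $ k * X v $ k"
    "\<And>u. X u = 0 \<longleftrightarrow> u = 0" "\<And>c. \<exists>u. X u = c"
    using lorentz_matrix_coordinates[OF assms(1)] by blast
  obtain v where "X v = (\<chi> i. if i = k then - X u $ k else X u $ i)" using X(3) by blast
  then have "(\<Sum>i\<in>UNIV - {k}. X u $ i * X u $ i) + X u $ k * X u $ k = 0"
    using assms(2)[of v] unfolding X(1) by simp
  then have "(\<Sum>i\<in>UNIV. X u $ i * X u $ i) = 0"
    by (subst sum.remove[of UNIV k]) auto
  then have "X u $ i = 0" for i by (subst (asm) sum_nonneg_eq_0_iff) auto
  then have "X u = 0" by (simp add: vec_eq_iff)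
  then show ?thesis using X(2) by simp
qed

lemma lorentz_matrix_invertible:
  assumes "lorentz_matrix M"
  shows "invertible M"
proof -
  have "inj ((*v) M)"
    unfolding linear_injective_0[OF matrix_vector_mul_linear]
  proof (intro allI impI)
    fix u assume "M *v u = 0"
    then have "mform M u v = 0" for v
      using assms unfolding lorentz_matrix_def mform_def by (metis inner_zero_right)
    then show "u = 0" by (rule lorentz_matrix_nondegenerate[OF assms])
  qed
  then show ?thesis using matrix_left_invertible_injective invertible_left_inverse by blast
qed

text \<open>The reversed Cauchy--Schwarz inequality, with \<open>h\<close> the time component in an orthonormal frame: for a
timelike and a causal vector the product of the time components dominates the spatial part of the
bilinear form and so determines its sign.\<close>

lemma lorentz_matrix_causal_signs:
  fixes M :: "real^'n^'n"
  assumes "lorentz_matrix M"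
  obtains h :: "real^'n \<Rightarrow> real" where
    "\<And>u v. mform M u u < 0 \<Longrightarrow> v \<noteq> 0 \<Longrightarrow> mform M v v \<le> 0 \<Longrightarrow>
       h u * h v \<noteq> 0 \<and> mform M u v \<noteq> 0 \<and> (mform M u v < 0 \<longleftrightarrow> 0 < h u * h v)"
proof -
  obtain X :: "real^'n \<Rightarrow> real^'n" and k where X:
    "\<And>u v. mform M u v = (\<Sum>i\<in>UNIV - {k}. X u $ i * X v $ i) - X u $ k * X v $ k"
    "\<And>u. X u = 0 \<longleftrightarrow> u = 0"
    using lorentz_matrix_coordinates[OF assms] by metis
  show ?thesis
  proof (rule that[of "\<lambda>u. X u $ k"])
    fix u v assume u: "mform M u u < 0" and v: "v \<noteq> 0" "mform M v v \<le> 0"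
    define s where "s = (\<Sum>i\<in>UNIV - {k}. X u $ i * X v $ i)"
    define a where "a = (\<Sum>i\<in>UNIV - {k}. (X u $ i)\<^sup>2)"
    define b where "b = (\<Sum>i\<in>UNIV - {k}. (X v $ i)\<^sup>2)"
    have a: "0 \<le> a" "a < (X u $ k)\<^sup>2" and b: "0 \<le> b" "b \<le> (X v $ k)\<^sup>2"
      using u v unfolding X(1) by (auto simp: a_def b_def power2_eq_square intro!: sum_nonneg)
    have "X v $ k \<noteq> 0"
    proof
      assume 0: "X v $ k = 0"
      then have "b = 0" using b by simp
      then have "X v $ i = 0" if "i \<noteq> k" for i
        using that unfolding b_def by (subst (asm) sum_nonneg_eq_0_iff) auto
      then have "X v = 0" using 0 unfolding vec_eq_iff by (metis zero_index)
      then show False using v(1) X(2) by simp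
    qed
    then have vk: "0 < (X v $ k)\<^sup>2" by simp
    have "s\<^sup>2 \<le> a * b"
      unfolding s_def a_def b_def by (rule Cauchy_Schwarz_ineq_sum)
    also have "\<dots> \<le> a * (X v $ k)\<^sup>2" using a b by (intro mult_left_mono) auto
    also have "\<dots> < (X u $ k)\<^sup>2 * (X v $ k)\<^sup>2" using a vk by simp
    finally have "s\<^sup>2 < (X u $ k * X v $ k)\<^sup>2" by (simp add: power_mult_distrib)
    then have "\<bar>s\<bar> < \<bar>X u $ k * X v $ k\<bar>" by (simp add: abs_le_square_iff[symmetric] not_le[symmetric])
    moreover have "mform M u v = s - X u $ k * X v $ k" unfolding X(1) s_def by simp
    ultimately show "X u $ k * X v $ k \<noteq> 0 \<and> mform M u v \<noteq> 0 \<and> (mform M u v < 0 \<longleftrightarrow> 0 < X u $ k * X v $ k)"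
      by linarith
  qed
qed

lemma lorentz_matrix_causal_timelike:
  fixes M :: "real^'n^'n"
  assumes M: "lorentz_matrix M" and t: "mform M t t < 0" and u: "u \<noteq> 0" "mform M u u \<le> 0"
  shows "mform M u t \<noteq> 0"
proof -
  obtain h :: "real^'n \<Rightarrow> real" where h: "\<And>u v. mform M u u < 0 \<Longrightarrow> v \<noteq> 0 \<Longrightarrow> mform M v v \<le> 0 \<Longrightarrow>
       h u * h v \<noteq> 0 \<and> mform M u v \<noteq> 0 \<and> (mform M u v < 0 \<longleftrightarrow> 0 < h u * h v)"
    using lorentz_matrix_causal_signs[OF M] by blast
  have "mform M u t = mform M t u" using M by (simp add: lorentz_matrix_def)
  then show ?thesis using h[OF t u] by simp
qed

lemma lorentz_matrix_future_future:
  fixes M :: "real^'n^'n"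
  assumes M: "lorentz_matrix M" and t: "mform M t t < 0"
    and u: "mform M u u < 0" "mform M u t < 0" and v: "mform M v v \<le> 0" "mform M v t < 0"
  shows "mform M u v < 0"
proof -
  obtain h :: "real^'n \<Rightarrow> real" where h: "\<And>u v. mform M u u < 0 \<Longrightarrow> v \<noteq> 0 \<Longrightarrow> mform M v v \<le> 0 \<Longrightarrow>
       h u * h v \<noteq> 0 \<and> mform M u v \<noteq> 0 \<and> (mform M u v < 0 \<longleftrightarrow> 0 < h u * h v)"
    using lorentz_matrix_causal_signs[OF M] by blast
  have v0: "v \<noteq> 0" and t0: "t \<noteq> 0" using v t by (auto simp: mform_simps)
  have "mform M t v < 0" using v(2) M by (simp add: lorentz_matrix_def)
  then have "0 < h t * h v" using h[OF t v0 v(1)] by simp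
  moreover have "0 < h u * h t" using h[OF u(1) t0] t u(2) by simp
  ultimately have "0 < h u * h v" by (auto simp: zero_less_mult_iff)
  then show ?thesis using h[OF u(1) v0 v(1)] by simp
qed

section \<open>The choice of the constants\<close>

lemma spray_bound_mono: "spray_bound S U K \<Longrightarrow> K \<le> K' \<Longrightarrow> spray_bound S U K'"
proof -
  assume S: "spray_bound S U K" and K: "K \<le> K'"
  have "norm (S x u - S y v) \<le> K' * (\<rho>\<^sup>2 * norm (x - y) + \<rho> * norm (u - v))"
    if "x \<in> U" "y \<in> U" "norm u \<le> \<rho>" "norm v \<le> \<rho>" for x y u v \<rho>
  proof -
    have "0 \<le> \<rho>" using that norm_ge_zero order_trans by blast
    then show ?thesis
      by (intro order_trans[OF spray_boundD[OF S that] mult_right_mono[OF K]]) simp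
  qed
  then show ?thesis using S K unfolding spray_bound_def by auto
qed

text \<open>On the compact set of causal unit vectors with \<open>mform (G x) u (T x) \<le> 0\<close> this product is negative,
hence bounded away from zero; scaling and the continuity of \<open>x \<mapsto> G x (T x)\<close> give the rest.\<close>

lemma future_covector_bound:
  fixes G :: "real^'n \<Rightarrow> real^'n^'n"
  assumes r0: "0 < r0" and G: "continuous_on (cball z0 r0) G" and T: "continuous_on (cball z0 r0) T"
    and lor: "\<And>x. x \<in> cball z0 r0 \<Longrightarrow> lorentz_matrix (G x)"
    and Tt: "\<And>x. x \<in> cball z0 r0 \<Longrightarrow> mform (G x) (T x) (T x) < 0"
  shows "\<exists>m>0. \<exists>r>0. r \<le> r0 \<and> (\<forall>x\<in>cball z0 r. \<forall>u. mform (G x) u u \<le> 0 \<longrightarrow> mform (G x) u (T x) < 0 \<longrightarrow>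
     m * norm u \<le> (- (G z0 *v T z0)) \<bullet> u)"
proof -
  let ?C = "cball z0 r0 \<times> sphere (0::real^'n) 1"
  define N where "N x = G x *v T x" for x
  have N: "continuous_on (cball z0 r0) N"
    unfolding N_def by (intro bounded_bilinear.continuous_on[OF bounded_bilinear_matrix_vector] G T)
  have mN: "mform (G x) u (T x) = u \<bullet> N x" for x u by (simp add: mform_def N_def)
  have Gc: "continuous_on ?C (\<lambda>p. G (fst p))" and Nc: "continuous_on ?C (\<lambda>p. N (fst p))"
    by (auto intro!: continuous_on_compose2[OF G] continuous_on_compose2[OF N] continuous_intros)
  define A where "A = {p \<in> ?C. mform (G (fst p)) (snd p) (snd p) \<le> 0} \<inter> {p \<in> ?C. snd p \<bullet> N (fst p) \<le> 0}"
  have "closed A"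
    unfolding A_def
    by (intro closed_Int continuous_on_closed_Collect_le continuous_intros Gc Nc closed_Times closed_cball
        closed_sphere)
  moreover have "compact ?C" by (intro compact_Times compact_cball compact_sphere)
  moreover have "A \<subseteq> ?C" by (auto simp: A_def)
  ultimately have A: "compact A" by (metis compact_Int_closed inf.absorb_iff2)
  have pos: "0 < - (snd p \<bullet> N (fst p))" if "p \<in> A" for p
  proof -
    have p: "fst p \<in> cball z0 r0" "norm (snd p) = 1" "mform (G (fst p)) (snd p) (snd p) \<le> 0"
        "snd p \<bullet> N (fst p) \<le> 0"
      using that by (auto simp: A_def mem_Times_iff simp del: mem_cball)
    have "snd p \<bullet> N (fst p) \<noteq> 0"
    proof -
      have "snd p \<noteq> 0" using p(2) by (metis norm_zero zero_neq_one)
      then show ?thesis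
        using lorentz_matrix_causal_timelike[OF lor[OF p(1)] Tt[OF p(1)] _ p(3)] by (simp add: mN)
    qed
    then show ?thesis using p(4) by simp
  qed
  have "\<exists>m0>0. \<forall>p\<in>A. m0 \<le> - (snd p \<bullet> N (fst p))"
  proof (cases "A = {}")
    case False
    have "continuous_on A (\<lambda>p. - (snd p \<bullet> N (fst p)))"
      by (intro continuous_intros continuous_on_subset[OF Nc \<open>A \<subseteq> ?C\<close>])
    then obtain p where "p \<in> A" "\<forall>q\<in>A. - (snd p \<bullet> N (fst p)) \<le> - (snd q \<bullet> N (fst q))"
      using continuous_attains_inf[OF A False] by blast
    then show ?thesis using pos by blast
  qed (auto intro: exI[of _ 1])
  then obtain m0 where m0: "0 < m0" "\<And>p. p \<in> A \<Longrightarrow> m0 \<le> - (snd p \<bullet> N (fst p))" by blast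
  have m0_bound: "m0 * norm u \<le> - (u \<bullet> N x)"
    if x: "x \<in> cball z0 r0" and u: "mform (G x) u u \<le> 0" "mform (G x) u (T x) < 0" for x u
  proof -
    have u0: "0 < norm u" using u(2) by (auto simp: mform_simps)
    have "(x, u /\<^sub>R norm u) \<in> A"
      using x u u0 unfolding A_def mN by (simp add: mform_simps mult_le_0_iff divide_simps del: mem_cball)
    then have "m0 \<le> - ((u /\<^sub>R norm u) \<bullet> N x)" using m0(2) by fastforce
    then have "m0 * norm u \<le> - ((u /\<^sub>R norm u) \<bullet> N x) * norm u" using u0 by (intro mult_right_mono) auto
    also have "\<dots> = - (u \<bullet> N x)" using u0 by simp
    finally show ?thesis .
  qed
  obtain d where d: "0 < d" "\<And>x. x \<in> cball z0 r0 \<Longrightarrow> dist x z0 < d \<Longrightarrow> dist (N x) (N z0) < m0 / 2"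
    using N m0(1) r0 unfolding continuous_on_iff by (metis centre_in_cball half_gt_zero less_imp_le)
  define r where "r = min r0 (d / 2)"
  have "m0 / 2 * norm u \<le> (- (G z0 *v T z0)) \<bullet> u"
    if x: "x \<in> cball z0 r" and u: "mform (G x) u u \<le> 0" "mform (G x) u (T x) < 0" for x u
  proof -
    have x0: "x \<in> cball z0 r0" "dist x z0 < d" using x d(1) by (auto simp: r_def dist_commute)
    have "\<bar>(N x - N z0) \<bullet> u\<bar> \<le> norm (N x - N z0) * norm u" by (rule Cauchy_Schwarz_ineq2)
    also have "\<dots> \<le> m0 / 2 * norm u"
      using d(2)[OF x0] by (intro mult_right_mono) (auto simp: dist_norm)
    finally have "- (m0 / 2 * norm u) \<le> (N x - N z0) \<bullet> u" by (simp add: abs_le_iff)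
    moreover have "(- (G z0 *v T z0)) \<bullet> u = - (u \<bullet> N x) + (N x - N z0) \<bullet> u"
      by (simp add: N_def inner_diff_left inner_diff_right inner_commute)
    ultimately show ?thesis using m0_bound[OF x0(1) u] by (simp add: field_simps)
  qed
  then show ?thesis
    using m0(1) d(1) r0 by (intro exI[of _ "m0/2"] conjI exI[of _ r]) (auto simp: r_def simp del: mem_cball)
qed

lemma local_lorentz_exists:
  fixes G :: "real^'n \<Rightarrow> real^'n^'n"
  assumes U: "open U" "z0 \<in> U"
    and G: "\<And>x. x \<in> U \<Longrightarrow> (G has_derivative DG x) (at x)" and DG: "\<And>v. lip_near (\<lambda>x. DG x v) z0"
    and lor: "\<And>x. x \<in> U \<Longrightarrow> lorentz_matrix (G x)"
    and T: "continuous_on U T" and Tt: "\<And>x. x \<in> U \<Longrightarrow> mform (G x) (T x) (T x) < 0"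
    and S: "\<exists>r>0. \<exists>K. spray_bound S (cball z0 r) K"
    and EL: "\<And>x u w. x \<in> U \<Longrightarrow> mform (G x) (S x u) w = 1/2 * mform (DG x w) u u - mform (DG x u) u w"
  shows "\<exists>\<tau> R K m \<rho> r a. cball z0 R \<subseteq> U \<and> local_lorentz G DG S T \<tau> z0 R K m \<rho> r a"
proof -
  obtain C where C: "0 < C" "\<And>(A::real^'n^'n) v. norm (A *v v) \<le> norm A * norm v * C"
    using bounded_bilinear.pos_bounded[OF bounded_bilinear_matrix_vector] by blast
  have mC: "\<bar>mform A u v\<bar> \<le> C * norm A * norm u * norm v" for A :: "real^'n^'n" and u v
  proof -
    have "\<bar>mform A u v\<bar> \<le> norm u * (norm A * norm v * C)"
      unfolding mform_def by (intro order_trans[OF Cauchy_Schwarz_ineq2] mult_left_mono C(2)) auto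
    then show ?thesis by (simp add: mult_ac)
  qed
  obtain r1 L where r1: "0 < r1" "0 \<le> L" "cball z0 r1 \<subseteq> U"
    and L1: "\<And>x y. x \<in> cball z0 r1 \<Longrightarrow> y \<in> cball z0 r1 \<Longrightarrow> norm (G y - G x) \<le> L * norm (y - x)"
    and L2: "\<And>x y. x \<in> cball z0 r1 \<Longrightarrow> y \<in> cball z0 r1 \<Longrightarrow>
        norm (G y - G x - DG x (y - x)) \<le> L * (norm (y - x))\<^sup>2"
    using C11_estimates[OF U G DG] by blast
  define M where "M = norm (G z0) + L * r1"
  have M: "norm (G x) \<le> M" if "x \<in> cball z0 r1" for x
  proof -
    have "norm (G x - G z0) \<le> L * norm (x - z0)" using L1[of z0 x] that r1 by simp
    also have "\<dots> \<le> L * r1" using that r1 by (intro mult_left_mono) (auto simp: dist_norm norm_minus_commute)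
    finally show ?thesis using norm_triangle_sub[of "G x" "G z0"] by (simp add: M_def)
  qed
  obtain r2 K2 where r2: "0 < r2" "spray_bound S (cball z0 r2) K2" using S by blast
  have Gc: "continuous_on (cball z0 r1) G"
    using G r1(3) by (meson continuous_at_imp_continuous_on has_derivative_continuous subsetD)
  obtain m r3 where r3: "0 < m" "0 < r3" "r3 \<le> r1" "\<And>x u. x \<in> cball z0 r3 \<Longrightarrow> mform (G x) u u \<le> 0 \<Longrightarrow>
      mform (G x) u (T x) < 0 \<Longrightarrow> m * norm u \<le> (- (G z0 *v T z0)) \<bullet> u"
    using future_covector_bound[OF r1(1) Gc continuous_on_subset[OF T r1(3)]] lor Tt r1(3) by blast
  \<comment> \<open>The constant is fixed first, on balls that may still shrink; then \<open>a\<close>, and then the radii.\<close>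
  define K where "K = Max {K2, C * L, C * M}"
  have K: "K2 \<le> K" "C * L \<le> K" "C * M \<le> K" by (auto simp: K_def)
  have K0: "0 \<le> K" using K(2) C(1) r1(2) by (meson mult_nonneg_nonneg less_imp_le order_trans)
  define \<tau> where "\<tau> = - (G z0 *v T z0)"
  define a where "a = K * norm \<tau> + 1"
  define R where "R = Min {r1, r2, r3, 1 / (2 * (K + 1))}"
  define \<rho> where "\<rho> = min (R / 2) (1 / (8 * (K + 1)))"
  define r where "r = min (\<rho> / 8) (m / (8 * a))"
  have a: "1 \<le> a" using K0 by (simp add: a_def)
  have R: "0 < R" "R \<le> r1" "R \<le> r2" "R \<le> r3" "R \<le> 1 / (2 * (K + 1))"
    using r1 r2 r3 K0 by (auto simp: R_def)
  have sub: "cball z0 R \<subseteq> cball z0 r1" "cball z0 R \<subseteq> cball z0 r2" "cball z0 R \<subseteq> cball z0 r3"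
    using R by (auto simp: subset_iff)
  have \<rho>: "0 < \<rho>" "\<rho> \<le> R / 2" "\<rho> \<le> 1 / (8 * (K + 1))" using R K0 by (auto simp: \<rho>_def)
  have KR: "2 * K * R \<le> 1"
  proof -
    have "2 * K * R \<le> 2 * (K + 1) * (1 / (2 * (K + 1)))" using R K0 by (intro mult_mono) auto
    then show ?thesis using K0 by simp
  qed
  have "1 / (8 * (K + 1)) \<le> 1" using K0 by simp
  then have \<rho>1: "\<rho> \<le> 1" using \<rho>(3) by linarith
  have K\<rho>: "K * (\<rho>\<^sup>2 + \<rho>) \<le> 1/4"
  proof -
    have "\<rho>\<^sup>2 \<le> \<rho>" using \<rho>1 \<rho>(1) by (simp add: power2_eq_square mult_left_le)
    then have "K * (\<rho>\<^sup>2 + \<rho>) \<le> (K + 1) * (2 * \<rho>)"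
      using K0 \<rho> by (intro mult_mono) auto
    moreover have "\<rho> * (8 * (K + 1)) \<le> 1" using \<rho>(3) K0 by (simp add: pos_le_divide_eq)
    ultimately show ?thesis by (simp add: algebra_simps)
  qed
  have r: "0 < r" "r \<le> \<rho> / 8" "4 * a * r < m"
  proof -
    show "0 < r" "r \<le> \<rho> / 8" using \<rho> a r3(1) by (auto simp: r_def)
    have "4 * a * r \<le> 4 * a * (m / (8 * a))" using a by (intro mult_left_mono) (auto simp: r_def)
    also have "\<dots> = m / 2" using a by simp
    finally show "4 * a * r < m" using r3(1) by simp
  qed
  have RU: "cball z0 R \<subseteq> U" using sub(1) r1(3) by blast
  have "local_lorentz G DG S T \<tau> z0 R K m \<rho> r a"
  proof
    show "spray_bound S (cball z0 R) K"
      by (rule spray_bound_mono[OF spray_bound_subset[OF r2(2) sub(2)] K(1)])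
    show "2 * K * R \<le> 1" "K * (\<rho>\<^sup>2 + \<rho>) \<le> 1 / 4" "0 < r" "r \<le> \<rho> / 8" "4 * a * r < m"
      "a = K * norm \<tau> + 1" by (fact KR K\<rho> r a_def)+
    show "r + \<rho> \<le> R" using r \<rho> R by simp
    show "continuous_on (cball z0 R) T" using T RU by (rule continuous_on_subset)
    fix x assume x: "x \<in> cball z0 R"
    have xU: "x \<in> U" and x1: "x \<in> cball z0 r1" and x3: "x \<in> cball z0 r3" using x RU sub by blast+
    show "(G has_derivative DG x) (at x)" by (rule G[OF xU])
    show "mform (G x) (T x) (T x) < 0" by (rule Tt[OF xU])
    show "mform (G x) (S x u) w = 1/2 * mform (DG x w) u u - mform (DG x u) u w" for u w by (rule EL[OF xU])
    show "mform (G x) u v = mform (G x) v u" for u v using lor[OF xU] by (simp add: lorentz_matrix_def)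
    show "mform (G x) u (T x) \<noteq> 0" if "u \<noteq> 0" "mform (G x) u u \<le> 0" for u
      by (rule lorentz_matrix_causal_timelike[OF lor[OF xU] Tt[OF xU] that])
    show "mform (G x) u v < 0" if "mform (G x) u u < 0" "mform (G x) u (T x) < 0"
        "mform (G x) v v \<le> 0" "mform (G x) v (T x) < 0" for u v
      by (rule lorentz_matrix_future_future[OF lor[OF xU] Tt[OF xU] that])
    show "m * norm u \<le> \<tau> \<bullet> u" if "mform (G x) u u \<le> 0" "mform (G x) u (T x) < 0" for u
      unfolding \<tau>_def by (rule r3(4)[OF x3 that])
    have bound: "\<bar>mform A u v\<bar> \<le> K * B * norm u * norm v"
      if "norm A \<le> c * B" "0 \<le> B" "C * c \<le> K" for A :: "real^'n^'n" and u v B c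
    proof -
      have "C * norm A \<le> C * (c * B)" using that C(1) by (intro mult_left_mono) auto
      also have "\<dots> \<le> K * B" using mult_right_mono[OF that(3,2)] by (simp add: mult.assoc)
      finally show ?thesis by (intro order_trans[OF mC] mult_right_mono) auto
    qed
    show "\<bar>mform (G x) u v\<bar> \<le> K * norm u * norm v" for u v
      using bound[of "G x" M 1] M[OF x1] K(3) by simp
    fix y assume "y \<in> cball z0 R"
    then have y1: "y \<in> cball z0 r1" using sub by blast
    show "\<bar>mform (G y - G x - DG x (y - x)) u v\<bar> \<le> K * (norm (y - x))\<^sup>2 * norm u * norm v" for u v
      by (rule bound[OF L2[OF x1 y1] _ K(2)]) simp
    show "\<bar>mform (G y - G x) u v\<bar> \<le> K * norm (y - x) * norm u * norm v" for u v
      by (rule bound[OF L1[OF x1 y1] _ K(2)]) simp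
  qed
  then show ?thesis using RU by blast
qed

section \<open>Charts and tangent vectors\<close>

lemma near_in_open:
  fixes \<gamma> :: "real \<Rightarrow> 'a::topological_space"
  assumes "continuous_on I \<gamma>" "t \<in> I" "open V" "\<gamma> t \<in> V"
  shows "\<exists>d>0. \<forall>s\<in>I. dist s t < d \<longrightarrow> \<gamma> s \<in> V"
proof -
  obtain W where W: "open W" "t \<in> W" "\<And>s. s \<in> I \<Longrightarrow> s \<in> W \<Longrightarrow> \<gamma> s \<in> V"
    using assms unfolding continuous_on_topological by metis
  then obtain d where "0 < d" "ball t d \<subseteq> W" using open_contains_ball by metis
  then show ?thesis using W(3) by (intro exI[of _ d]) (auto simp: subset_iff dist_commute)
qed

lemma vec_expand: "(u :: real^'n) = (\<Sum>k\<in>UNIV. u $ k *\<^sub>R axis k 1)"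
  using basis_expansion[of u] by (simp add: scalar_mult_eq_scaleR)

locale atlas =
  fixes A :: "('a::t2_space, 'n::finite) chart set"
  assumes atlas: "C21_atlas A"
begin

lemma chart:
  assumes "c \<in> A"
  shows open_domain: "open (fst c)" and open_image: "open (snd c ` fst c)"
    and continuous_chart: "continuous_on (fst c) (snd c)"
    and continuous_chart_inv: "continuous_on (snd c ` fst c) (chart_inv c)"
    and chart_inv_chart: "\<And>q. q \<in> fst c \<Longrightarrow> chart_inv c (snd c q) = q"
    and chart_chart_inv: "\<And>x. x \<in> snd c ` fst c \<Longrightarrow> snd c (chart_inv c x) = x"
    and chart_inv_in: "\<And>x. x \<in> snd c ` fst c \<Longrightarrow> chart_inv c x \<in> fst c"
  using atlas assms unfolding C21_atlas_def homeomorphism_def by auto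

definition overlap :: "('a, 'n) chart \<Rightarrow> ('a, 'n) chart \<Rightarrow> (real^'n) set" where
  "overlap c c' = snd c ` (fst c \<inter> fst c')"

lemma open_overlap:
  assumes "c \<in> A" "c' \<in> A"
  shows "open (overlap c c')"
proof -
  have "overlap c c' = snd c ` fst c \<inter> chart_inv c -` fst c'"
    using chart_inv_chart[OF assms(1)] by (auto simp: overlap_def)
  then show ?thesis
    using continuous_open_preimage[OF continuous_chart_inv[OF assms(1)] open_image[OF assms(1)]
        open_domain[OF assms(2)]] by simp
qed

definition trans :: "('a, 'n) chart \<Rightarrow> ('a, 'n) chart \<Rightarrow> real^'n \<Rightarrow> real^'n" where
  "trans c c' = snd c' \<circ> chart_inv c"

definition Dtrans :: "('a, 'n) chart \<Rightarrow> ('a, 'n) chart \<Rightarrow> real^'n \<Rightarrow> real^'n \<Rightarrow> real^'n" where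
  "Dtrans c c' x = frechet_derivative (trans c c') (at x)"

definition D2trans :: "('a, 'n) chart \<Rightarrow> ('a, 'n) chart \<Rightarrow> real^'n \<Rightarrow> real^'n \<Rightarrow> real^'n \<Rightarrow> real^'n" where
  "D2trans c c' v x = frechet_derivative (\<lambda>y. Dtrans c c' y v) (at x)"

lemma change_of_chart_Dtrans: "change_of_chart c c' q = Dtrans c c' (snd c q)"
  by (simp add: change_of_chart_def Dtrans_def trans_def)

lemma Ck1_on_trans:
  assumes "c \<in> A" "c' \<in> A"
  shows "Ck1_on (Suc (Suc 0)) (overlap c c') (trans c c')"
  using atlas assms unfolding C21_atlas_def overlap_def trans_def numeral_2_eq_2 by blast

lemma trans_derivative:
  assumes "c \<in> A" "c' \<in> A" "x \<in> overlap c c'"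
  shows "(trans c c' has_derivative Dtrans c c' x) (at x)"
  using Ck1_on_SucD(1)[OF Ck1_on_trans[OF assms(1,2)] assms(3)] by (simp add: Dtrans_def)

lemma Ck1_on_Dtrans:
  assumes "c \<in> A" "c' \<in> A"
  shows "Ck1_on (Suc 0) (overlap c c') (\<lambda>y. Dtrans c c' y v)"
  using Ck1_on_SucD(2)[OF Ck1_on_trans[OF assms(1,2)]] by (simp add: Dtrans_def del: Ck1_on.simps)

lemma Dtrans_derivative:
  assumes "c \<in> A" "c' \<in> A" "x \<in> overlap c c'"
  shows "((\<lambda>y. Dtrans c c' y v) has_derivative D2trans c c' v x) (at x)"
  using Ck1_on_SucD(1)[OF Ck1_on_Dtrans[OF assms(1,2)] assms(3)] by (simp add: D2trans_def)

lemma D2trans_continuous: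
  assumes "c \<in> A" "c' \<in> A"
  shows "continuous_on (overlap c c') (\<lambda>y. D2trans c c' v y w)"
proof -
  have "Ck1_on 0 (overlap c c') (\<lambda>y. D2trans c c' v y w)"
    using Ck1_on_SucD(2)[OF Ck1_on_Dtrans[OF assms(1,2)]] by (simp add: D2trans_def del: Ck1_on.simps)
  then show ?thesis
    by (meson continuous_at_imp_continuous_on lip_near_Ck1_on lip_near_isCont open_overlap assms)
qed

lemma D2trans_symmetric:
  assumes "c \<in> A" "c' \<in> A" "x \<in> overlap c c'"
  shows "D2trans c c' v x w = D2trans c c' w x v"
  by (rule symmetric_second_derivative[OF open_overlap[OF assms(1,2)] assms(3)
        trans_derivative[OF assms(1,2)] Dtrans_derivative[OF assms(1,2)]
        D2trans_continuous[OF assms(1,2)]])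

lemma lip_near_trans:
  assumes "c \<in> A" "c' \<in> A" "x \<in> overlap c c'"
  shows "lip_near (trans c c') x"
  by (rule lip_near_Ck1_on[OF open_overlap[OF assms(1,2)] assms(3) Ck1_on_trans[OF assms(1,2)]])

lemma Dtrans_continuous:
  assumes "c \<in> A" "c' \<in> A"
  shows "continuous_on (overlap c c') (\<lambda>y. Dtrans c c' y v)"
  using Dtrans_derivative[OF assms] by (meson continuous_at_imp_continuous_on has_derivative_continuous)

lemma linear_Dtrans: "c \<in> A \<Longrightarrow> c' \<in> A \<Longrightarrow> x \<in> overlap c c' \<Longrightarrow> linear (Dtrans c c' x)"
  by (rule has_derivative_linear[OF trans_derivative])

lemma linear_D2trans: "c \<in> A \<Longrightarrow> c' \<in> A \<Longrightarrow> x \<in> overlap c c' \<Longrightarrow> linear (D2trans c c' v x)"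
  by (rule has_derivative_linear[OF Dtrans_derivative])

lemma in_overlap: "q \<in> fst c \<Longrightarrow> q \<in> fst c' \<Longrightarrow> snd c q \<in> overlap c c'"
  by (simp add: overlap_def)

lemma trans_chart: "c \<in> A \<Longrightarrow> q \<in> fst c \<Longrightarrow> trans c c' (snd c q) = snd c' q"
  by (simp add: trans_def chart_inv_chart)

lemma change_cocycle:
  assumes "c \<in> A" "c' \<in> A" "c'' \<in> A" "q \<in> fst c" "q \<in> fst c'" "q \<in> fst c''"
  shows "change_of_chart c' c'' q (change_of_chart c c' q u) = change_of_chart c c'' q u"
proof -
  let ?x = "snd c q"
  define W where "W = overlap c c' \<inter> overlap c c''"
  have W: "open W" "?x \<in> W"
    using open_overlap[OF assms(1,2)] open_overlap[OF assms(1,3)] assms by (auto simp: W_def intro: in_overlap)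
  have "(trans c' c'' has_derivative Dtrans c' c'' (snd c' q)) (at (trans c c' ?x))"
    using trans_derivative[OF assms(2,3) in_overlap[OF assms(5,6)]] assms by (simp add: trans_chart)
  from diff_chain_at[OF trans_derivative[OF assms(1,2) in_overlap[OF assms(4,5)]] this]
  have "(trans c' c'' \<circ> trans c c' has_derivative Dtrans c' c'' (snd c' q) \<circ> Dtrans c c' ?x) (at ?x)" .
  moreover have "(trans c' c'' \<circ> trans c c') y = trans c c'' y" if "y \<in> W" for y
  proof -
    obtain q' where "q' \<in> fst c" "q' \<in> fst c'" "y = snd c q'"
      using \<open>y \<in> W\<close> by (auto simp: W_def overlap_def)
    then show ?thesis using chart_inv_chart[OF assms(1)] chart_inv_chart[OF assms(2)] by (simp add: trans_def)
  qed
  ultimately have "(trans c c'' has_derivative Dtrans c' c'' (snd c' q) \<circ> Dtrans c c' ?x) (at ?x)"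
    by (rule has_derivative_transform_within_open[OF _ W])
  from has_derivative_unique[OF this trans_derivative[OF assms(1,3) in_overlap[OF assms(4,6)]]]
  show ?thesis by (simp add: change_of_chart_Dtrans fun_eq_iff)
qed

lemma change_id:
  assumes "c \<in> A" "q \<in> fst c"
  shows "change_of_chart c c q u = u"
proof -
  have "((\<lambda>x. x) has_derivative (\<lambda>x. x)) (at (snd c q))" by (rule has_derivative_ident)
  then have "(trans c c has_derivative (\<lambda>x. x)) (at (snd c q))"
    by (rule has_derivative_transform_within_open[OF _ open_image[OF assms(1)]])
       (use assms in \<open>auto simp: trans_def chart_inv_chart\<close>)
  from has_derivative_unique[OF this trans_derivative[OF assms(1,1) in_overlap[OF assms(2,2)]]]
  show ?thesis by (metis change_of_chart_Dtrans)
qed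

lemma tvec_at: "c' \<in> A \<Longrightarrow> q \<in> fst c' \<Longrightarrow> tvec A c q u c' = change_of_chart c c' q u"
  by (simp add: tvec_def)

lemma tvec_self: "c \<in> A \<Longrightarrow> q \<in> fst c \<Longrightarrow> tvec A c q u c = u"
  by (simp add: tvec_at change_id)

lemma tvec_in_tangent_space:
  assumes "c \<in> A" "q \<in> fst c"
  shows "tvec A c q u \<in> tangent_space A q"
  using assms change_cocycle unfolding tangent_space_def by (auto simp: tvec_def)

lemma tvec_of_tangent:
  assumes "c \<in> A" "q \<in> fst c" "v \<in> tangent_space A q"
  shows "tvec A c q (v c) = v"
proof
  fix c'
  show "tvec A c q (v c) c' = v c'"
  proof (cases "c' \<in> A \<and> q \<in> fst c'")
    case True
    then have "v c' = change_of_chart c c' q (v c)"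
      using assms unfolding tangent_space_def mem_Collect_eq by blast
    then show ?thesis using True by (simp add: tvec_def)
  next
    case False
    then have "v c' = 0" using assms(3) unfolding tangent_space_def mem_Collect_eq by blast
    then show ?thesis using False unfolding tvec_def by (simp only: if_False)
  qed
qed

lemma tvec_change:
  assumes "c \<in> A" "q \<in> fst c" "c' \<in> A" "q \<in> fst c'"
  shows "tvec A c' q (change_of_chart c c' q u) = tvec A c q u"
  using tvec_of_tangent[OF assms(3,4) tvec_in_tangent_space[OF assms(1,2)], of u] assms
  by (simp add: tvec_at)

lemma linear_change:
  assumes "c \<in> A" "c' \<in> A" "q \<in> fst c" "q \<in> fst c'"
  shows "linear (change_of_chart c c' q)"
  unfolding change_of_chart_Dtrans by (rule linear_Dtrans[OF assms(1,2) in_overlap[OF assms(3,4)]])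

subsection \<open>Curves\<close>

lemma curve_change_of_chart:
  assumes c: "c \<in> A" "c' \<in> A" and \<gamma>: "continuous_on I \<gamma>" and t: "t \<in> I" "\<gamma> t \<in> fst c" "\<gamma> t \<in> fst c'"
    and d: "((snd c \<circ> \<gamma>) has_vector_derivative u) (at t within I)"
  shows "((snd c' \<circ> \<gamma>) has_vector_derivative change_of_chart c c' (\<gamma> t) u) (at t within I)"
proof -
  obtain e where e: "0 < e" "\<And>s. s \<in> I \<Longrightarrow> dist s t < e \<Longrightarrow> \<gamma> s \<in> fst c"
    using near_in_open[OF \<gamma> t(1) open_domain[OF c(1)] t(2)] by blast
  have "(trans c c' has_derivative change_of_chart c c' (\<gamma> t)) (at ((snd c \<circ> \<gamma>) t) within (snd c \<circ> \<gamma>) ` I)"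
    using trans_derivative[OF c in_overlap[OF t(2,3)]]
    by (simp add: change_of_chart_Dtrans has_derivative_at_withinI)
  from vector_derivative_diff_chain_within[OF d this] show ?thesis
    by (rule has_vector_derivative_transform_within[OF _ e(1) t(1)])
       (use e(2) trans_chart[OF c(1)] in simp)
qed

lemma velocity_tvec:
  assumes ab: "a < b" "t \<in> {a..b}" and \<gamma>: "continuous_on {a..b} \<gamma>" and c: "c \<in> A" "\<gamma> t \<in> fst c"
    and d: "((snd c \<circ> \<gamma>) has_vector_derivative u) (at t within {a..b})"
  shows "velocity A {a..b} \<gamma> t = tvec A c (\<gamma> t) u"
proof
  fix c'
  show "velocity A {a..b} \<gamma> t c' = tvec A c (\<gamma> t) u c'"
  proof (cases "c' \<in> A \<and> \<gamma> t \<in> fst c'")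
    case True
    then show ?thesis
      using vector_derivative_within_closed_interval[OF ab curve_change_of_chart[OF c(1) _ \<gamma> ab(2) c(2) _ d]]
      by (simp add: velocity_def tvec_def)
  qed (auto simp: velocity_def tvec_def)
qed

lemma velocity_chart:
  assumes c: "c \<in> A" "\<gamma> t \<in> fst c" and d: "(snd c \<circ> \<gamma>) differentiable (at t within {a..b})"
  shows "((snd c \<circ> \<gamma>) has_vector_derivative velocity A {a..b} \<gamma> t c) (at t within {a..b})"
  using d c by (simp add: velocity_def vector_derivative_works)

lemma Dtrans_expand:
  assumes "c \<in> A" "c' \<in> A" "x \<in> overlap c c'"
  shows "Dtrans c c' x u = (\<Sum>k\<in>UNIV. u $ k *\<^sub>R Dtrans c c' x (axis k 1))"
proof -
  have "Dtrans c c' x u = Dtrans c c' x (\<Sum>k\<in>UNIV. u $ k *\<^sub>R axis k 1)" using vec_expand[of u] by simp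
  then show ?thesis
    by (simp only: linear_sum[OF linear_Dtrans[OF assms]] linear_scale[OF linear_Dtrans[OF assms]])
qed

lemma C1_curve_onI:
  assumes ab: "a < b" and c: "c \<in> A" and \<gamma>: "continuous_on {a..b} \<gamma>" "\<And>t. t \<in> {a..b} \<Longrightarrow> \<gamma> t \<in> fst c"
    and d: "\<And>t. t \<in> {a..b} \<Longrightarrow> ((snd c \<circ> \<gamma>) has_vector_derivative u t) (at t within {a..b})"
    and u: "continuous_on {a..b} u"
  shows "C1_curve_on A {a..b} \<gamma>"
  unfolding C1_curve_on_def
proof (intro conjI ballI \<gamma>(1))
  fix c' t assume c': "c' \<in> A" and t: "t \<in> {t \<in> {a..b}. \<gamma> t \<in> fst c'}"
  then have "((snd c' \<circ> \<gamma>) has_vector_derivative change_of_chart c c' (\<gamma> t) (u t)) (at t within {a..b})"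
    using curve_change_of_chart[OF c c' \<gamma>(1) _ \<gamma>(2) _ d, of t] by blast
  then show "(snd c' \<circ> \<gamma>) differentiable (at t within {a..b})" by (rule differentiableI_vector)
next
  fix c' assume c': "c' \<in> A"
  let ?I = "{t \<in> {a..b}. \<gamma> t \<in> fst c'}"
  have ov: "snd c (\<gamma> t) \<in> overlap c c'" if "t \<in> ?I" for t using that \<gamma>(2) by (auto intro: in_overlap)
  have X: "continuous_on ?I (\<lambda>t. snd c (\<gamma> t))"
    by (rule continuous_on_compose2[OF continuous_chart[OF c] continuous_on_subset[OF \<gamma>(1)]]) (use \<gamma>(2) in auto)
  have "continuous_on ?I (\<lambda>t. \<Sum>k\<in>UNIV. u t $ k *\<^sub>R Dtrans c c' (snd c (\<gamma> t)) (axis k 1))"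
    by (intro continuous_intros continuous_on_compose2[OF Dtrans_continuous[OF c c'] X]
        continuous_on_subset[OF u]) (use ov in auto)
  then have "continuous_on ?I (\<lambda>t. Dtrans c c' (snd c (\<gamma> t)) (u t))"
    by (rule continuous_on_eq) (use Dtrans_expand[OF c c' ov] in auto)
  then show "continuous_on ?I (\<lambda>t. velocity A {a..b} \<gamma> t c')"
    by (rule continuous_on_eq)
       (use velocity_tvec[OF ab _ \<gamma>(1) c \<gamma>(2) d] c' in \<open>auto simp: tvec_at change_of_chart_Dtrans\<close>)
qed

end

section \<open>The metric in charts\<close>

lemma matrix_expand: "(M :: real^'n^'m) = (\<Sum>i\<in>UNIV. \<Sum>j\<in>UNIV. (M $ i $ j) *\<^sub>R axis i (axis j 1))"
proof -
  have "(\<Sum>i\<in>UNIV. \<Sum>j\<in>UNIV. (M $ i $ j) *\<^sub>R axis i (axis j 1)) $ k $ l = M $ k $ l" for k l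
  proof -
    have "(\<Sum>i\<in>UNIV. \<Sum>j\<in>UNIV. (M $ i $ j) *\<^sub>R axis i (axis j 1)) $ k $ l
        = (\<Sum>i\<in>UNIV. \<Sum>j\<in>UNIV. if i = k \<and> j = l then M $ i $ j else 0)"
      by (simp add: sum_component, intro sum.cong refl) (auto simp: axis_def)
    also have "\<dots> = (\<Sum>i\<in>UNIV. if i = k then M $ i $ l else 0)"
      by (intro sum.cong refl) (auto simp: sum.delta cong: if_cong)
    also have "\<dots> = M $ k $ l" by simp
    finally show ?thesis .
  qed
  then show ?thesis by (simp add: vec_eq_iff)
qed

lemma mform_entries: "mform M u w = (\<Sum>i\<in>UNIV. \<Sum>j\<in>UNIV. u $ i * (w $ j * M $ i $ j))"
  by (simp add: mform_def inner_vec_def matrix_vector_mult_def sum_distrib_left mult_ac)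

locale lorentz_manifold = atlas A for A :: "('a::t2_space, 'n::finite) chart set" +
  fixes g :: "('a, 'n) metric" and T :: "'a \<Rightarrow> ('a, 'n) tvector"
  assumes metric: "C11_lorentzian_metric A g" and orient: "time_orientation A g T"
begin

abbreviation G :: "('a, 'n) chart \<Rightarrow> real^'n \<Rightarrow> real^'n^'n" where "G \<equiv> metric_comp A g"

definition DG :: "('a, 'n) chart \<Rightarrow> real^'n \<Rightarrow> real^'n \<Rightarrow> real^'n^'n" where
  "DG c x w = (\<chi> i j. frechet_derivative (\<lambda>y. G c y $ i $ j) (at x) w)"

lemma metric_in_chart:
  assumes c: "c \<in> A" "q \<in> fst c"
  shows "g q (tvec A c q u) (tvec A c q w) = mform (G c (snd c q)) u w"
proof -
  define B where "B u w = g q (tvec A c q u) (tvec A c q w)" for u w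
  have "bilinear B" using metric c unfolding C11_lorentzian_metric_def B_def by blast
  then have l: "linear (\<lambda>u. B u w)" and r: "linear (B u)" for u w by (auto simp: bilinear_def)
  have "B u w = B (\<Sum>i\<in>UNIV. u $ i *\<^sub>R axis i 1) w" using vec_expand[of u] by simp
  also have "\<dots> = (\<Sum>i\<in>UNIV. u $ i * B (axis i 1) w)"
    by (simp only: linear_sum[OF l] linear_scale[OF l] real_scaleR_def)
  also have "\<dots> = (\<Sum>i\<in>UNIV. u $ i * B (axis i 1) (\<Sum>j\<in>UNIV. w $ j *\<^sub>R axis j 1))"
    using vec_expand[of w] by simp
  also have "\<dots> = (\<Sum>i\<in>UNIV. u $ i * (\<Sum>j\<in>UNIV. w $ j * B (axis i 1) (axis j 1)))"
    by (simp only: linear_sum[OF r] linear_scale[OF r] real_scaleR_def)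
  finally show ?thesis
    using chart_inv_chart[OF c]
    by (simp add: B_def mform_entries metric_comp_def sum_distrib_left)
qed

lemma metric_tangent:
  assumes "c \<in> A" "q \<in> fst c" "v \<in> tangent_space A q" "w \<in> tangent_space A q"
  shows "g q v w = mform (G c (snd c q)) (v c) (w c)"
  using metric_in_chart[OF assms(1,2), of "v c" "w c"] assms by (simp add: tvec_of_tangent)

lemma metric_change_of_chart:
  assumes "c \<in> A" "c' \<in> A" "x \<in> overlap c c'"
  shows "mform (G c x) u w = mform (G c' (trans c c' x)) (Dtrans c c' x u) (Dtrans c c' x w)"
proof -
  obtain q where q: "q \<in> fst c" "q \<in> fst c'" "x = snd c q" using assms by (auto simp: overlap_def)
  show ?thesis
    using metric_in_chart[OF assms(1) q(1), of u w]
      metric_in_chart[OF assms(2) q(2), of "change_of_chart c c' q u" "change_of_chart c c' q w"]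
    by (simp add: tvec_change assms q trans_chart change_of_chart_Dtrans[symmetric])
qed

lemma lorentz_matrix_metric:
  assumes c: "c \<in> A" "x \<in> snd c ` fst c"
  shows "lorentz_matrix (G c x)"
proof -
  obtain q where q: "q \<in> fst c" "x = snd c q" using c by blast
  obtain e :: "'n \<Rightarrow> ('a, 'n) tvector" and k where e: "\<And>i. e i \<in> tangent_space A q"
      "\<And>i j. g q (e i) (e j) = (if i = j then (if i = k then -1 else 1) else 0)"
    using metric unfolding C11_lorentzian_metric_def by metis
  have "mform (G c x) u v = mform (G c x) v u" for u v
  proof -
    have "g q (tvec A c q u) (tvec A c q v) = g q (tvec A c q v) (tvec A c q u)"
      using metric tvec_in_tangent_space[OF c(1) q(1)] unfolding C11_lorentzian_metric_def by blast
    then show ?thesis using metric_in_chart[OF c(1) q(1)] q(2) by simp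
  qed
  moreover have "mform (G c x) (e i c) (e j c) = (if i = j then (if i = k then -1 else 1) else 0)" for i j
    using metric_tangent[OF c(1) q(1) e(1)[of i] e(1)[of j]] e(2)[of i j] q(2) by simp
  ultimately show ?thesis
    unfolding lorentz_matrix_def by (intro conjI allI exI[of _ "\<lambda>i. e i c"] exI[of _ k])
qed

lemma Ck1_on_entry:
  assumes "c \<in> A"
  shows "Ck1_on (Suc 0) (snd c ` fst c) (\<lambda>x. G c x $ i $ j)"
  using metric assms unfolding C11_lorentzian_metric_def One_nat_def[symmetric] by blast

lemma metric_derivative:
  assumes c: "c \<in> A" "x \<in> snd c ` fst c"
  shows "(G c has_derivative DG c x) (at x)"
proof -
  have e: "((\<lambda>y. G c y $ i $ j) has_derivative (\<lambda>w. DG c x w $ i $ j)) (at x)" for i j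
    using Ck1_on_SucD(1)[OF Ck1_on_entry[OF c(1)] c(2)] by (simp add: DG_def)
  have d: "((\<lambda>y. \<Sum>i\<in>UNIV. \<Sum>j\<in>UNIV. (G c y $ i $ j) *\<^sub>R axis i (axis j (1::real))) has_derivative
      (\<lambda>w. \<Sum>i\<in>UNIV. \<Sum>j\<in>UNIV. (DG c x w $ i $ j) *\<^sub>R axis i (axis j (1::real)))) (at x)"
    by (intro has_derivative_sum has_derivative_scaleR_left e)
  have G: "(\<lambda>y. \<Sum>i\<in>UNIV. \<Sum>j\<in>UNIV. (G c y $ i $ j) *\<^sub>R axis i (axis j (1::real))) = G c"
    by (intro ext matrix_expand[symmetric])
  have D: "(\<lambda>w. \<Sum>i\<in>UNIV. \<Sum>j\<in>UNIV. (DG c x w $ i $ j) *\<^sub>R axis i (axis j (1::real))) = DG c x"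
    by (intro ext matrix_expand[symmetric])
  show ?thesis using d unfolding G D .
qed

lemma lip_near_DG:
  assumes c: "c \<in> A" "x \<in> snd c ` fst c"
  shows "lip_near (\<lambda>y. DG c y w) x"
  unfolding DG_def
  by (intro lip_near_vec lip_near_Ck1_on[OF open_image[OF c(1)] c(2) Ck1_on_SucD(2)[OF Ck1_on_entry[OF c(1)]]])

lemma DG_expand:
  assumes c: "c \<in> A" "x \<in> snd c ` fst c"
  shows "DG c x u $ i $ j = (\<Sum>k\<in>UNIV. u $ k * DG c x (axis k 1) $ i $ j)"
proof -
  have lin: "linear (DG c x)" by (rule has_derivative_linear[OF metric_derivative[OF c]])
  have "DG c x u = DG c x (\<Sum>k\<in>UNIV. u $ k *\<^sub>R axis k 1)" using vec_expand[of u] by simp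
  also have "\<dots> = (\<Sum>k\<in>UNIV. u $ k *\<^sub>R DG c x (axis k 1))"
    by (simp only: linear_sum[OF lin] linear_scale[OF lin])
  finally show ?thesis by (simp add: sum_component)
qed

definition spray :: "('a, 'n) chart \<Rightarrow> real^'n \<Rightarrow> real^'n \<Rightarrow> real^'n" where
  "spray c x u = (\<chi> k. - (\<Sum>i\<in>UNIV. \<Sum>j\<in>UNIV. christoffel A g c x k i j * u $ i * u $ j))"

lemma christoffel_DG:
  "christoffel A g c x k i j = 1/2 * (\<Sum>l\<in>UNIV. matrix_inv (G c x) $ k $ l *
     (DG c x (axis i 1) $ j $ l + DG c x (axis j 1) $ i $ l - DG c x (axis l 1) $ i $ j))"
  by (simp add: christoffel_def partial_deriv_def DG_def Let_def)

lemma spray_bound_near: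
  assumes c: "c \<in> A" "x \<in> snd c ` fst c"
  shows "\<exists>r>0. \<exists>K. spray_bound (spray c) (cball x r) K"
proof -
  have DGe: "lip_near (\<lambda>y. DG c y w $ i $ j) x" for w i j
    using lip_near_Ck1_on[OF open_image[OF c(1)] c(2) Ck1_on_SucD(2)[OF Ck1_on_entry[OF c(1)]]]
    by (simp add: DG_def)
  have "lip_near (G c) x"
    by (rule lip_near_C11[OF open_image[OF c(1)] c(2) metric_derivative[OF c(1)] lip_near_DG[OF c]])
  then have inv: "lip_near (\<lambda>y. matrix_inv (G c y) $ k $ l) x" for k l
    by (rule lip_near_matrix_inv) (rule lorentz_matrix_invertible[OF lorentz_matrix_metric[OF c]])
  have "lip_near (\<lambda>y. christoffel A g c y k i j) x" for k i j
    unfolding christoffel_DG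
    by (intro lip_near_mult lip_near_const lip_near_sum inv lip_near_diff lip_near_add DGe)
  then have "lip_near (\<lambda>y. \<chi> k. - christoffel A g c y k i j) x" for i j
    by (intro lip_near_vec lip_near_minus)
  from spray_bound_of_coefficients[OF this]
  have "\<exists>r>0. \<exists>K. spray_bound (\<lambda>y u. \<Sum>i\<in>UNIV. \<Sum>j\<in>UNIV.
      (u $ i * u $ j) *\<^sub>R (\<chi> k. - christoffel A g c y k i j)) (cball x r) K" .
  moreover have "(\<lambda>y u. \<Sum>i\<in>UNIV. \<Sum>j\<in>UNIV. (u $ i * u $ j) *\<^sub>R (\<chi> k. - christoffel A g c y k i j)) = spray c"
    by (intro ext) (simp add: vec_eq_iff spray_def sum_component sum_negf mult_ac)
  ultimately show ?thesis by simp
qed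

text \<open>The Christoffel symbols with lowered index. In this form the inverse of the metric has disappeared.\<close>

lemma spray_euler_lagrange:
  assumes c: "c \<in> A" "x \<in> snd c ` fst c"
  shows "mform (G c x) (spray c x u) w = 1/2 * mform (DG c x w) u u - mform (DG c x u) u w"
proof -
  define P where "P i j l = DG c x (axis i 1) $ j $ l" for i j l
  define q :: "real^'n" where
    "q = (\<chi> l. \<Sum>i\<in>UNIV. \<Sum>j\<in>UNIV. 1/2 * (P i j l + P j i l - P l i j) * u $ i * u $ j)"
  have lor: "lorentz_matrix (G c x)" by (rule lorentz_matrix_metric[OF c])
  have sp: "spray c x u = - (matrix_inv (G c x) *v q)"
  proof -
    have "(\<Sum>i\<in>UNIV. \<Sum>j\<in>UNIV. christoffel A g c x k i j * u $ i * u $ j)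
        = (\<Sum>l\<in>UNIV. matrix_inv (G c x) $ k $ l * q $ l)" for k
    proof -
      have "(\<Sum>i\<in>UNIV. \<Sum>j\<in>UNIV. christoffel A g c x k i j * u $ i * u $ j) =
        (\<Sum>i\<in>UNIV. \<Sum>j\<in>UNIV. \<Sum>l\<in>UNIV. matrix_inv (G c x) $ k $ l *
          (1/2 * (P i j l + P j i l - P l i j) * u $ i * u $ j))"
        by (simp add: christoffel_DG P_def sum_distrib_left sum_distrib_right mult_ac)
      also have "\<dots> = (\<Sum>i\<in>UNIV. \<Sum>l\<in>UNIV. \<Sum>j\<in>UNIV. matrix_inv (G c x) $ k $ l *
          (1/2 * (P i j l + P j i l - P l i j) * u $ i * u $ j))"
        by (intro sum.cong refl sum.swap)
      also have "\<dots> = (\<Sum>l\<in>UNIV. \<Sum>i\<in>UNIV. \<Sum>j\<in>UNIV. matrix_inv (G c x) $ k $ l *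
          (1/2 * (P i j l + P j i l - P l i j) * u $ i * u $ j))"
        by (rule sum.swap)
      finally show ?thesis by (simp add: q_def sum_distrib_left)
    qed
    then show ?thesis by (simp add: vec_eq_iff spray_def matrix_vector_mult_def)
  qed
  have "mform (G c x) (spray c x u) w = mform (G c x) w (spray c x u)"
    using lor by (simp add: lorentz_matrix_def)
  also have "\<dots> = - (w \<bullet> q)"
    unfolding sp mform_simps
    by (simp add: mform_def matrix_inv_works(1)[OF lorentz_matrix_invertible[OF lor]])
  also have "w \<bullet> q = (\<Sum>l\<in>UNIV. \<Sum>i\<in>UNIV. \<Sum>j\<in>UNIV. 1/2 * (w $ l * P i j l * u $ i * u $ j)
      + 1/2 * (w $ l * P j i l * u $ j * u $ i) - 1/2 * (w $ l * P l i j * u $ i * u $ j))"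
    by (simp add: inner_vec_def q_def sum_distrib_left) (intro sum.cong refl; simp add: algebra_simps add_divide_distrib diff_divide_distrib)
  also have "\<dots> = 1/2 * (\<Sum>l\<in>UNIV. \<Sum>i\<in>UNIV. \<Sum>j\<in>UNIV. w $ l * P i j l * u $ i * u $ j)
      + 1/2 * (\<Sum>l\<in>UNIV. \<Sum>i\<in>UNIV. \<Sum>j\<in>UNIV. w $ l * P j i l * u $ j * u $ i)
      - 1/2 * (\<Sum>l\<in>UNIV. \<Sum>i\<in>UNIV. \<Sum>j\<in>UNIV. w $ l * P l i j * u $ i * u $ j)"
    by (simp only: sum.distrib sum_subtractf sum_distrib_left)
  also have "(\<Sum>l\<in>UNIV. \<Sum>i\<in>UNIV. \<Sum>j\<in>UNIV. w $ l * P j i l * u $ j * u $ i)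
      = (\<Sum>l\<in>UNIV. \<Sum>i\<in>UNIV. \<Sum>j\<in>UNIV. w $ l * P i j l * u $ i * u $ j)"
    by (intro sum.cong refl sum.swap)
  also have "(\<Sum>l\<in>UNIV. \<Sum>i\<in>UNIV. \<Sum>j\<in>UNIV. w $ l * P i j l * u $ i * u $ j) = mform (DG c x u) u w"
  proof -
    have "mform (DG c x u) u w = (\<Sum>j\<in>UNIV. \<Sum>l\<in>UNIV. \<Sum>i\<in>UNIV. w $ l * P i j l * u $ i * u $ j)"
      by (simp add: mform_entries DG_expand[OF c, of u] P_def sum_distrib_left mult_ac)
    also have "\<dots> = (\<Sum>l\<in>UNIV. \<Sum>j\<in>UNIV. \<Sum>i\<in>UNIV. w $ l * P i j l * u $ i * u $ j)" by (rule sum.swap)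
    also have "\<dots> = (\<Sum>l\<in>UNIV. \<Sum>i\<in>UNIV. \<Sum>j\<in>UNIV. w $ l * P i j l * u $ i * u $ j)"
      by (intro sum.cong refl sum.swap)
    finally show ?thesis ..
  qed
  also have "(\<Sum>l\<in>UNIV. \<Sum>i\<in>UNIV. \<Sum>j\<in>UNIV. w $ l * P l i j * u $ i * u $ j) = mform (DG c x w) u u"
  proof -
    have "mform (DG c x w) u u = (\<Sum>i\<in>UNIV. \<Sum>j\<in>UNIV. \<Sum>l\<in>UNIV. w $ l * P l i j * u $ i * u $ j)"
      by (simp add: mform_entries DG_expand[OF c, of w] P_def sum_distrib_left mult_ac)
    also have "\<dots> = (\<Sum>i\<in>UNIV. \<Sum>l\<in>UNIV. \<Sum>j\<in>UNIV. w $ l * P l i j * u $ i * u $ j)"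
      by (intro sum.cong refl sum.swap)
    also have "\<dots> = (\<Sum>l\<in>UNIV. \<Sum>i\<in>UNIV. \<Sum>j\<in>UNIV. w $ l * P l i j * u $ i * u $ j)" by (rule sum.swap)
    finally show ?thesis ..
  qed
  finally show ?thesis by simp
qed

subsection \<open>Change of charts and uniqueness of geodesics\<close>

text \<open>Differentiate \<open>metric_change_of_chart\<close> along the line through \<open>x\<close> in the direction \<open>w\<close>.\<close>

lemma metric_change_of_chart_derivative:
  assumes c: "c \<in> A" "c' \<in> A" and x: "x \<in> overlap c c'"
  shows "mform (DG c x w) u v = mform (DG c' (trans c c' x) (Dtrans c c' x w)) (Dtrans c c' x u) (Dtrans c c' x v)
    + mform (G c' (trans c c' x)) (D2trans c c' u x w) (Dtrans c c' x v)
    + mform (G c' (trans c c' x)) (Dtrans c c' x u) (D2trans c c' v x w)"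
proof -
  define l where "l s = x + s *\<^sub>R w" for s
  have l0: "l 0 = x" by (simp add: l_def)
  have dl: "(l has_vector_derivative w) (at 0)"
    unfolding l_def by (auto intro!: derivative_eq_intros)
  have img: "x \<in> snd c ` fst c" "trans c c' x \<in> snd c' ` fst c'"
    using x chart_inv_chart[OF c(1)] by (auto simp: overlap_def trans_def)
  have chain: "((\<lambda>s. f (l s)) has_vector_derivative f' w) (at 0)"
    if "(f has_derivative f') (at x)" for f :: "real^'n \<Rightarrow> 'b::real_normed_vector" and f'
    using vector_derivative_diff_chain_within[OF dl, of f f'] that
    by (simp add: o_def l0 has_derivative_at_withinI)
  have chainG: "((\<lambda>s. G c' (trans c c' (l s))) has_vector_derivative
      DG c' (trans c c' x) (Dtrans c c' x w)) (at 0)"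
    using chain[OF diff_chain_at[OF trans_derivative[OF c x] metric_derivative[OF c(2) img(2)]]]
    by (simp add: o_def)
  have 1: "((\<lambda>s. mform (G c (l s)) u v) has_real_derivative mform (DG c x w) u v) (at 0)"
    using mform_has_real_derivative[OF chain[OF metric_derivative[OF c(1) img(1)]]
        has_vector_derivative_const[of u] has_vector_derivative_const[of v]]
    by (simp add: mform_simps)
  have 2: "((\<lambda>s. mform (G c' (trans c c' (l s))) (Dtrans c c' (l s) u) (Dtrans c c' (l s) v))
      has_real_derivative
      mform (DG c' (trans c c' x) (Dtrans c c' x w)) (Dtrans c c' x u) (Dtrans c c' x v)
    + mform (G c' (trans c c' x)) (D2trans c c' u x w) (Dtrans c c' x v)
    + mform (G c' (trans c c' x)) (Dtrans c c' x u) (D2trans c c' v x w)) (at 0)"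
    using mform_has_real_derivative[OF chainG chain[OF Dtrans_derivative[OF c x]]
        chain[OF Dtrans_derivative[OF c x]], of u v] by (simp add: l0)
  have "open (l -` overlap c c')"
    unfolding l_def by (intro open_vimage open_overlap c continuous_intros)
  from DERIV_unique[OF 1 has_field_derivative_transform_within_open[OF 2 this]]
  show ?thesis using metric_change_of_chart[OF c] x by (simp add: l0)
qed

text \<open>By nondegeneracy it suffices to test with \<open>b = ?D w\<close>. In the Euler--Lagrange form, the terms with
second derivatives of the transition map other than \<open>D2trans c c' u x u\<close> cancel, because \<open>D2trans\<close> is
symmetric in \<open>u\<close> and \<open>w\<close>.\<close>

lemma spray_change_of_chart:
  assumes c: "c \<in> A" "c' \<in> A" and x: "x \<in> overlap c c'"
  shows "spray c' (trans c c' x) (Dtrans c c' x u) = Dtrans c c' x (spray c x u) + D2trans c c' u x u"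
proof -
  let ?y = "trans c c' x" and ?D = "Dtrans c c' x" and ?D2 = "\<lambda>v w. D2trans c c' v x w"
  obtain q where q: "q \<in> fst c" "q \<in> fst c'" "x = snd c q" using x by (auto simp: overlap_def)
  have img: "x \<in> snd c ` fst c" "?y \<in> snd c' ` fst c'" using q c by (auto simp: trans_chart)
  have lor: "lorentz_matrix (G c' ?y)" by (rule lorentz_matrix_metric[OF c(2) img(2)])
  have "mform (G c' ?y) (?D (spray c x u) + ?D2 u u - spray c' ?y (?D u)) b = 0" for b
  proof -
    define w where "w = change_of_chart c' c q b"
    have b: "?D w = b"
      using change_cocycle[OF c(2,1,2) q(2,1,2), of b] change_id[OF c(2) q(2), of b] q(3)
      by (simp add: w_def change_of_chart_Dtrans)
    have "mform (G c' ?y) (?D (spray c x u)) b = mform (G c x) (spray c x u) w"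
      using metric_change_of_chart[OF c x] b by simp
    also have "\<dots> = 1/2 * mform (DG c x w) u u - mform (DG c x u) u w"
      by (rule spray_euler_lagrange[OF c(1) img(1)])
    also have "\<dots> = 1/2 * mform (DG c' ?y b) (?D u) (?D u) - mform (DG c' ?y (?D u)) (?D u) b
        - mform (G c' ?y) (?D2 u u) b"
    proof -
      have sym: "mform (G c' ?y) (?D2 u w) (?D u) = mform (G c' ?y) (?D u) (?D2 u w)"
        using lor by (simp add: lorentz_matrix_def)
      have "1/2 * mform (DG c x w) u u = 1/2 * mform (DG c' ?y b) (?D u) (?D u) + mform (G c' ?y) (?D u) (?D2 u w)"
        unfolding metric_change_of_chart_derivative[OF c x, of w u u] b sym by simp
      moreover have "mform (DG c x u) u w = mform (DG c' ?y (?D u)) (?D u) b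
          + mform (G c' ?y) (?D2 u u) b + mform (G c' ?y) (?D u) (?D2 u w)"
        unfolding metric_change_of_chart_derivative[OF c x, of u u w] b
        by (simp add: D2trans_symmetric[OF c x, of w u])
      ultimately show ?thesis by linarith
    qed
    also have "\<dots> = mform (G c' ?y) (spray c' ?y (?D u)) b - mform (G c' ?y) (?D2 u u) b"
      by (simp add: spray_euler_lagrange[OF c(2) img(2)])
    finally show ?thesis by (simp add: mform_simps)
  qed
  from lorentz_matrix_nondegenerate[OF lor this] show ?thesis by simp
qed

lemma spray_solution_of_geodesic:
  assumes \<gamma>: "geodesic_solution A g {0..1} \<gamma>" and c: "c \<in> A" and J: "J \<subseteq> {0..1}"
    and in_c: "\<And>t. t \<in> J \<Longrightarrow> \<gamma> t \<in> fst c"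
  shows "spray_solution (spray c) J (\<lambda>t. snd c (\<gamma> t)) (\<lambda>t. velocity A {0..1} \<gamma> t c)"
  unfolding spray_solution_def
proof (intro ballI conjI)
  fix t assume t: "t \<in> J"
  have d: "(snd c \<circ> \<gamma>) differentiable (at t within {0..1})"
    and d': "((\<lambda>s. velocity A {0..1} \<gamma> s c) has_vector_derivative
        spray c (snd c (\<gamma> t)) (velocity A {0..1} \<gamma> t c)) (at t within {0..1})"
    using \<gamma> c in_c[OF t] t J unfolding geodesic_solution_def spray_def by auto
  have "((snd c \<circ> \<gamma>) has_vector_derivative velocity A {0..1} \<gamma> t c) (at t within {0..1})"
    by (rule velocity_chart[OF c in_c[OF t] d])
  then show "((\<lambda>t. snd c (\<gamma> t)) has_vector_derivative velocity A {0..1} \<gamma> t c) (at t within J)"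
    using J by (auto simp: o_def intro: has_vector_derivative_within_subset)
  show "((\<lambda>s. velocity A {0..1} \<gamma> s c) has_vector_derivative
        spray c (snd c (\<gamma> t)) (velocity A {0..1} \<gamma> t c)) (at t within J)"
    using d' J by (rule has_vector_derivative_within_subset)
qed

text \<open>A solution in one chart satisfies the geodesic equation in every chart that it meets, since
differentiating its velocity in the other chart produces the right-hand side of
\<open>spray_change_of_chart\<close>.\<close>

lemma geodesic_of_spray_solution:
  assumes c: "c \<in> A" and \<gamma>: "continuous_on {0..1} \<gamma>" and in_c: "\<And>t. t \<in> {0..1} \<Longrightarrow> \<gamma> t \<in> fst c"
    and X: "spray_solution (spray c) {0..1} (\<lambda>t. snd c (\<gamma> t)) U"
  shows "geodesic_solution A g {0..1} \<gamma>"
    and "\<And>t. t \<in> {0..1} \<Longrightarrow> velocity A {0..1} \<gamma> t = tvec A c (\<gamma> t) (U t)"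
proof -
  have dX: "((snd c \<circ> \<gamma>) has_vector_derivative U t) (at t within {0..1})"
    and dU: "(U has_vector_derivative spray c (snd c (\<gamma> t)) (U t)) (at t within {0..1})" if "t \<in> {0..1}" for t
    using X that by (auto simp: spray_solution_def o_def)
  show vel: "velocity A {0..1} \<gamma> t = tvec A c (\<gamma> t) (U t)" if "t \<in> {0..1}" for t
    by (rule velocity_tvec[OF _ that \<gamma> c in_c[OF that] dX[OF that]]) simp
  have vel': "velocity A {0..1} \<gamma> t c' = Dtrans c c' (snd c (\<gamma> t)) (U t)"
    if "t \<in> {0..1}" "c' \<in> A" "\<gamma> t \<in> fst c'" for t c'
    using vel[OF that(1)] that by (simp add: tvec_at change_of_chart_Dtrans)
  show "geodesic_solution A g {0..1} \<gamma>"
    unfolding geodesic_solution_def spray_def[symmetric]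
  proof (intro conjI ballI impI \<gamma>)
    fix c' and t :: real assume c': "c' \<in> A" and t: "t \<in> {0..1}" and t': "\<gamma> t \<in> fst c'"
    let ?x = "snd c (\<gamma> t)"
    have ov: "?x \<in> overlap c c'" using in_c[OF t] t' by (rule in_overlap)
    show "(snd c' \<circ> \<gamma>) differentiable (at t within {0..1})"
      using curve_change_of_chart[OF c c' \<gamma> t in_c[OF t] t' dX[OF t]] by (rule differentiableI_vector)
    have comp: "((\<lambda>s. Dtrans c c' (snd c (\<gamma> s)) v) has_vector_derivative D2trans c c' v ?x (U t)) (at t within {0..1})" for v
      using vector_derivative_diff_chain_within[OF dX[OF t], of "\<lambda>y. Dtrans c c' y v"]
        Dtrans_derivative[OF c c' ov] by (simp add: o_def has_derivative_at_withinI)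
    have dUk: "((\<lambda>s. U s $ k) has_vector_derivative spray c ?x (U t) $ k) (at t within {0..1})" for k
      using bounded_linear.has_vector_derivative[OF bounded_linear_vec_nth dU[OF t]] .
    have sum: "((\<lambda>s. \<Sum>k\<in>UNIV. U s $ k *\<^sub>R Dtrans c c' (snd c (\<gamma> s)) (axis k 1)) has_vector_derivative
      (\<Sum>k\<in>UNIV. U t $ k *\<^sub>R D2trans c c' (axis k 1) ?x (U t)
        + spray c ?x (U t) $ k *\<^sub>R Dtrans c c' ?x (axis k 1))) (at t within {0..1})"
      by (intro has_vector_derivative_sum
          bounded_bilinear.has_vector_derivative[OF bounded_bilinear_scaleR] dUk comp)
    have "(\<Sum>k\<in>UNIV. U t $ k *\<^sub>R D2trans c c' (axis k 1) ?x (U t)) = D2trans c c' (U t) ?x (U t)"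
    proof -
      have "(\<Sum>k\<in>UNIV. U t $ k *\<^sub>R D2trans c c' (axis k 1) ?x (U t))
          = (\<Sum>k\<in>UNIV. U t $ k *\<^sub>R D2trans c c' (U t) ?x (axis k 1))"
        by (intro sum.cong refl arg_cong2[where f = "(*\<^sub>R)"] D2trans_symmetric c c' ov)
      also have "\<dots> = D2trans c c' (U t) ?x (\<Sum>k\<in>UNIV. U t $ k *\<^sub>R axis k 1)"
        by (simp only: linear_sum[OF linear_D2trans[OF c c' ov]] linear_scale[OF linear_D2trans[OF c c' ov]])
      finally show ?thesis using vec_expand[of "U t"] by simp
    qed
    moreover have "(\<Sum>k\<in>UNIV. spray c ?x (U t) $ k *\<^sub>R Dtrans c c' ?x (axis k 1)) = Dtrans c c' ?x (spray c ?x (U t))"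
      by (rule Dtrans_expand[OF c c' ov, symmetric])
    ultimately have "((\<lambda>s. \<Sum>k\<in>UNIV. U s $ k *\<^sub>R Dtrans c c' (snd c (\<gamma> s)) (axis k 1)) has_vector_derivative
      spray c' (trans c c' ?x) (Dtrans c c' ?x (U t))) (at t within {0..1})"
      using sum spray_change_of_chart[OF c c' ov, of "U t"] by (simp add: sum.distrib add.commute)
    moreover obtain e where e: "0 < e" "\<And>s. s \<in> {0..1} \<Longrightarrow> dist s t < e \<Longrightarrow> \<gamma> s \<in> fst c'"
      using near_in_open[OF \<gamma> t open_domain[OF c'] t'] by blast
    have "(\<Sum>k\<in>UNIV. U s $ k *\<^sub>R Dtrans c c' (snd c (\<gamma> s)) (axis k 1)) = velocity A {0..1} \<gamma> s c'"
      if "s \<in> {0..1}" "dist s t < e" for s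
      using vel'[OF that(1) c' e(2)[OF that]]
        Dtrans_expand[OF c c' in_overlap[OF in_c[OF that(1)] e(2)[OF that]], of "U s"] by (simp only:)
    ultimately have "((\<lambda>s. velocity A {0..1} \<gamma> s c') has_vector_derivative
      spray c' (trans c c' ?x) (Dtrans c c' ?x (U t))) (at t within {0..1})"
      using e(1) t by (blast intro: has_vector_derivative_transform_within)
    then show "((\<lambda>s. velocity A {0..1} \<gamma> s c') has_vector_derivative
      spray c' (snd c' (\<gamma> t)) (velocity A {0..1} \<gamma> t c')) (at t within {0..1})"
      by (simp add: vel'[OF t c' t'] trans_chart[OF c in_c[OF t]])
  qed
qed

text \<open>Local uniqueness in a chart excludes an infimum of the parameters at which the two curves differ; the
Hausdorff property and the one-sided derivatives show that position and velocity still agree there.\<close>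

lemma geodesic_solution_unique:
  assumes \<gamma>1: "geodesic_solution A g {0..1} \<gamma>1" and \<gamma>2: "geodesic_solution A g {0..1} \<gamma>2"
    and init: "\<gamma>1 0 = \<gamma>2 0" "velocity A {0..1} \<gamma>1 0 = velocity A {0..1} \<gamma>2 0" and t: "t \<in> {0..1}"
  shows "\<gamma>1 t = \<gamma>2 t"
proof (rule ccontr)
  assume ne: "\<gamma>1 t \<noteq> \<gamma>2 t"
  have cont: "continuous_on {0..1} \<gamma>1" "continuous_on {0..1} \<gamma>2"
    using \<gamma>1 \<gamma>2 by (auto simp: geodesic_solution_def)
  define E where "E = {s \<in> {0..1}. \<gamma>1 s \<noteq> \<gamma>2 s}"
  define u where "u = Inf E"
  have tE: "t \<in> E" using t ne by (simp add: E_def)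
  have bdd: "bdd_below E" by (auto simp: E_def)
  have lower: "u \<le> s" if "s \<in> E" for s unfolding u_def using bdd that by (intro cInf_lower)
  have "0 \<le> u" unfolding u_def using tE by (intro cInf_greatest) (auto simp: E_def)
  moreover have "u \<le> t" using lower[OF tE] .
  ultimately have u01: "u \<in> {0..1}" using t by auto
  have before: "\<gamma>1 s = \<gamma>2 s" if "s \<in> {0..1}" "s < u" for s
    using lower[of s] that by (auto simp: E_def)
  have eq_u: "\<gamma>1 u = \<gamma>2 u"
  proof (rule ccontr)
    assume "\<gamma>1 u \<noteq> \<gamma>2 u"
    then obtain V W where VW: "open V" "open W" "\<gamma>1 u \<in> V" "\<gamma>2 u \<in> W" "V \<inter> W = {}"
      using hausdorff by metis
    obtain d1 where d1: "0 < d1" "\<And>s. s \<in> {0..1} \<Longrightarrow> dist s u < d1 \<Longrightarrow> \<gamma>1 s \<in> V"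
      using near_in_open[OF cont(1) u01 VW(1,3)] by blast
    obtain d2 where d2: "0 < d2" "\<And>s. s \<in> {0..1} \<Longrightarrow> dist s u < d2 \<Longrightarrow> \<gamma>2 s \<in> W"
      using near_in_open[OF cont(2) u01 VW(2,4)] by blast
    have "u \<noteq> 0" using \<open>\<gamma>1 u \<noteq> \<gamma>2 u\<close> init by auto
    define s where "s = max (u / 2) (u - min d1 d2 / 2)"
    have s: "s \<in> {0..1}" "s < u" "dist s u < d1" "dist s u < d2"
      using u01 \<open>u \<noteq> 0\<close> d1(1) d2(1) by (auto simp: s_def dist_real_def max_def min_def)
    then show False using before[OF s(1,2)] d1(2)[OF s(1,3)] d2(2)[OF s(1,4)] VW(5) by auto
  qed
  have "u \<noteq> t" using eq_u ne by auto
  then have ut: "u < t" using \<open>u \<le> t\<close> by simp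
  obtain c where c: "c \<in> A" "\<gamma>1 u \<in> fst c" using atlas unfolding C21_atlas_def by blast
  have vel_u: "velocity A {0..1} \<gamma>1 u c = velocity A {0..1} \<gamma>2 u c"
  proof (cases "u = 0")
    case False
    then have u0: "0 < u" using u01 by simp
    have d: "((snd c \<circ> \<gamma>) has_vector_derivative velocity A {0..1} \<gamma> u c) (at u within {0..u})"
      if "geodesic_solution A g {0..1} \<gamma>" "\<gamma> u \<in> fst c" for \<gamma>
    proof -
      have "(snd c \<circ> \<gamma>) differentiable (at u within {0..1})"
        using that c(1) u01 by (auto simp: geodesic_solution_def)
      from velocity_chart[OF c(1) that(2) this] show ?thesis
        using u01 by (auto intro: has_vector_derivative_within_subset)
    qed
    have 1: "((snd c \<circ> \<gamma>2) has_vector_derivative velocity A {0..1} \<gamma>1 u c) (at u within {0..u})"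
      by (rule has_vector_derivative_transform[OF _ _ d[OF \<gamma>1 c(2)]])
         (use before eq_u u01 u0 in \<open>auto simp: le_less\<close>)
    have 2: "((snd c \<circ> \<gamma>2) has_vector_derivative velocity A {0..1} \<gamma>2 u c) (at u within {0..u})"
      using d[OF \<gamma>2] c(2) eq_u by simp
    have "u \<in> {0..u}" using u0 by simp
    from vector_derivative_within_closed_interval[OF u0 this 1]
      vector_derivative_within_closed_interval[OF u0 this 2]
    show ?thesis by simp
  qed (simp add: init)
  obtain d1 where d1: "0 < d1" "\<And>s. s \<in> {0..1} \<Longrightarrow> dist s u < d1 \<Longrightarrow> \<gamma>1 s \<in> fst c"
    using near_in_open[OF cont(1) u01 open_domain[OF c(1)] c(2)] by blast
  obtain d2 where d2: "0 < d2" "\<And>s. s \<in> {0..1} \<Longrightarrow> dist s u < d2 \<Longrightarrow> \<gamma>2 s \<in> fst c"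
    using near_in_open[OF cont(2) u01 open_domain[OF c(1)]] c(2) eq_u by auto
  define b where "b = min t (u + min d1 d2 / 2)"
  have b: "u < b" "b \<le> t" and J: "{u..b} \<subseteq> {0..1}"
    using ut d1(1) d2(1) u01 t by (auto simp: b_def)
  have near: "dist s u < d1" "dist s u < d2" if "s \<in> {u..b}" for s
    using d1(1) d2(1) that by (auto simp: b_def dist_real_def min_def split: if_splits)
  have in1: "\<gamma>1 s \<in> fst c" and in2: "\<gamma>2 s \<in> fst c" if "s \<in> {u..b}" for s
    using d1(2) d2(2) near[OF that] J that by blast+
  obtain r K where rK: "0 < r" "spray_bound (spray c) (cball (snd c (\<gamma>1 u)) r) K"
    using spray_bound_near[OF c(1), of "snd c (\<gamma>1 u)"] c(2) by blast
  have "\<exists>e. u < e \<and> e \<le> b \<and> (\<forall>s\<in>{u..e}. snd c (\<gamma>1 s) = snd c (\<gamma>2 s))"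
  proof (rule spray_solution_local_unique[OF rK(2,1) b(1)])
    show "spray_solution (spray c) {u..b} (\<lambda>t. snd c (\<gamma>1 t)) (\<lambda>t. velocity A {0..1} \<gamma>1 t c)"
      by (rule spray_solution_of_geodesic[OF \<gamma>1 c(1) J]) (rule in1)
    show "spray_solution (spray c) {u..b} (\<lambda>t. snd c (\<gamma>2 t)) (\<lambda>t. velocity A {0..1} \<gamma>2 t c)"
      by (rule spray_solution_of_geodesic[OF \<gamma>2 c(1) J]) (rule in2)
  qed (simp_all only: eq_u vel_u)
  then obtain e where e: "u < e" "e \<le> b" "\<And>s. s \<in> {u..e} \<Longrightarrow> snd c (\<gamma>1 s) = snd c (\<gamma>2 s)"
    by blast
  have after: "\<gamma>1 s = \<gamma>2 s" if "s \<in> {u..e}" for s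
  proof -
    have s: "s \<in> {u..b}" using that e(2) by auto
    then show ?thesis
      using arg_cong[OF e(3)[OF that], of "chart_inv c"]
      by (simp only: chart_inv_chart[OF c(1) in1[OF s]] chart_inv_chart[OF c(1) in2[OF s]])
  qed
  have "e \<le> s" if "s \<in> E" for s
  proof (rule ccontr)
    assume "\<not> e \<le> s"
    then show False using after[of s] lower[OF that] that by (auto simp: E_def)
  qed
  then have "e \<le> u" unfolding u_def using tE by (intro cInf_greatest) auto
  then show False using e(1) by simp
qed

lemma geod_exp_eq:
  assumes "solution_with_velocity A g q v \<gamma>"
  shows "geod_exp A g q v = \<gamma> 1"
  unfolding geod_exp_def
proof (rule the_equality)
  show "\<exists>\<gamma>'. solution_with_velocity A g q v \<gamma>' \<and> \<gamma>' 1 = \<gamma> 1" using assms by blast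
  show "y = \<gamma> 1" if ex: "\<exists>\<gamma>'. solution_with_velocity A g q v \<gamma>' \<and> \<gamma>' 1 = y" for y
  proof -
    obtain \<gamma>' where \<gamma>': "solution_with_velocity A g q v \<gamma>'" "\<gamma>' 1 = y" using ex by blast
    have 1: "geodesic_solution A g {0..1} \<gamma>'" "\<gamma>' 0 = q" "velocity A {0..1} \<gamma>' 0 = v"
      using \<gamma>'(1) unfolding solution_with_velocity_def by blast+
    have 2: "geodesic_solution A g {0..1} \<gamma>" "\<gamma> 0 = q" "velocity A {0..1} \<gamma> 0 = v"
      using assms unfolding solution_with_velocity_def by blast+
    have "\<gamma>' 1 = \<gamma> 1"
      by (rule geodesic_solution_unique[OF 1(1) 2(1)]) (simp_all only: 1 2, simp)
    then show ?thesis using \<gamma>'(2) by simp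
  qed
qed

subsection \<open>The time orientation in charts\<close>

definition Tc :: "('a, 'n) chart \<Rightarrow> real^'n \<Rightarrow> real^'n" where
  "Tc c x = T (chart_inv c x) c"

lemma T_tvec: "c \<in> A \<Longrightarrow> q \<in> fst c \<Longrightarrow> T q = tvec A c q (Tc c (snd c q))"
  using orient tvec_of_tangent[of c q "T q"] by (simp add: time_orientation_def Tc_def chart_inv_chart)

lemma Tc_continuous:
  assumes c: "c \<in> A"
  shows "continuous_on (snd c ` fst c) (Tc c)"
proof -
  have "continuous_on (fst c) (\<lambda>q. T q c)" using orient c by (auto simp: time_orientation_def)
  then show ?thesis
    unfolding Tc_def
    by (rule continuous_on_compose2[OF _ continuous_chart_inv[OF c]]) (use chart_inv_in[OF c] in blast)
qed

lemma Tc_timelike: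
  assumes c: "c \<in> A" "x \<in> snd c ` fst c"
  shows "mform (G c x) (Tc c x) (Tc c x) < 0"
proof -
  obtain q where q: "q \<in> fst c" "x = snd c q" using c by blast
  have "g q (T q) (T q) < 0" using orient by (auto simp: time_orientation_def timelike_vector_def)
  then show ?thesis using metric_in_chart[OF c(1) q(1)] T_tvec[OF c(1) q(1)] q(2) by simp
qed

lemma local_lorentz_chart:
  assumes c: "c \<in> A" "z0 \<in> snd c ` fst c"
  shows "\<exists>\<tau> R K m \<rho> r a. cball z0 R \<subseteq> snd c ` fst c \<and>
    local_lorentz (G c) (DG c) (spray c) (Tc c) \<tau> z0 R K m \<rho> r a"
  by (rule local_lorentz_exists[OF open_image[OF c(1)] c(2) metric_derivative[OF c(1)] lip_near_DG[OF c]
        lorentz_matrix_metric[OF c(1)] Tc_continuous[OF c(1)] Tc_timelike[OF c(1)] spray_bound_near[OF c]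
        spray_euler_lagrange[OF c(1)]])

end

section \<open>Lens neighbourhoods\<close>

context lorentz_manifold begin

lemma tvec_scaleR:
  assumes "c \<in> A" "q \<in> fst c"
  shows "tvec A c q (s *\<^sub>R u) = (\<lambda>c'. s *\<^sub>R tvec A c q u c')"
  using linear_scale[OF linear_change[OF assms(1) _ assms(2)]] by (auto simp: tvec_def fun_eq_iff)

lemma tvec_eq_zero_iff:
  assumes "c \<in> A" "q \<in> fst c"
  shows "tvec A c q u = (\<lambda>_. 0) \<longleftrightarrow> u = 0"
proof
  assume "tvec A c q u = (\<lambda>_. 0)"
  then show "u = 0" using tvec_self[OF assms, of u] by simp
next
  assume "u = 0"
  then show "tvec A c q u = (\<lambda>_. 0)" using tvec_scaleR[OF assms, of 0 u] by simp
qed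

context
  fixes c :: "('a, 'n) chart" and \<tau> z0 :: "real^'n" and R K m \<rho> r a :: real
  assumes c: "c \<in> A" and R_sub: "cball z0 R \<subseteq> snd c ` fst c"
    and L: "local_lorentz (G c) (DG c) (spray c) (Tc c) \<tau> z0 R K m \<rho> r a"
begin

interpretation L: local_lorentz "G c" "DG c" "spray c" "Tc c" \<tau> z0 R K m \<rho> r a by (rule L)

lemma r_sub: "cball z0 r \<subseteq> snd c ` fst c"
  using L.ball_subset R_sub by blast

definition patch :: "real \<Rightarrow> 'a set" where
  "patch \<epsilon> = {q \<in> fst c. snd c q \<in> L.lens z0 \<epsilon>}"

definition closed_patch :: "real \<Rightarrow> 'a set" where
  "closed_patch \<epsilon> = {q \<in> fst c. snd c q \<in> L.closed_lens z0 \<epsilon>}"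

lemma open_chart_preimage: "open D \<Longrightarrow> open {q \<in> fst c. snd c q \<in> D}"
  using continuous_open_preimage[OF continuous_chart[OF c] open_domain[OF c], of D]
  by (simp add: vimage_def Int_def)

lemma open_chart_image: "open V \<Longrightarrow> open (snd c ` (fst c \<inter> V))"
proof -
  assume "open V"
  then have "open (snd c ` fst c \<inter> chart_inv c -` V)"
    by (rule continuous_open_preimage[OF continuous_chart_inv[OF c] open_image[OF c]])
  moreover have "snd c ` (fst c \<inter> V) = snd c ` fst c \<inter> chart_inv c -` V"
    using chart_inv_chart[OF c] by auto
  ultimately show ?thesis by simp
qed

context
  fixes \<epsilon> :: real
  assumes \<epsilon>: "0 < \<epsilon>" "\<epsilon> \<le> r\<^sup>2"
begin

lemma lens_ball: "L.lens z0 \<epsilon> \<subseteq> ball z0 r" "L.lens z0 \<epsilon> \<subseteq> cball z0 r" "L.closed_lens z0 \<epsilon> \<subseteq> cball z0 r"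
  using L.lens_subset_ball[OF L.r(1) \<epsilon>(2), of z0] by auto

lemma chart_preimage_image:
  assumes "D \<subseteq> snd c ` fst c"
  shows "{q \<in> fst c. snd c q \<in> D} = chart_inv c ` D"
proof (intro equalityI subsetI)
  fix q assume q: "q \<in> {q \<in> fst c. snd c q \<in> D}"
  then have "q = chart_inv c (snd c q)" using chart_inv_chart[OF c] by simp
  then show "q \<in> chart_inv c ` D" using q by (intro image_eqI) auto
next
  fix q assume "q \<in> chart_inv c ` D"
  then obtain z where z: "z \<in> D" "q = chart_inv c z" by blast
  then have "z \<in> snd c ` fst c" using assms by blast
  then show "q \<in> {q \<in> fst c. snd c q \<in> D}"
    using z chart_inv_in[OF c, of z] chart_chart_inv[OF c, of z] by simp
qed

lemma patch_image: "patch \<epsilon> = chart_inv c ` L.lens z0 \<epsilon>"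
  unfolding patch_def by (rule chart_preimage_image[OF order_trans[OF lens_ball(2) r_sub]])

lemma closed_patch_image: "closed_patch \<epsilon> = chart_inv c ` L.closed_lens z0 \<epsilon>"
  unfolding closed_patch_def by (rule chart_preimage_image[OF order_trans[OF lens_ball(3) r_sub]])

lemma patchD: "q \<in> patch \<epsilon> \<Longrightarrow> q \<in> fst c" "q \<in> patch \<epsilon> \<Longrightarrow> snd c q \<in> L.lens z0 \<epsilon>"
    "q \<in> patch \<epsilon> \<Longrightarrow> snd c q \<in> cball z0 r" "q \<in> patch \<epsilon> \<Longrightarrow> snd c q \<in> ball z0 r"
  using lens_ball by (auto simp: patch_def simp del: mem_ball mem_cball)

lemma patchI: "z \<in> L.lens z0 \<epsilon> \<Longrightarrow> chart_inv c z \<in> patch \<epsilon>"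
  by (simp add: patch_image)

lemma open_patch: "open (patch \<epsilon>)"
  unfolding patch_def by (rule open_chart_preimage[OF L.open_lens])

lemma closure_patch: "closure (patch \<epsilon>) \<subseteq> closed_patch \<epsilon>"
proof -
  have "compact (L.closed_lens z0 \<epsilon>)"
    using L.closed_closed_lens lens_ball(3) by (metis compact_cball compact_Int_closed inf.absorb_iff2)
  moreover have "continuous_on (L.closed_lens z0 \<epsilon>) (chart_inv c)"
    using continuous_chart_inv[OF c] lens_ball(3) r_sub by (meson continuous_on_subset order_trans)
  ultimately have "closed (closed_patch \<epsilon>)"
    unfolding closed_patch_image by (intro compact_imp_closed compact_continuous_image)
  moreover have "patch \<epsilon> \<subseteq> closed_patch \<epsilon>"
    using L.lens_subset_closed_lens unfolding patch_def closed_patch_def by blast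
  ultimately show ?thesis by (rule closure_minimal[rotated])
qed

lemma joins_geodesic:
  assumes J: "L.joins x y X U"
  defines "\<gamma> \<equiv> \<lambda>t. chart_inv c (X t)"
  shows "geodesic_solution A g {0..1} \<gamma>" "\<gamma> 0 = chart_inv c x" "\<gamma> 1 = chart_inv c y"
    and "\<And>t. t \<in> {0..1} \<Longrightarrow> velocity A {0..1} \<gamma> t = tvec A c (\<gamma> t) (U t)"
    and "\<And>t. t \<in> {0..1} \<Longrightarrow> \<gamma> t \<in> fst c" "\<And>t. t \<in> {0..1} \<Longrightarrow> snd c (\<gamma> t) = X t"
    and "continuous_on {0..1} \<gamma>"
proof -
  have img: "X t \<in> snd c ` fst c" if "t \<in> {0..1}" for t using L.joinsD(5)[OF J that] R_sub by blast
  show in_c: "\<gamma> t \<in> fst c" if "t \<in> {0..1}" for t unfolding \<gamma>_def by (rule chart_inv_in[OF c img[OF that]])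
  show X: "snd c (\<gamma> t) = X t" if "t \<in> {0..1}" for t unfolding \<gamma>_def by (rule chart_chart_inv[OF c img[OF that]])
  show \<gamma>: "continuous_on {0..1} \<gamma>"
    unfolding \<gamma>_def using img
    by (intro continuous_on_compose2[OF continuous_chart_inv[OF c] spray_solution_continuous(1)[OF L.joinsD(1)[OF J]]]) auto
  have sol: "spray_solution (spray c) {0..1} (\<lambda>t. snd c (\<gamma> t)) U"
    by (rule spray_solution_cong[OF L.joinsD(1)[OF J]]) (simp_all add: X)
  show "geodesic_solution A g {0..1} \<gamma>"
    by (rule geodesic_of_spray_solution(1)[OF c \<gamma> _ sol]) (rule in_c)
  show "velocity A {0..1} \<gamma> t = tvec A c (\<gamma> t) (U t)" if "t \<in> {0..1}" for t
    by (rule geodesic_of_spray_solution(2)[OF c \<gamma> _ sol that]) (rule in_c)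
  show "\<gamma> 0 = chart_inv c x" "\<gamma> 1 = chart_inv c y" using L.joinsD(2,3)[OF J] by (simp_all add: \<gamma>_def)
qed

subsection \<open>Convexity\<close>

text \<open>In the chart the exponential map inverts \<open>vel0\<close>.\<close>

lemma exponential_in_chart:
  assumes q: "q \<in> patch \<epsilon>" and z: "z \<in> L.lens z0 \<epsilon>"
  shows "tvec A c q (L.vel0 (snd c q) z) \<in> exp_domain A g q"
    and "geod_exp A g q (tvec A c q (L.vel0 (snd c q) z)) = chart_inv c z"
proof -
  obtain X U where J: "L.joins (snd c q) z X U"
    using L.joins_exists[OF patchD(3)[OF q]] z lens_ball(2) by blast
  note \<gamma> = joins_geodesic[OF J]
  have "solution_with_velocity A g q (tvec A c q (L.vel0 (snd c q) z)) (\<lambda>t. chart_inv c (X t))"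
    using \<gamma>(1,2) \<gamma>(4)[of 0] chart_inv_chart[OF c patchD(1)[OF q]]
    by (simp add: solution_with_velocity_def L.vel_eq(1)[OF J])
  then show "tvec A c q (L.vel0 (snd c q) z) \<in> exp_domain A g q"
    and "geod_exp A g q (tvec A c q (L.vel0 (snd c q) z)) = chart_inv c z"
    using tvec_in_tangent_space[OF c patchD(1)[OF q]] geod_exp_eq \<gamma>(3)
    by (auto simp: exp_domain_def)
qed

lemma convex_normal_patch: "convex_normal A g (patch \<epsilon>)"
  unfolding convex_normal_def
proof (intro conjI ballI open_patch)
  fix q assume q: "q \<in> patch \<epsilon>"
  note qc = patchD(1)[OF q]
  define x where "x = snd c q"
  have x: "x \<in> L.lens z0 \<epsilon>" "x \<in> cball z0 r" using patchD[OF q] by (simp_all only: x_def)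
  define D where "D = L.lens z0 \<epsilon>"
  have D: "open D" "D \<subseteq> cball z0 r" using L.open_lens lens_ball(2) by (simp_all only: D_def)
  define V where "V = L.vel0 x ` D"
  have V: "open V" unfolding V_def by (rule L.open_vel0_image[OF x(2) D])
  have inj: "inj_on (L.vel0 x) D" using L.vel0_inj[OF x(2)] D(2) by (rule inj_on_subset)
  define E where "E = the_inv_into D (L.vel0 x)"
  have E: "E (L.vel0 x z) = z" if "z \<in> D" for z unfolding E_def by (rule the_inv_into_f_f[OF inj that])
  have EV: "E v \<in> D" "L.vel0 x (E v) = v" if "v \<in> V" for v using that E by (auto simp: V_def)
  have E_lip: "2-lipschitz_on V E"
  proof (rule lipschitz_onI)
    fix v w assume vw: "v \<in> V" "w \<in> V"
    have "norm (E v - E w) \<le> 2 * (norm (x - x) + norm (L.vel0 x (E v) - L.vel0 x (E w)))"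
      using EV(1)[OF vw(1)] EV(1)[OF vw(2)] D(2) x(2) by (intro L.vel_lipschitz(3)) blast+
    then show "dist (E v) (E w) \<le> 2 * dist v w" using EV(2) vw by (simp add: dist_norm)
  qed simp
  have vel_lip: "8-lipschitz_on D (L.vel0 x)"
  proof (rule lipschitz_onI)
    fix y z assume "y \<in> D" "z \<in> D"
    then have "norm (L.vel0 x y - L.vel0 x z) \<le> 8 * (norm (x - x) + norm (y - z))"
      using D(2) x(2) by (intro L.vel_lipschitz(1)) blast+
    then show "dist (L.vel0 x y) (L.vel0 x z) \<le> 8 * dist y z" by (simp add: dist_norm)
  qed simp
  define N where "N = {w \<in> tangent_space A q. w c \<in> V}"
  define h where "h y = tvec A c q (L.vel0 x (snd c y))" for y
  have N_tvec: "tvec A c q (w c) = w" if "w \<in> N" for w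
    using that tvec_of_tangent[OF c qc] by (simp add: N_def)
  have tvec_N: "tvec A c q v \<in> N" if "v \<in> V" for v
    using that tvec_in_tangent_space[OF c qc] tvec_self[OF c qc] by (simp add: N_def)
  have exp_vel: "geod_exp A g q (tvec A c q (L.vel0 x z)) = chart_inv c z" if "z \<in> D" for z
    using exponential_in_chart(2)[OF q] that by (simp add: x_def D_def)
  have exp_N: "geod_exp A g q w = chart_inv c (E (w c))" if w: "w \<in> N" for w
  proof -
    have "w c \<in> V" using w by (simp add: N_def)
    then show ?thesis using exp_vel[OF EV(1)] EV(2) N_tvec[OF w] by metis
  qed
  have exp_D: "snd c (geod_exp A g q w) = E (w c)" "geod_exp A g q w \<in> patch \<epsilon>" if w: "w \<in> N" for w
  proof -
    have "E (w c) \<in> D" using w EV(1) by (simp add: N_def)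
    then show "geod_exp A g q w \<in> patch \<epsilon>" using patchI exp_N[OF w] by (simp add: D_def)
    have "E (w c) \<in> snd c ` fst c" using \<open>E (w c) \<in> D\<close> D(2) r_sub by blast
    then show "snd c (geod_exp A g q w) = E (w c)" using chart_chart_inv[OF c] exp_N[OF w] by simp
  qed
  have contE: "continuous_on V E" using E_lip by (rule lipschitz_on_continuous_on)
  have ev: "continuous_on B (\<lambda>w. w c)" for B :: "('a, 'n) tvector set"
    by (rule continuous_on_subset[OF continuous_on_product_coordinates]) simp
  have "openin (top_of_set (tangent_space A q)) N"
  proof -
    have "open ((\<lambda>w::('a, 'n) tvector. w c) -` V)" by (rule open_vimage[OF V ev])
    moreover have "N = tangent_space A q \<inter> (\<lambda>w. w c) -` V" by (auto simp: N_def)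
    ultimately show ?thesis by (auto simp: openin_open)
  qed
  moreover have "\<forall>v\<in>N. \<forall>s\<in>{0..1}. (\<lambda>c. s *\<^sub>R v c) \<in> N"
  proof (intro ballI)
    fix w s assume w: "w \<in> N" and s: "s \<in> {0..1::real}"
    have "w c \<in> V" using w by (simp add: N_def)
    then have "s *\<^sub>R w c \<in> V"
      using L.vel0_image_starshaped[OF x(1) \<epsilon>(2) _ s] by (simp add: V_def D_def)
    then have "tvec A c q (s *\<^sub>R w c) \<in> N" by (rule tvec_N)
    then show "(\<lambda>c. s *\<^sub>R w c) \<in> N" by (simp add: tvec_scaleR[OF c qc] N_tvec[OF w])
  qed
  moreover have "N \<subseteq> exp_domain A g q"
  proof
    fix w assume w: "w \<in> N"
    then have v: "w c \<in> V" by (simp add: N_def)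
    show "w \<in> exp_domain A g q"
      using exponential_in_chart(1)[OF q, of "E (w c)"] EV[OF v] N_tvec[OF w] by (simp add: x_def D_def)
  qed
  moreover have "homeomorphism N (patch \<epsilon>) (geod_exp A g q) h"
  proof (rule homeomorphismI)
    have "continuous_on N (\<lambda>w. chart_inv c (E (w c)))"
    proof (rule continuous_on_compose2[OF continuous_chart_inv[OF c]])
      show "continuous_on N (\<lambda>w. E (w c))"
        by (rule continuous_on_compose2[OF contE ev]) (auto simp: N_def)
      show "(\<lambda>w. E (w c)) ` N \<subseteq> snd c ` fst c" using EV(1) D(2) r_sub by (auto simp: N_def)
    qed
    then show "continuous_on N (geod_exp A g q)" by (rule continuous_on_eq) (simp add: exp_N)
    have vc: "continuous_on (patch \<epsilon>) (\<lambda>y. L.vel0 x (snd c y))"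
    proof (rule continuous_on_compose2[OF lipschitz_on_continuous_on[OF vel_lip]])
      show "continuous_on (patch \<epsilon>) (snd c)"
        by (rule continuous_on_subset[OF continuous_chart[OF c]]) (auto simp: patch_def)
    qed (auto simp: patch_def D_def)
    show "continuous_on (patch \<epsilon>) h"
    proof (rule continuous_on_coordinatewise_then_product)
      fix c'
      show "continuous_on (patch \<epsilon>) (\<lambda>y. h y c')"
      proof (cases "c' \<in> A \<and> q \<in> fst c'")
        case True
        have "continuous_on UNIV (change_of_chart c c' q)"
          using linear_change[OF c _ qc] True by (intro linear_continuous_on linear_conv_bounded_linear[THEN iffD1]) auto
        from continuous_on_compose2[OF this vc] show ?thesis using True by (simp add: h_def tvec_def)
      next
        case False
        then have "h y c' = 0" for y unfolding h_def tvec_def by (simp only: if_False)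
        then show ?thesis by simp
      qed
    qed
    show "geod_exp A g q ` N \<subseteq> patch \<epsilon>" using exp_D(2) by blast
    show "h ` patch \<epsilon> \<subseteq> N" unfolding h_def using tvec_N by (auto simp: V_def D_def patch_def)
    show "h (geod_exp A g q w) = w" if w: "w \<in> N" for w
    proof -
      have v: "w c \<in> V" using w by (simp add: N_def)
      show ?thesis unfolding h_def exp_D(1)[OF w] EV(2)[OF v] by (rule N_tvec[OF w])
    qed
    show "geod_exp A g q (h y) = y" if y: "y \<in> patch \<epsilon>" for y
      using exp_vel[of "snd c y"] patchD(2)[OF y] chart_inv_chart[OF c patchD(1)[OF y]]
      by (simp add: h_def D_def)
  qed
  moreover have "loc_lipschitz_from_tangent A q N (geod_exp A g q)"
    unfolding loc_lipschitz_from_tangent_def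
  proof (intro ballI impI)
    fix c1 c2 assume c1: "c1 \<in> A" and c2: "c2 \<in> A" and q1: "q \<in> fst c1"
    define l where "l = change_of_chart c1 c q"
    have at: "tvec A c1 q u c = l u" for u by (simp add: l_def tvec_at[OF c qc])
    let ?U = "{u. tvec A c1 q u \<in> N \<and> geod_exp A g q (tvec A c1 q u) \<in> fst c2}"
    show "loc_lipschitz_on ?U (\<lambda>u. snd c2 (geod_exp A g q (tvec A c1 q u)))"
    proof (rule loc_lipschitz_on_if_eq[where F = "\<lambda>u. trans c c2 (E (l u))"])
      fix u assume u: "u \<in> ?U"
      then have w: "tvec A c1 q u \<in> N" "geod_exp A g q (tvec A c1 q u) \<in> fst c2" by auto
      have lu: "l u \<in> V" using w(1) at by (simp add: N_def)
      have ov: "E (l u) \<in> overlap c c2"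
        using in_overlap[OF patchD(1)[OF exp_D(2)[OF w(1)]] w(2)] exp_D(1)[OF w(1)] at by simp
      have "lip_near l u" unfolding l_def by (rule lip_near_linear[OF linear_change[OF c1 c q1 qc]])
      from lip_near_compose[OF this lip_near_if_lipschitz_on[OF E_lip V lu]]
      have "lip_near (\<lambda>u. E (l u)) u" .
      from lip_near_compose[OF this lip_near_trans[OF c c2 ov]]
      show "lip_near (\<lambda>u. trans c c2 (E (l u))) u" .
      show "snd c2 (geod_exp A g q (tvec A c1 q u)) = trans c c2 (E (l u))"
        using exp_N[OF w(1)] at by (simp add: trans_def)
    qed
  qed
  moreover have "loc_lipschitz_to_tangent A q (patch \<epsilon>) h"
    unfolding loc_lipschitz_to_tangent_def
  proof (intro ballI impI)
    fix c1 c2 assume c1: "c1 \<in> A" and c2: "c2 \<in> A" and q1: "q \<in> fst c1"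
    show "loc_lipschitz_on (snd c2 ` (patch \<epsilon> \<inter> fst c2)) (\<lambda>x. h (chart_inv c2 x) c1)"
    proof (rule loc_lipschitz_on_if_eq[where F = "\<lambda>y. change_of_chart c c1 q (L.vel0 x (trans c2 c y))"])
      fix y assume "y \<in> snd c2 ` (patch \<epsilon> \<inter> fst c2)"
      then obtain p where p: "p \<in> patch \<epsilon>" "p \<in> fst c2" "y = snd c2 p" by blast
      have ov: "y \<in> overlap c2 c" using p patchD(1)[OF p(1)] by (auto intro: in_overlap)
      have ty: "trans c2 c y \<in> D" using trans_chart[OF c2 p(2), of c] patchD(2)[OF p(1)] p(3) by (simp add: D_def)
      from lip_near_compose[OF lip_near_trans[OF c2 c ov] lip_near_if_lipschitz_on[OF vel_lip D(1) ty]]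
      have "lip_near (\<lambda>y. L.vel0 x (trans c2 c y)) y" .
      from lip_near_compose[OF this lip_near_linear[OF linear_change[OF c c1 qc q1]]]
      show "lip_near (\<lambda>y. change_of_chart c c1 q (L.vel0 x (trans c2 c y))) y" .
      show "h (chart_inv c2 y) c1 = change_of_chart c c1 q (L.vel0 x (trans c2 c y))"
        by (simp add: h_def tvec_at[OF c1 q1] trans_def)
    qed
  qed
  ultimately show "\<exists>N. openin (top_of_set (tangent_space A q)) N \<and>
      (\<forall>v\<in>N. \<forall>s\<in>{0..1}. (\<lambda>c. s *\<^sub>R v c) \<in> N) \<and> N \<subseteq> exp_domain A g q \<and>
      (\<exists>h. homeomorphism N (patch \<epsilon>) (geod_exp A g q) h \<and>
        loc_lipschitz_from_tangent A q N (geod_exp A g q) \<and> loc_lipschitz_to_tangent A q (patch \<epsilon>) h)"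
    by blast
qed

lemma strictly_convex_normal_patch: "strictly_convex_normal A g (patch \<epsilon>)"
  unfolding strictly_convex_normal_def
proof (intro conjI convex_normal_patch ballI impI)
  fix x y assume xy: "x \<in> closure (patch \<epsilon>)" "y \<in> closure (patch \<epsilon>)" "x \<noteq> y"
  have cp: "w \<in> fst c" "snd c w \<in> L.closed_lens z0 \<epsilon>" "snd c w \<in> cball z0 r" if "w \<in> closure (patch \<epsilon>)" for w
    using that closure_patch lens_ball(3) by (auto simp: closed_patch_def simp del: mem_cball)
  have ne: "snd c x \<noteq> snd c y"
    using xy chart_inv_chart[OF c cp(1)[OF xy(1)]] chart_inv_chart[OF c cp(1)[OF xy(2)]] by metis
  obtain X U where J: "L.joins (snd c x) (snd c y) X U"
    using L.joins_exists[OF cp(3)[OF xy(1)] cp(3)[OF xy(2)]] by blast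
  define \<gamma> where "\<gamma> t = chart_inv c (X t)" for t
  note \<gamma> = joins_geodesic[OF J, folded \<gamma>_def]
  have ends: "\<gamma> 0 = x" "\<gamma> 1 = y"
    using \<gamma>(2,3) chart_inv_chart[OF c cp(1)[OF xy(1)]] chart_inv_chart[OF c cp(1)[OF xy(2)]] by simp_all
  have inner: "\<gamma> ` {0<..<1} \<subseteq> patch \<epsilon>"
    using L.closed_lens_joins[OF J ne cp(2)[OF xy(1)] cp(2)[OF xy(2)]] patchI by (auto simp: \<gamma>_def)
  have "\<not> \<gamma> constant_on {0..1}"
  proof
    assume "\<gamma> constant_on {0..1}"
    then obtain k where "\<And>t. t \<in> {0..1} \<Longrightarrow> \<gamma> t = k" unfolding constant_on_def by blast
    from this[of 0] this[of 1] show False using ends xy(3) by simp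
  qed
  then have "inner_geodesic A g (patch \<epsilon>) x y \<gamma>"
    using \<gamma>(1) ends inner by (simp add: inner_geodesic_def geodesic_def)
  moreover have "\<gamma>' t = \<gamma> t" if \<gamma>': "inner_geodesic A g (patch \<epsilon>) x y \<gamma>'" and t: "t \<in> {0..1}" for \<gamma>' t
  proof -
    have sol: "geodesic_solution A g {0..1} \<gamma>'" and e': "\<gamma>' 0 = x" "\<gamma>' 1 = y"
      and i': "\<gamma>' ` {0<..<1} \<subseteq> patch \<epsilon>"
      using \<gamma>' unfolding inner_geodesic_def geodesic_def by blast+
    have clo: "\<gamma>' t \<in> closure (patch \<epsilon>)" if "t \<in> {0..1}" for t
    proof (cases "t = 0 \<or> t = 1")
      case True
      then show ?thesis using e' xy by blast
    next
      case False
      then have "\<gamma>' t \<in> patch \<epsilon>" using i' that by auto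
      then show ?thesis using closure_subset by blast
    qed
    have "spray_solution (spray c) {0..1} (\<lambda>t. snd c (\<gamma>' t)) (\<lambda>t. velocity A {0..1} \<gamma>' t c)"
      by (rule spray_solution_of_geodesic[OF sol c order_refl]) (rule cp(1)[OF clo])
    then have "L.joins (snd c (\<gamma>' 0)) (snd c (\<gamma>' 1)) (\<lambda>t. snd c (\<gamma>' t)) (\<lambda>t. velocity A {0..1} \<gamma>' t c)"
      by (rule L.joins_if_in_small_ball) (rule cp(3)[OF clo])
    then have "snd c (\<gamma>' t) = X t"
      using L.joins_unique(1)[OF _ J t] e' by simp
    then show ?thesis using chart_inv_chart[OF c cp(1)[OF clo[OF t]]] by (simp add: \<gamma>_def)
  qed
  ultimately show "\<exists>\<gamma>. inner_geodesic A g (patch \<epsilon>) x y \<gamma> \<and>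
      (\<forall>\<gamma>'. inner_geodesic A g (patch \<epsilon>) x y \<gamma>' \<longrightarrow> (\<forall>t\<in>{0..1}. \<gamma>' t = \<gamma> t))" by blast
qed

end

subsection \<open>Causality\<close>

lemma causal_curve_in_chart:
  assumes \<gamma>: "causal_curve A g \<alpha> \<beta> \<gamma>" and in_c: "\<And>t. t \<in> {\<alpha>..\<beta>} \<Longrightarrow> \<gamma> t \<in> fst c"
  defines "X \<equiv> \<lambda>t. snd c (\<gamma> t)" and "u \<equiv> \<lambda>t. velocity A {\<alpha>..\<beta>} \<gamma> t c"
  shows "\<And>t. t \<in> {\<alpha>..\<beta>} \<Longrightarrow> (X has_vector_derivative u t) (at t within {\<alpha>..\<beta>})"
    and "continuous_on {\<alpha>..\<beta>} X" "continuous_on {\<alpha>..\<beta>} u"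
    and "\<And>t. t \<in> {\<alpha>..\<beta>} \<Longrightarrow> mform (G c (X t)) (u t) (u t) \<le> 0" "\<And>t. t \<in> {\<alpha>..\<beta>} \<Longrightarrow> u t \<noteq> 0"
    and "\<And>t. t \<in> {\<alpha>..\<beta>} \<Longrightarrow> g (\<gamma> t) (velocity A {\<alpha>..\<beta>} \<gamma> t) (T (\<gamma> t)) = mform (G c (X t)) (u t) (Tc c (X t))"
proof -
  have ab: "\<alpha> < \<beta>" and cont: "continuous_on {\<alpha>..\<beta>} \<gamma>"
    and d: "\<And>t. t \<in> {\<alpha>..\<beta>} \<Longrightarrow> (snd c \<circ> \<gamma>) differentiable (at t within {\<alpha>..\<beta>})"
    and cv: "\<And>t. t \<in> {\<alpha>..\<beta>} \<Longrightarrow> causal_vector g (\<gamma> t) (velocity A {\<alpha>..\<beta>} \<gamma> t)"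
    using \<gamma> c in_c unfolding causal_curve_def C1_curve_on_def by blast+
  have "{t \<in> {\<alpha>..\<beta>}. \<gamma> t \<in> fst c} = {\<alpha>..\<beta>}" using in_c by auto
  moreover have "continuous_on {t \<in> {\<alpha>..\<beta>}. \<gamma> t \<in> fst c} u"
    using \<gamma> c unfolding causal_curve_def C1_curve_on_def u_def by blast
  ultimately show "continuous_on {\<alpha>..\<beta>} u" by simp
  have dX: "((snd c \<circ> \<gamma>) has_vector_derivative u t) (at t within {\<alpha>..\<beta>})" if "t \<in> {\<alpha>..\<beta>}" for t
    unfolding u_def by (rule velocity_chart[OF c in_c[OF that] d[OF that]])
  then show dX': "(X has_vector_derivative u t) (at t within {\<alpha>..\<beta>})" if "t \<in> {\<alpha>..\<beta>}" for t
    using that by (simp add: X_def o_def)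
  then show "continuous_on {\<alpha>..\<beta>} X"
    by (meson continuous_on_eq_continuous_within has_vector_derivative_continuous)
  have vel: "velocity A {\<alpha>..\<beta>} \<gamma> t = tvec A c (\<gamma> t) (u t)" if "t \<in> {\<alpha>..\<beta>}" for t
    by (rule velocity_tvec[OF ab that cont c in_c[OF that] dX[OF that]])
  show "mform (G c (X t)) (u t) (u t) \<le> 0" "u t \<noteq> 0" if t: "t \<in> {\<alpha>..\<beta>}" for t
    using cv[OF t] unfolding causal_vector_def vel[OF t] metric_in_chart[OF c in_c[OF t]] X_def
    by (simp_all add: tvec_eq_zero_iff[OF c in_c[OF t]])
  show "g (\<gamma> t) (velocity A {\<alpha>..\<beta>} \<gamma> t) (T (\<gamma> t)) = mform (G c (X t)) (u t) (Tc c (X t))"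
    if t: "t \<in> {\<alpha>..\<beta>}" for t
    unfolding vel[OF t] T_tvec[OF c in_c[OF t]] metric_in_chart[OF c in_c[OF t]] X_def ..
qed

text \<open>By continuity a causal curve is future directed throughout or past directed throughout, which fixes
the sign in \<open>lens_causally_convex\<close>.\<close>

lemma causally_convex_lens:
  assumes q: "q \<in> cball z0 r" and B: "B \<subseteq> fst c" "snd c ` B \<subseteq> cball z0 r"
  shows "causally_convex A g {y \<in> B. snd c y \<in> L.lens q \<delta>} B"
  unfolding causally_convex_def
proof (intro conjI allI impI)
  show "{y \<in> B. snd c y \<in> L.lens q \<delta>} \<subseteq> B" by blast
  fix \<alpha> \<beta> \<gamma>
  assume "causal_curve A g \<alpha> \<beta> \<gamma> \<and> \<gamma> ` {\<alpha>..\<beta>} \<subseteq> B \<and> \<gamma> \<alpha> \<in> {y \<in> B. snd c y \<in> L.lens q \<delta>} \<and>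
      \<gamma> \<beta> \<in> {y \<in> B. snd c y \<in> L.lens q \<delta>}"
  then have \<gamma>: "causal_curve A g \<alpha> \<beta> \<gamma>" and \<gamma>B: "\<gamma> ` {\<alpha>..\<beta>} \<subseteq> B"
    and e: "snd c (\<gamma> \<alpha>) \<in> L.lens q \<delta>" "snd c (\<gamma> \<beta>) \<in> L.lens q \<delta>" by blast+
  have ab: "\<alpha> < \<beta>" using \<gamma> by (simp add: causal_curve_def)
  have in_c: "\<gamma> t \<in> fst c" and ball: "snd c (\<gamma> t) \<in> cball z0 r" if "t \<in> {\<alpha>..\<beta>}" for t
    using \<gamma>B B that by blast+
  define X where "X t = snd c (\<gamma> t)" for t
  define u where "u t = velocity A {\<alpha>..\<beta>} \<gamma> t c" for t
  note cc = causal_curve_in_chart[OF \<gamma>, folded X_def u_def, OF in_c]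
  have dX: "(X has_vector_derivative u t) (at t within {\<alpha>..\<beta>})" and causal: "mform (G c (X t)) (u t) (u t) \<le> 0"
    and u0: "u t \<noteq> 0" and Xr: "X t \<in> cball z0 r" and XR: "X t \<in> cball z0 R" if "t \<in> {\<alpha>..\<beta>}" for t
    using cc(1,4,5) that ball[OF that] L.ball_subset unfolding X_def by blast+
  define f where "f t = mform (G c (X t)) (u t) (Tc c (X t))" for t
  have Xc: "continuous_on {\<alpha>..\<beta>} X" and uc: "continuous_on {\<alpha>..\<beta>} u" using cc(2,3) by blast+
  have fc: "continuous_on {\<alpha>..\<beta>} f"
    unfolding f_def
    by (intro continuous_intros uc continuous_on_compose2[OF L.G_continuous Xc]
        continuous_on_compose2[OF L.T_continuous Xc]) (use XR in blast)+
  have f0: "f t \<noteq> 0" if "t \<in> {\<alpha>..\<beta>}" for t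
    unfolding f_def by (rule L.causal_T[OF XR[OF that] u0[OF that] causal[OF that]])
  \<comment> \<open>The time orientation of the curve at its initial point.\<close>
  define \<sigma> :: real where "\<sigma> = (if f \<alpha> < 0 then 1 else -1)"
  have \<sigma>: "\<bar>\<sigma>\<bar> = 1" "\<sigma> \<noteq> 0" by (auto simp: \<sigma>_def)
  have \<sigma>f: "\<sigma> * f t < 0" if t: "t \<in> {\<alpha>..\<beta>}" for t
  proof (rule nonvanishing_negative[where f = "\<lambda>t. \<sigma> * f t"])
    show "continuous_on {\<alpha>..\<beta>} (\<lambda>t. \<sigma> * f t)" by (intro continuous_intros fc)
    show "\<sigma> * f t \<noteq> 0" if "t \<in> {\<alpha>..\<beta>}" for t using f0[OF that] \<sigma> by simp
    show "\<alpha> \<in> {\<alpha>..\<beta>}" using ab by simp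
    show "\<sigma> * f \<alpha> < 0" using f0[of \<alpha>] ab by (auto simp: \<sigma>_def)
  qed (rule t)
  have "X t \<in> L.lens q \<delta>" if t: "t \<in> {\<alpha>..\<beta>}" for t
    by (rule L.lens_causally_convex[OF dX Xr q causal \<sigma>f[unfolded f_def] \<sigma>(1) _ _ t])
       (use e in \<open>auto simp: X_def\<close>)
  then show "\<gamma> ` {\<alpha>..\<beta>} \<subseteq> {y \<in> B. snd c y \<in> L.lens q \<delta>}" using \<gamma>B by (auto simp: X_def)
qed

context
  fixes \<epsilon> :: real
  assumes \<epsilon>: "0 < \<epsilon>" "\<epsilon> \<le> r\<^sup>2"
begin

lemmas pD = patchD[OF \<epsilon>]

lemma strongly_causal_patch: "strongly_causal A g (patch \<epsilon>)"
  unfolding strongly_causal_def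
proof (intro conjI ballI allI impI open_patch[OF \<epsilon>])
  fix x W assume x: "x \<in> patch \<epsilon>" and W: "open W \<and> x \<in> W"
  have "open (snd c ` (fst c \<inter> W))" by (rule open_chart_image) (use W in blast)
  moreover have "snd c x \<in> snd c ` (fst c \<inter> W)" using pD(1)[OF x] W by blast
  ultimately obtain s where s: "0 < s" "ball (snd c x) s \<subseteq> snd c ` (fst c \<inter> W)"
    by (meson open_contains_ball)
  define V where "V = {y \<in> patch \<epsilon>. snd c y \<in> L.lens (snd c x) (s\<^sup>2)}"
  have "V = patch \<epsilon> \<inter> {y \<in> fst c. snd c y \<in> L.lens (snd c x) (s\<^sup>2)}"
    using pD(1) by (auto simp: V_def)
  then have "open V" using open_patch[OF \<epsilon>] open_chart_preimage[OF L.open_lens] by (simp add: open_Int)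
  moreover have "x \<in> V" using x s(1) L.center_in_lens[of "s\<^sup>2"] by (simp add: V_def)
  moreover have "V \<subseteq> W"
  proof
    fix y assume y: "y \<in> V"
    then have "snd c y \<in> ball (snd c x) s"
      using L.lens_subset_ball(1)[OF s(1) order_refl, of "snd c x"] by (auto simp: V_def simp del: mem_ball)
    then obtain y' where y': "y' \<in> fst c" "y' \<in> W" "snd c y = snd c y'" using s(2) by blast
    have "y \<in> fst c" using y pD(1) by (simp add: V_def)
    then have "y = y'" using chart_inv_chart[OF c] y' by metis
    then show "y \<in> W" using y' by simp
  qed
  moreover have "causally_convex A g V (patch \<epsilon>)"
    unfolding V_def by (rule causally_convex_lens) (use x pD in \<open>blast+\<close>)
  ultimately show "\<exists>V. open V \<and> x \<in> V \<and> V \<subseteq> W \<and> causally_convex A g V (patch \<epsilon>)" by blast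
qed

lemma future_causal_curve_of_joins:
  assumes J: "L.joins x y X U" and f: "L.future_curve X U 0 1"
  shows "future_causal_curve A g T 0 1 (\<lambda>t. chart_inv c (X t))"
proof -
  define \<gamma> where "\<gamma> t = chart_inv c (X t)" for t
  note \<gamma> = joins_geodesic[OF \<epsilon> J, folded \<gamma>_def]
  note fD = L.future_curveD[OF f]
  have dX: "((snd c \<circ> \<gamma>) has_vector_derivative U t) (at t within {0..1})" if "t \<in> {0..1}" for t
    by (rule has_vector_derivative_transform[OF that _ fD(2)[OF that]]) (simp add: \<gamma>(6))
  have "C1_curve_on A {0..1} \<gamma>"
    by (rule C1_curve_onI[OF _ c \<gamma>(7,5) dX spray_solution_continuous(2)[OF L.joinsD(1)[OF J]]]) simp_all
  moreover have "causal_vector g (\<gamma> t) (velocity A {0..1} \<gamma> t) \<and> g (\<gamma> t) (velocity A {0..1} \<gamma> t) (T (\<gamma> t)) < 0"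
    if t: "t \<in> {0..1}" for t
  proof -
    have "U t \<noteq> 0" using fD(6)[OF t] by (auto simp: mform_simps)
    then show ?thesis
      using fD(5,6)[OF t]
      unfolding causal_vector_def \<gamma>(4)[OF t] T_tvec[OF c \<gamma>(5)[OF t]] metric_in_chart[OF c \<gamma>(5)[OF t]] \<gamma>(6)[OF t]
      by (simp add: tvec_eq_zero_iff[OF c \<gamma>(5)[OF t]])
  qed
  ultimately have "future_causal_curve A g T 0 1 \<gamma>"
    by (simp add: future_causal_curve_def causal_curve_def)
  then show ?thesis by (simp add: \<gamma>_def[abs_def])
qed

text \<open>One direction is the causal geodesic between the endpoints of a causal curve; for the other, that
geodesic itself is a causal curve, and it stays in the lens by convexity.\<close>

lemma Jplus_patch:
  "(x, y) \<in> Jplus A g T (patch \<epsilon>) \<longleftrightarrow>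
     x \<in> patch \<epsilon> \<and> y \<in> patch \<epsilon> \<and> L.causal_pair (snd c x) (snd c y)"
proof
  assume xy: "(x, y) \<in> Jplus A g T (patch \<epsilon>)"
  then have x: "x \<in> patch \<epsilon>" and y: "y \<in> patch \<epsilon>" by (auto simp: Jplus_def)
  have "L.causal_pair (snd c x) (snd c y)"
  proof (cases "x = y")
    case True
    have "snd c x \<in> cball z0 R" using pD(3)[OF x] L.ball_subset by blast
    then show ?thesis using True L.causal_pair_refl by simp
  next
    case False
    then obtain \<alpha> \<beta> \<gamma> where \<gamma>: "future_causal_curve A g T \<alpha> \<beta> \<gamma>" "\<gamma> \<alpha> = x" "\<gamma> \<beta> = y" "\<gamma> ` {\<alpha>..\<beta>} \<subseteq> patch \<epsilon>"
      using xy by (auto simp: Jplus_def)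
    have cc: "causal_curve A g \<alpha> \<beta> \<gamma>" and ab: "\<alpha> < \<beta>"
      using \<gamma>(1) by (auto simp: future_causal_curve_def causal_curve_def)
    have in_c: "\<gamma> t \<in> fst c" and ball: "snd c (\<gamma> t) \<in> cball z0 r" if "t \<in> {\<alpha>..\<beta>}" for t
      using \<gamma>(4) that pD by blast+
    note k = causal_curve_in_chart[OF cc in_c]
    have "L.future_curve (\<lambda>t. snd c (\<gamma> t)) (\<lambda>t. velocity A {\<alpha>..\<beta>} \<gamma> t c) \<alpha> \<beta>"
      unfolding L.future_curve_def
    proof (intro conjI ballI ab)
      fix t assume t: "t \<in> {\<alpha>..\<beta>}"
      show "((\<lambda>t. snd c (\<gamma> t)) has_vector_derivative velocity A {\<alpha>..\<beta>} \<gamma> t c) (at t within {\<alpha>..\<beta>})"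
        by (rule k(1)[OF _ t])
      show "mform (G c (snd c (\<gamma> t))) (velocity A {\<alpha>..\<beta>} \<gamma> t c) (velocity A {\<alpha>..\<beta>} \<gamma> t c) \<le> 0"
        by (rule k(4)[OF _ t])
      show "snd c (\<gamma> t) \<in> cball z0 r" by (rule ball[OF t])
      have "g (\<gamma> t) (velocity A {\<alpha>..\<beta>} \<gamma> t) (T (\<gamma> t)) < 0"
        using \<gamma>(1) t by (simp add: future_causal_curve_def)
      then show "mform (G c (snd c (\<gamma> t))) (velocity A {\<alpha>..\<beta>} \<gamma> t c) (Tc c (snd c (\<gamma> t))) < 0"
        using k(6)[OF _ t] by simp
    qed
    from L.causal_pair_if_future_curve[OF this] show ?thesis using pD(4)[OF x] \<gamma>(2,3) by simp
  qed
  then show "x \<in> patch \<epsilon> \<and> y \<in> patch \<epsilon> \<and> L.causal_pair (snd c x) (snd c y)" using x y by blast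
next
  assume a: "x \<in> patch \<epsilon> \<and> y \<in> patch \<epsilon> \<and> L.causal_pair (snd c x) (snd c y)"
  then have x: "x \<in> patch \<epsilon>" and y: "y \<in> patch \<epsilon>" and cp: "L.causal_pair (snd c x) (snd c y)" by blast+
  show "(x, y) \<in> Jplus A g T (patch \<epsilon>)"
  proof (cases "x = y")
    case True
    then show ?thesis using x by (simp add: Jplus_def)
  next
    case False
    have ix: "chart_inv c (snd c x) = x" and iy: "chart_inv c (snd c y) = y"
      using chart_inv_chart[OF c] pD(1) x y by blast+
    have ne: "snd c x \<noteq> snd c y" using ix iy False by metis
    obtain X U where J: "L.joins (snd c x) (snd c y) X U"
      using L.joins_exists[OF pD(3)[OF x] pD(3)[OF y]] by blast
    have lens: "X t \<in> L.lens z0 \<epsilon>" if "t \<in> {0..1}" for t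
      by (rule L.lens_joins[OF J pD(2)[OF x] pD(2)[OF y] that])
    have "L.future_curve X U 0 1"
      by (rule L.future_curve_if_causal_pair[OF J ne cp]) (use lens lens_ball(2)[OF \<epsilon>] in blast)
    from future_causal_curve_of_joins[OF J this]
    have "\<exists>a b \<gamma>. future_causal_curve A g T a b \<gamma> \<and> \<gamma> a = x \<and> \<gamma> b = y \<and> \<gamma> ` {a..b} \<subseteq> patch \<epsilon>"
      using L.joinsD(2,3)[OF J] ix iy lens patchI[OF \<epsilon>]
      by (intro exI[of _ 0] exI[of _ 1] exI[of _ "\<lambda>t. chart_inv c (X t)"]) auto
    then show ?thesis using x y by (simp add: Jplus_def)
  qed
qed

lemma globally_hyperbolic_patch: "globally_hyperbolic A g T (patch \<epsilon>)"
  unfolding globally_hyperbolic_def causally_simple_def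
proof (intro conjI ballI open_patch[OF \<epsilon>] strongly_causal_patch)
  let ?Q = "{p \<in> cball z0 r \<times> cball z0 r. L.causal_pair (fst p) (snd p)}"
  let ?f = "\<lambda>p. (snd c (fst p), snd c (snd p))"
  have "continuous_on (patch \<epsilon> \<times> patch \<epsilon>) ?f"
    by (intro continuous_intros continuous_on_compose2[OF continuous_chart[OF c]]) (use pD(1) in auto)
  from continuous_closedin_preimage[OF this L.closed_causal_pair]
  have "closedin (top_of_set (patch \<epsilon> \<times> patch \<epsilon>)) ((patch \<epsilon> \<times> patch \<epsilon>) \<inter> ?f -` ?Q)" .
  moreover have "(patch \<epsilon> \<times> patch \<epsilon>) \<inter> ?f -` ?Q = Jplus A g T (patch \<epsilon>)"
  proof (intro set_eqI)
    fix p :: "'a \<times> 'a"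
    obtain x y where p: "p = (x, y)" by (cases p)
    have "p \<in> (patch \<epsilon> \<times> patch \<epsilon>) \<inter> ?f -` ?Q \<longleftrightarrow>
        x \<in> patch \<epsilon> \<and> y \<in> patch \<epsilon> \<and> L.causal_pair (snd c x) (snd c y)"
      unfolding p using pD(3) by (auto simp del: mem_cball)
    then show "p \<in> (patch \<epsilon> \<times> patch \<epsilon>) \<inter> ?f -` ?Q \<longleftrightarrow> p \<in> Jplus A g T (patch \<epsilon>)"
      unfolding p Jplus_patch .
  qed
  ultimately show "closedin (top_of_set (patch \<epsilon> \<times> patch \<epsilon>)) (Jplus A g T (patch \<epsilon>))" by simp
next
  fix x y assume x: "x \<in> patch \<epsilon>" and y: "y \<in> patch \<epsilon>"
  let ?D = "{z \<in> L.lens z0 \<epsilon>. L.causal_pair (snd c x) z \<and> L.causal_pair z (snd c y)}"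
  have "compact ?D" by (rule L.compact_diamond[OF pD(2)[OF x] pD(2)[OF y] \<epsilon>(2)])
  moreover have "continuous_on ?D (chart_inv c)"
    by (rule continuous_on_subset[OF continuous_chart_inv[OF c]]) (use lens_ball(2)[OF \<epsilon>] r_sub in blast)
  ultimately have "compact (chart_inv c ` ?D)" by (intro compact_continuous_image)
  moreover have "chart_inv c ` ?D = {z. (x, z) \<in> Jplus A g T (patch \<epsilon>)} \<inter> {z. (z, y) \<in> Jplus A g T (patch \<epsilon>)}"
    unfolding Jplus_patch
  proof (intro equalityI subsetI)
    fix w assume "w \<in> chart_inv c ` ?D"
    then obtain z where z: "z \<in> ?D" "w = chart_inv c z" by blast
    have "z \<in> snd c ` fst c" using z(1) lens_ball(2)[OF \<epsilon>] r_sub by blast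
    then have "snd c w = z" using chart_chart_inv[OF c] z(2) by simp
    then show "w \<in> {z. x \<in> patch \<epsilon> \<and> z \<in> patch \<epsilon> \<and> L.causal_pair (snd c x) (snd c z)} \<inter>
        {z. z \<in> patch \<epsilon> \<and> y \<in> patch \<epsilon> \<and> L.causal_pair (snd c z) (snd c y)}"
      using z x y patchI[OF \<epsilon>] by simp
  next
    fix w assume w: "w \<in> {z. x \<in> patch \<epsilon> \<and> z \<in> patch \<epsilon> \<and> L.causal_pair (snd c x) (snd c z)} \<inter>
        {z. z \<in> patch \<epsilon> \<and> y \<in> patch \<epsilon> \<and> L.causal_pair (snd c z) (snd c y)}"
    then have "w = chart_inv c (snd c w)" using chart_inv_chart[OF c] pD(1) by simp
    moreover have "snd c w \<in> ?D" using w pD(2) by simp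
    ultimately show "w \<in> chart_inv c ` ?D" by (rule image_eqI)
  qed
  ultimately show "compact ({z. (x, z) \<in> Jplus A g T (patch \<epsilon>)} \<inter> {z. (z, y) \<in> Jplus A g T (patch \<epsilon>)})"
    by simp
qed

end

lemma causally_convex_patch:
  assumes "0 < \<delta>" "\<delta> \<le> \<epsilon>" "\<epsilon> \<le> r\<^sup>2"
  shows "causally_convex A g (patch \<delta>) (patch \<epsilon>)"
proof -
  have \<epsilon>: "0 < \<epsilon>" "\<epsilon> \<le> r\<^sup>2" using assms by auto
  have "L.lens z0 \<delta> \<subseteq> L.lens z0 \<epsilon>" using assms(2) by (auto simp: L.lens_def)
  then have "patch \<delta> = {y \<in> patch \<epsilon>. snd c y \<in> L.lens z0 \<delta>}" by (auto simp: patch_def)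
  moreover have "causally_convex A g {y \<in> patch \<epsilon>. snd c y \<in> L.lens z0 \<delta>} (patch \<epsilon>)"
    by (rule causally_convex_lens) (use L.r(1) patchD[OF \<epsilon>] in \<open>auto simp del: mem_cball intro: centre_in_cball[THEN iffD2]\<close>)
  ultimately show ?thesis by simp
qed

lemma patches_shrink:
  assumes p: "p \<in> fst c" "snd c p = z0" and W: "open W" "p \<in> W"
  shows "\<exists>s>0. patch (s\<^sup>2) \<subseteq> W"
proof -
  have "open (snd c ` (fst c \<inter> W))" by (rule open_chart_image[OF W(1)])
  moreover have "z0 \<in> snd c ` (fst c \<inter> W)" using p W by blast
  ultimately obtain s where s: "0 < s" "ball z0 s \<subseteq> snd c ` (fst c \<inter> W)" by (meson open_contains_ball)
  have "patch (s\<^sup>2) \<subseteq> W"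
  proof
    fix y assume y: "y \<in> patch (s\<^sup>2)"
    then have "y \<in> fst c" "snd c y \<in> L.lens z0 (s\<^sup>2)" by (simp_all add: patch_def)
    then have "snd c y \<in> ball z0 s" using L.lens_subset_ball(1)[OF s(1) order_refl, of z0] by blast
    then obtain y' where y': "y' \<in> fst c" "y' \<in> W" "snd c y = snd c y'" using s(2) by blast
    have "y = y'" using chart_inv_chart[OF c] \<open>y \<in> fst c\<close> y' by metis
    then show "y \<in> W" using y' by simp
  qed
  then show ?thesis using s(1) by blast
qed

lemma local_base_of_patches:
  assumes p: "p \<in> fst c" "snd c p = z0"
  shows "\<exists>C :: nat \<Rightarrow> 'a set. local_base_at p C \<and>
    (\<forall>i. strictly_convex_normal A g (C i) \<and> globally_hyperbolic A g T (C i) \<and>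
         closure (C (Suc i)) \<subseteq> C i \<and> causally_convex A g (C (Suc i)) (C i) \<and>
         causally_convex A g (C (Suc i)) (C 0))"
proof (intro exI conjI allI)
  define e where "e i = r\<^sup>2 / real (Suc i)" for i
  let ?C = "\<lambda>i. patch (e i)"
  have e: "0 < e i" "e i \<le> r\<^sup>2" "e (Suc i) < e i" for i
  proof -
    have r2: "0 < r\<^sup>2" using L.r(1) by simp
    then show "0 < e i" "e (Suc i) < e i" by (simp_all add: e_def frac_less2)
    have "r\<^sup>2 / real (Suc i) \<le> r\<^sup>2 / 1" using r2 by (intro divide_left_mono) auto
    then show "e i \<le> r\<^sup>2" by (simp add: e_def)
  qed
  show "strictly_convex_normal A g (?C i)" "globally_hyperbolic A g T (?C i)" for i
    by (rule strictly_convex_normal_patch[OF e(1,2)] globally_hyperbolic_patch[OF e(1,2)])+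
  show "causally_convex A g (?C (Suc i)) (?C i)" for i
    by (rule causally_convex_patch[OF e(1) less_imp_le[OF e(3)] e(2)])
  show "causally_convex A g (?C (Suc i)) (?C 0)" for i
    by (rule causally_convex_patch[OF e(1) _ e(2)]) (use e(2)[of "Suc i"] in \<open>simp add: e_def\<close>)
  show "closure (?C (Suc i)) \<subseteq> ?C i" for i
  proof -
    have "closed_patch (e (Suc i)) \<subseteq> ?C i"
      using L.closed_lens_subset_lens[OF e(3)] unfolding closed_patch_def patch_def by blast
    then show ?thesis using closure_patch[OF e(1,2), of "Suc i"] by blast
  qed
  show "local_base_at p ?C"
    unfolding local_base_at_def
  proof (intro conjI allI impI)
    show "open (?C i)" for i by (rule open_patch[OF e(1,2)])
    show "p \<in> ?C i" for i using p L.center_in_lens[OF e(1)] by (simp add: patch_def)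
    fix W assume "open W \<and> p \<in> W"
    then obtain s where s: "0 < s" "patch (s\<^sup>2) \<subseteq> W" using patches_shrink[OF p] by blast
    obtain n where n: "r\<^sup>2 / s\<^sup>2 < real n" using reals_Archimedean2 by blast
    have "r\<^sup>2 < real n * s\<^sup>2" using n s(1) by (simp add: pos_divide_less_eq)
    also have "\<dots> \<le> real (Suc n) * s\<^sup>2" by (intro mult_right_mono) auto
    finally have "e n \<le> s\<^sup>2" by (simp add: e_def pos_divide_le_eq mult.commute)
    then have "?C n \<subseteq> patch (s\<^sup>2)" by (auto simp: patch_def L.lens_def)
    then show "\<exists>i. ?C i \<subseteq> W" using s(2) by blast
  qed
qed

end

end

theorem corollary2:
  fixes A :: "('a::t2_space, 'n::finite) chart set"
    and g :: "('a, 'n) metric"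
    and T :: "'a \<Rightarrow> ('a, 'n) tvector"
    and p :: 'a
  assumes "C21_manifold A"
    and "C11_lorentzian_metric A g"
    and "time_orientation A g T"
  shows "\<exists>C :: nat \<Rightarrow> 'a set.
           local_base_at p C \<and>
           (\<forall>i. strictly_convex_normal A g (C i) \<and>
                globally_hyperbolic A g T (C i) \<and>
                closure (C (Suc i)) \<subseteq> C i \<and>
                causally_convex A g (C (Suc i)) (C i) \<and>
                causally_convex A g (C (Suc i)) (C 0))"
proof -
  interpret lorentz_manifold A g T
    by unfold_locales (use assms in \<open>auto simp: C21_manifold_def\<close>)
  obtain c where c: "c \<in> A" "p \<in> fst c"
    using atlas unfolding C21_atlas_def by blast
  obtain \<tau> R K m \<rho> r a where "cball (snd c p) R \<subseteq> snd c ` fst c"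
      "local_lorentz (G c) (DG c) (spray c) (Tc c) \<tau> (snd c p) R K m \<rho> r a"
    using local_lorentz_chart[OF c(1)] c(2) by blast
  from local_base_of_patches[OF c(1) this c(2) refl] show ?thesis .
qed

end
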